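(* Suppose that Assumption A (stated in the context) holds, and let $(\widehat{\Delta z},\widehat{\Delta\lambda},\widehat{\Delta s})$ be the step calculated in the finite-precision environment described in the context by using the procedure condensed. Then there is a constant $\hat C$ such that for all $\tau\in(0,1/2]$ and all $\alpha$ satisfying $$\alpha\in[0,\,1-\hat C\tau^{-1}(\mathbf u/\mu+\mu)],$$ the following relaxed form of the approximate centrality conditions holds: $$\|r_f(z+\alpha\widehat{\Delta z},\lambda+\alpha\widehat{\Delta\lambda})\|\le C(1+\tau)\,\mu(\lambda+\alpha\widehat{\Delta\lambda},s+\alpha\widehat{\Delta s}),$$ $$\|r_g(z+\alpha\widehat{\Delta z},s+\alpha\widehat{\Delta s})\|\le C(1+\tau)\,\mu(\lambda+\alpha\widehat{\Delta\lambda},s+\alpha\widehat{\Delta s}),$$ $$(\lambda_i+\alpha\widehat{\Delta\lambda}_i)(s_i+\alpha\widehat{\Delta s}_i)\ge\gamma(1-\tau)\,\mu(\lambda+\alpha\widehat{\Delta\lambda},s+\alpha\widehat{\Delta s}),\quad i=1,\dots,m,$$ where $C,\gamma$ are the constants from the centrality conditions in Assumption A. Moreover, when $\alpha$ is set to its upper bound $1-\hat C\tau^{-1}(\mathbf u/\mu+\mu)$ (in case this is nonnegative), $$\delta(z+\alpha\widehat{\Delta z},\lambda+\alpha\widehat{\Delta\lambda})\le\tau^{-1}(\delta_{\mathbf u}+O(\mu^2)).$$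
   Context: (NLP) is $\min_z\phi(z)$ subject to $g(z)\le0$, where $\phi:\mathbb{R}^n\to\mathbb{R}$ and $g:\mathbb{R}^n\to\mathbb{R}^m$ are twice Lipschitz continuously differentiable. $\mathcal{L}(z,\lambda)=\phi(z)+\lambda^Tg(z)$; $\mathcal{L}_z$, $\mathcal{L}_{zz}$ are its gradient and Hessian in $z$. $r_f(z,\lambda)=\mathcal{L}_z(z,\lambda)$, $r_g(z,s)=g(z)+s$, $\mu(\lambda,s)=\lambda^Ts/m$, and $\mu$ without arguments is evaluated at the current iterate. $\nabla g(z)=[\nabla g_1(z),\dots,\nabla g_m(z)]$. KKT conditions: $\mathcal{L}_z(z,\lambda)=0$, $g(z)\le0$, $\lambda\ge0$, $\lambda^Tg(z)=0$. $\mathcal{S}_\lambda$ is the set of $\lambda^*$ such that $(z^*,\lambda^* )$ satisfies the KKT conditions, $\mathcal{S}=\{z^*\}\times\mathcal{S}_\lambda$, $\delta(z,\lambda)$ is the Euclidean distance from $(z,\lambda)$ to $\mathcal{S}$. $\mathcal{B}=\{i:g_i(z^* )=0\}$, $\mathcal{N}=\{1,\dots,m\}\setminus\mathcal{B}$, $\mathcal{B}_+=\{i\in\mathcal{B}:\lambda_i^*>0\text{ for some }\lambda^*\in\mathcal{S}_\lambda\}$. Subscripts $\mathcal{B},\mathcal{N}$ denote subvectors/submatrices; $\nabla g_{\mathcal{B}}(z)$ has columns $\nabla g_i(z)$, $i\in\mathcal{B}$. $S=\mathrm{diag}(s)$, $\Lambda=\mathrm{diag}(\lambda)$, $D=\Lambda^{-1}S$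 (with diagonal blocks $D_{\mathcal{B}},D_{\mathcal{N}}$). SVD: $\nabla g_{\mathcal{B}}(z^* )=\begin{bmatrix}\hat U&\hat V\end{bmatrix}\begin{bmatrix}\Sigma&0\\ 0&0\end{bmatrix}\begin{bmatrix}U^T\\ V^T\end{bmatrix}=\hat U\Sigma U^T$ with $[\hat U\ \hat V]$, $[U\ V]$ orthogonal and $\Sigma$ diagonal with positive diagonal. $\sigma_{\min}$ denotes smallest eigenvalue. Assumption A. (a) $z^*$ is a solution of (NLP), so the KKT conditions hold ($\mathcal{S}_\lambda\neq\emptyset$). MFCQ: there is $\bar y$ with $\nabla g_{\mathcal{B}}(z^* )^T\bar y<0$. Second-order conditions: there is $\xi>0$ with $w^T\mathcal{L}_{zz}(z^*,\lambda^* )w\ge\xi\|w\|^2$ for all $\lambda^*\in\mathcal{S}_\lambda$ and all $w$ with $\nabla g_i(z^* )^Tw=0$ ($i\in\mathcal{B}_+$), $\nabla g_i(z^* )^Tw\le0$ ($i\in\mathcal{B}\setminus\mathcal{B}_+$). SC: some $\lambda^*\in\mathcal{S}_\lambda$ has $\lambda_i^*>0$ for all $i\in\mathcal{B}$. The current iterate $(z,\lambda,s)$ satisfies the centrality conditions, with $\mu=\lambda^Ts/m$ and fixed constants $C>0$, $\gamma\in(0,1)$: $\|\mathcal{L}_z(z,\lambda)\|\le C\mu$, $\|g(z)+s\|\le C\mu$, $(\lambda,s)>0$, $\lambda_is_i\ge\gamma\mu$ for all $i$. The vector $t\in\mathbb{R}^m$ satisfies $t=O(\mu^2)$. (b) For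 a sufficiently large $\beta>0$: $\mathbf u/\mu\ll1$, $\mathbf u\ll1$, $\sigma_{\min}(\Sigma)\ge\beta\max(\mu^{1/3},\mathbf u/\mu)$, and $\sigma_{\min}(\hat V^T\mathcal{L}_{zz}(z^*,\lambda^* )\hat V)\ge\beta\max(\mu^{1/3},\mathbf u/\mu)$ for all $\lambda^*\in\mathcal{S}_\lambda$. Procedure condensed: given $(z,\lambda,s)$, form and solve $[\mathcal{L}_{zz}(z,\lambda)+\nabla g(z)D^{-1}\nabla g(z)^T]\Delta z=-\mathcal{L}_z(z,\lambda)-\nabla g(z)D^{-1}[g(z)-\Lambda^{-1}t]$ by a backward stable algorithm; then set $\Delta\lambda=D^{-1}[g(z)-\Lambda^{-1}t+\nabla g(z)^T\Delta z]$; then set $\Delta s=-(g(z)+s)-\nabla g(z)^T\Delta z$. Finite-precision environment: $z,\lambda,s,t$ are floating-point vectors. $\mathbf u$ is the unit roundoff: for floating-point numbers $x,y$ and $\mathrm{op}\in\{+,-,\times,/\}$, $fl(x\,\mathrm{op}\,y)=(x\,\mathrm{op}\,y)(1+\epsilon)$ with $|\epsilon|\le\mathbf u$. The computed values of $\mathcal{L}_{zz}(z,\lambda)$, $\mathcal{L}_z(z,\lambda)$, $\nabla g(z)$, $g(z)$ are $\mathcal{L}_{zz}(z,\lambda)+\bar F$, $\mathcal{L}_z(z,\lambda)+\bar f$, $\nabla g(z)+F$, $g(z)+f$ with $\bar F,\bar f,F,f$ all of size $\delta_{\mathbf u}$. The computed $D^{-1}$ is $(D+G)^{-1}$ with $G$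 diagonal, $G_{\mathcal{B}}=\mu\,\delta_{\mathbf u}$, $G_{\mathcal{N}}=\delta_{\mathbf u}/\mu$. Roundoff in forming the linear system from these computed quantities and in the backward stable solve is accounted for by a matrix $\hat F=\delta_{\mathbf u}/\mu$ and a vector $\hat f=\delta_{\mathbf u}$: $\widehat{\Delta z}$ is the exact solution of $$[\mathcal{L}_{zz}(z,\lambda)+\bar F+(\nabla g(z)+F)(D+G)^{-1}(\nabla g(z)+F)^T+\hat F]\widehat{\Delta z}=-\mathcal{L}_z(z,\lambda)-\bar f-(\nabla g(z)+F)(D+G)^{-1}[g(z)+f-\Lambda^{-1}t]+\hat f.$$ Then $\widehat{\Delta\lambda}$ and $\widehat{\Delta s}$ are obtained by carrying out the last two assignments of the procedure in floating-point arithmetic (each operation obeying the model above), using $\widehat{\Delta z}$ and the computed values of $g(z)$, $\nabla g(z)$, $D^{-1}$. Conventions: $O(\epsilon)$ means norm at most a constant times $\epsilon$; $\delta_{\mathbf u}$ denotes any quantity of norm at most a constant times $\mathbf u$. Precisely: for fixed problem, $z^*$, $C,\gamma$ and every choice of the constants implicit in the hypotheses, there exist $\epsilon,\eta,\beta_0,K',\hat C>0$ depending only on these (in particular not on $\tau$, $\mu$, $\mathbf u$ or the iterate) such that, whenever the hypotheses hold with $\delta(z,\lambda)\le\epsilon$, $\mu\le\epsilon$, $\mathbf u/\mu\le\eta$, $\mathbf u\le\eta$, $\beta\ge\beta_0$, the conclusions hold with all implied constants equal to $K'$. *)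

theory Defs
  imports "HOL-Analysis.Analysis" "HOL-Library.Multiset"
begin

definition grad :: "(real^'n \<Rightarrow> real) \<Rightarrow> real^'n \<Rightarrow> real^'n" where
  "grad f z = (\<chi> j. frechet_derivative f (at z) (axis j 1))"

definition hess :: "(real^'n \<Rightarrow> real) \<Rightarrow> real^'n \<Rightarrow> real^'n^'n" where
  "hess f z = jacobian (grad f) (at z)"

text \<open>The Lipschitz condition on the second derivative is local: a globally Lipschitz Hessian
  is a special case.\<close>

definition twice_lipschitz_diff :: "(real^'n \<Rightarrow> real) \<Rightarrow> bool" where
  "twice_lipschitz_diff f \<longleftrightarrow>
     (\<forall>z. f differentiable (at z)) \<and> (\<forall>z. grad f differentiable (at z)) \<and>
     (\<forall>z. \<exists>\<rho>>0. \<exists>L. L-lipschitz_on (ball z \<rho>) (hess f))"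

definition grad_cols :: "(real^'n \<Rightarrow> real^'m) \<Rightarrow> real^'n \<Rightarrow> real^'m^'n" where
  "grad_cols g z = (\<chi> j i. grad (\<lambda>y. g y $ i) z $ j)"

definition diag :: "real^'m \<Rightarrow> real^'m^'m" where
  "diag v = (\<chi> i j. if i = j then v $ i else 0)"

subsection \<open>The nonlinear program and its KKT conditions\<close>

definition lagrangian ::
    "(real^'n \<Rightarrow> real) \<Rightarrow> (real^'n \<Rightarrow> real^'m) \<Rightarrow> real^'n \<Rightarrow> real^'m \<Rightarrow> real" where
  "lagrangian \<phi> g z lam = \<phi> z + lam \<bullet> g z"

definition lagr_z ::
    "(real^'n \<Rightarrow> real) \<Rightarrow> (real^'n \<Rightarrow> real^'m) \<Rightarrow> real^'n \<Rightarrow> real^'m \<Rightarrow> real^'n" where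
  "lagr_z \<phi> g z lam = grad (\<lambda>y. lagrangian \<phi> g y lam) z"

definition lagr_zz ::
    "(real^'n \<Rightarrow> real) \<Rightarrow> (real^'n \<Rightarrow> real^'m) \<Rightarrow> real^'n \<Rightarrow> real^'m \<Rightarrow> real^'n^'n" where
  "lagr_zz \<phi> g z lam = hess (\<lambda>y. lagrangian \<phi> g y lam) z"

definition r_f ::
    "(real^'n \<Rightarrow> real) \<Rightarrow> (real^'n \<Rightarrow> real^'m) \<Rightarrow> real^'n \<Rightarrow> real^'m \<Rightarrow> real^'n" where
  "r_f \<phi> g z lam = lagr_z \<phi> g z lam"

definition r_g :: "(real^'n \<Rightarrow> real^'m) \<Rightarrow> real^'n \<Rightarrow> real^'m \<Rightarrow> real^'m" where
  "r_g g z s = g z + s"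

definition mu :: "real^'m \<Rightarrow> real^'m \<Rightarrow> real" where
  "mu lam s = (lam \<bullet> s) / real CARD('m)"

text \<open>A solution is a local minimizer over the feasible set; a global minimizer is a special
  case.\<close>

definition nlp_solution ::
    "(real^'n \<Rightarrow> real) \<Rightarrow> (real^'n \<Rightarrow> real^'m) \<Rightarrow> real^'n \<Rightarrow> bool" where
  "nlp_solution \<phi> g zs \<longleftrightarrow>
     g zs \<le> 0 \<and> (\<exists>\<rho>>0. \<forall>z\<in>ball zs \<rho>. g z \<le> 0 \<longrightarrow> \<phi> zs \<le> \<phi> z)"

definition kkt ::
    "(real^'n \<Rightarrow> real) \<Rightarrow> (real^'n \<Rightarrow> real^'m) \<Rightarrow> real^'n \<Rightarrow> real^'m \<Rightarrow> bool" where
  "kkt \<phi> g z lam \<longleftrightarrow> lagr_z \<phi> g z lam = 0 \<and> g z \<le> 0 \<and> 0 \<le> lam \<and> lam \<bullet> g z = 0"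

definition multipliers ::
    "(real^'n \<Rightarrow> real) \<Rightarrow> (real^'n \<Rightarrow> real^'m) \<Rightarrow> real^'n \<Rightarrow> (real^'m) set" where
  "multipliers \<phi> g zs = {lam. kkt \<phi> g zs lam}"

definition dist_sol ::
    "(real^'n \<Rightarrow> real) \<Rightarrow> (real^'n \<Rightarrow> real^'m) \<Rightarrow> real^'n \<Rightarrow> real^'n \<Rightarrow> real^'m \<Rightarrow> real" where
  "dist_sol \<phi> g zs z lam = infdist (z, lam) ({zs} \<times> multipliers \<phi> g zs)"

definition active :: "(real^'n \<Rightarrow> real^'m) \<Rightarrow> real^'n \<Rightarrow> 'm set" where
  "active g zs = {i. g zs $ i = 0}"

definition active_pos ::
    "(real^'n \<Rightarrow> real) \<Rightarrow> (real^'n \<Rightarrow> real^'m) \<Rightarrow> real^'n \<Rightarrow> 'm set" where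
  "active_pos \<phi> g zs = {i \<in> active g zs. \<exists>lam \<in> multipliers \<phi> g zs. lam $ i > 0}"

definition mfcq :: "(real^'n \<Rightarrow> real^'m) \<Rightarrow> real^'n \<Rightarrow> bool" where
  "mfcq g zs \<longleftrightarrow> (\<exists>y. \<forall>i \<in> active g zs. grad (\<lambda>x. g x $ i) zs \<bullet> y < 0)"

definition second_order ::
    "(real^'n \<Rightarrow> real) \<Rightarrow> (real^'n \<Rightarrow> real^'m) \<Rightarrow> real^'n \<Rightarrow> bool" where
  "second_order \<phi> g zs \<longleftrightarrow>
     (\<exists>\<xi>>0. \<forall>lam \<in> multipliers \<phi> g zs. \<forall>w.
        (\<forall>i \<in> active_pos \<phi> g zs. grad (\<lambda>x. g x $ i) zs \<bullet> w = 0) \<and>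
        (\<forall>i \<in> active g zs - active_pos \<phi> g zs. grad (\<lambda>x. g x $ i) zs \<bullet> w \<le> 0) \<longrightarrow>
        w \<bullet> (lagr_zz \<phi> g zs lam *v w) \<ge> \<xi> * (norm w)\<^sup>2)"

definition strict_compl ::
    "(real^'n \<Rightarrow> real) \<Rightarrow> (real^'n \<Rightarrow> real^'m) \<Rightarrow> real^'n \<Rightarrow> bool" where
  "strict_compl \<phi> g zs \<longleftrightarrow> (\<exists>lam \<in> multipliers \<phi> g zs. \<forall>i \<in> active g zs. lam $ i > 0)"

definition centrality ::
    "(real^'n \<Rightarrow> real) \<Rightarrow> (real^'n \<Rightarrow> real^'m) \<Rightarrow> real \<Rightarrow> real \<Rightarrow>
     real^'n \<Rightarrow> real^'m \<Rightarrow> real^'m \<Rightarrow> bool" where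
  "centrality \<phi> g C \<gamma> z lam s \<longleftrightarrow>
     norm (r_f \<phi> g z lam) \<le> C * mu lam s \<and>
     norm (r_g g z s) \<le> C * mu lam s \<and>
     (\<forall>i. lam $ i > 0 \<and> s $ i > 0) \<and>
     (\<forall>i. lam $ i * s $ i \<ge> \<gamma> * mu lam s)"

subsection \<open>Singular value decomposition of the active gradients\<close>

text \<open>Full SVD of the submatrix of \<open>A\<close> formed by the columns with index in \<open>I\<close>.
  The columns of the orthogonal matrix \<open>[Uhat Vhat]\<close> are \<open>p 0, ..., p (n - 1)\<close>, those of
  the orthogonal matrix \<open>[U V]\<close>, whose rows are indexed by \<open>I\<close>, are
  \<open>q 0, ..., q (card I - 1)\<close> (entries of \<open>q k\<close> outside \<open>I\<close> are irrelevant);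
  the first \<open>r\<close> of each make up \<open>Uhat\<close> and \<open>U\<close>, and
  \<open>Sigma\<close> is the diagonal matrix with entries \<open>\<sigma> 0, ..., \<sigma> (r - 1)\<close>.\<close>

definition svd_cols ::
    "real^'m^'n \<Rightarrow> 'm set \<Rightarrow> nat \<Rightarrow> (nat \<Rightarrow> real^'n) \<Rightarrow> (nat \<Rightarrow> real) \<Rightarrow> (nat \<Rightarrow> real^'m) \<Rightarrow> bool"
  where
  "svd_cols A I r p \<sigma> q \<longleftrightarrow>
     r \<le> CARD('n) \<and> r \<le> card I \<and>
     (\<forall>k<CARD('n). \<forall>l<CARD('n). p k \<bullet> p l = (if k = l then 1 else 0)) \<and>
     (\<forall>k<card I. \<forall>l<card I. (\<Sum>i\<in>I. q k $ i * q l $ i) = (if k = l then 1 else 0)) \<and>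
     (\<forall>k<r. \<sigma> k > 0) \<and>
     (\<forall>j. \<forall>i\<in>I. A $ j $ i = (\<Sum>k<r. p k $ j * \<sigma> k * q k $ i))"

text \<open>\<open>M :: nat \<Rightarrow> nat \<Rightarrow> real\<close> stands for the \<open>d \<times> d\<close> matrix of its entries with indices
  below \<open>d\<close>.\<close>

definition eigenvals :: "nat \<Rightarrow> (nat \<Rightarrow> nat \<Rightarrow> real) \<Rightarrow> real set" where
  "eigenvals d M =
     {e. \<exists>x :: nat \<Rightarrow> real. (\<exists>k<d. x k \<noteq> 0) \<and> (\<forall>k<d. (\<Sum>l<d. M k l * x l) = e * x k)}"

text \<open>Smallest eigenvalue of a symmetric matrix. It is extended-real-valued so that it is
  \<open>\<infinity>\<close> for the empty matrix (\<open>d = 0\<close>), which occurs for \<open>Sigma\<close> if no constraint is active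
  and for the reduced Hessian if the active gradients span the whole space.\<close>

definition sigma_min :: "nat \<Rightarrow> (nat \<Rightarrow> nat \<Rightarrow> real) \<Rightarrow> ereal" where
  "sigma_min d M = Inf (ereal ` eigenvals d M)"

definition Sigma_mat :: "(nat \<Rightarrow> real) \<Rightarrow> nat \<Rightarrow> nat \<Rightarrow> real" where
  "Sigma_mat \<sigma> k l = (if k = l then \<sigma> k else 0)"

text \<open>The entries of \<open>Vhat\<^sup>T H Vhat\<close>, where \<open>Vhat\<close> has the columns
  \<open>p r, ..., p (n - 1)\<close>; the matrix has dimension \<open>n - r\<close>.\<close>

definition reduced_mat :: "nat \<Rightarrow> (nat \<Rightarrow> real^'n) \<Rightarrow> real^'n^'n \<Rightarrow> nat \<Rightarrow> nat \<Rightarrow> real" where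
  "reduced_mat r p H k l = p (r + k) \<bullet> (H *v p (r + l))"

definition conditioning ::
    "(real^'n \<Rightarrow> real) \<Rightarrow> (real^'n \<Rightarrow> real^'m) \<Rightarrow> real^'n \<Rightarrow>
     nat \<Rightarrow> (nat \<Rightarrow> real^'n) \<Rightarrow> (nat \<Rightarrow> real) \<Rightarrow> real \<Rightarrow> real \<Rightarrow> real \<Rightarrow> bool" where
  "conditioning \<phi> g zs r p \<sigma> \<beta> u \<mu> \<longleftrightarrow>
     sigma_min r (Sigma_mat \<sigma>) \<ge> ereal (\<beta> * max (root 3 \<mu>) (u / \<mu>)) \<and>
     (\<forall>lam \<in> multipliers \<phi> g zs.
        sigma_min (CARD('n) - r) (reduced_mat r p (lagr_zz \<phi> g zs lam))
          \<ge> ereal (\<beta> * max (root 3 \<mu>) (u / \<mu>)))"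

subsection \<open>Floating-point arithmetic\<close>

text \<open>\<open>\<FF>\<close> is the set of floating-point numbers (overflow and underflow are disregarded, and
  negation is exact), and \<open>fl op x y\<close> is the computed value of \<open>op x y\<close>.\<close>

definition float_model ::
    "real set \<Rightarrow> ((real \<Rightarrow> real \<Rightarrow> real) \<Rightarrow> real \<Rightarrow> real \<Rightarrow> real) \<Rightarrow> real \<Rightarrow> bool" where
  "float_model \<FF> fl u \<longleftrightarrow>
     0 < u \<and> (\<forall>x\<in>\<FF>. - x \<in> \<FF>) \<and>
     (\<forall>op \<in> {(+), (-), (*), (/)}. \<forall>x\<in>\<FF>. \<forall>y\<in>\<FF>. (op = (/) \<longrightarrow> y \<noteq> 0) \<longrightarrow>
        fl op x y \<in> \<FF> \<and> (\<exists>e. \<bar>e\<bar> \<le> u \<and> fl op x y = op x y * (1 + e)))"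

definition float_vec :: "real set \<Rightarrow> real^'k \<Rightarrow> bool" where
  "float_vec \<FF> v \<longleftrightarrow> (\<forall>i. v $ i \<in> \<FF>)"

definition float_mat :: "real set \<Rightarrow> real^'k^'l \<Rightarrow> bool" where
  "float_mat \<FF> A \<longleftrightarrow> (\<forall>i j. A $ i $ j \<in> \<FF>)"

text \<open>\<open>fl_sum fl X y\<close>: evaluating the sum of the numbers in \<open>X\<close> by floating-point additions and
  subtractions, in some order, may produce \<open>y\<close>.\<close>

inductive fl_sum ::
    "((real \<Rightarrow> real \<Rightarrow> real) \<Rightarrow> real \<Rightarrow> real \<Rightarrow> real) \<Rightarrow> real multiset \<Rightarrow> real \<Rightarrow> bool"
  for fl where
  single: "fl_sum fl {#x#} x"
| add: "fl_sum fl A x \<Longrightarrow> fl_sum fl B y \<Longrightarrow> fl_sum fl (A + B) (fl (+) x y)"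
| sub: "fl_sum fl A x \<Longrightarrow> fl_sum fl B y \<Longrightarrow> fl_sum fl (A + image_mset uminus B) (fl (-) x y)"

text \<open>The rounded products whose sum is the \<open>i\<close>-th component of \<open>A\<^sup>T v\<close>.\<close>

definition fl_products ::
    "((real \<Rightarrow> real \<Rightarrow> real) \<Rightarrow> real \<Rightarrow> real \<Rightarrow> real) \<Rightarrow> real^'m^'n \<Rightarrow> real^'n \<Rightarrow> 'm \<Rightarrow> real multiset"
  where
  "fl_products fl A v i = image_mset (\<lambda>j. fl (*) (A $ j $ i) (v $ j)) (mset_set UNIV)"

subsection \<open>The computed step of the condensed procedure\<close>

definition diag_bounded :: "real \<Rightarrow> real \<Rightarrow> real \<Rightarrow> 'm set \<Rightarrow> real^'m^'m \<Rightarrow> bool" where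
  "diag_bounded K u \<mu> B G \<longleftrightarrow>
     (\<forall>i j. i \<noteq> j \<longrightarrow> G $ i $ j = 0) \<and>
     (\<forall>i\<in>B. \<bar>G $ i $ i\<bar> \<le> K * (\<mu> * u)) \<and>
     (\<forall>i\<in>-B. \<bar>G $ i $ i\<bar> \<le> K * (u / \<mu>))"

text \<open>\<open>K\<close> serves as the constant in every order estimate. \<open>Fb\<close>, \<open>fb\<close>, \<open>F\<close>, \<open>f\<close>, \<open>G\<close> are the
  errors in the computed values \<open>Hc\<close>, \<open>Lc\<close>, \<open>Ac\<close>, \<open>gc\<close>, \<open>Dinv\<close> of the Hessian and gradient of
  the Lagrangian, the constraint gradients, the constraint values and \<open>D\<^sup>-\<^sup>1\<close>; \<open>Fh\<close> and \<open>fh\<close>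
  account for the roundoff in forming and solving the linear system.\<close>

definition computed_step ::
    "(real^'n \<Rightarrow> real) \<Rightarrow> (real^'n \<Rightarrow> real^'m) \<Rightarrow> real^'n \<Rightarrow> real \<Rightarrow>
     real set \<Rightarrow> ((real \<Rightarrow> real \<Rightarrow> real) \<Rightarrow> real \<Rightarrow> real \<Rightarrow> real) \<Rightarrow> real \<Rightarrow>
     real^'n \<Rightarrow> real^'m \<Rightarrow> real^'m \<Rightarrow> real^'m \<Rightarrow>
     real^'n \<Rightarrow> real^'m \<Rightarrow> real^'m \<Rightarrow> bool" where
  "computed_step \<phi> g zs K \<FF> fl u z lam s t dz dlam ds \<longleftrightarrow>
     (\<exists>Fb fb F f G Fh fh Hc Lc Ac gc Dinv.
        norm Fb \<le> K * u \<and> norm fb \<le> K * u \<and> norm F \<le> K * u \<and> norm f \<le> K * u \<and>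
        diag_bounded K u (mu lam s) (active g zs) G \<and>
        norm Fh \<le> K * (u / mu lam s) \<and> norm fh \<le> K * u \<and>
        Hc = lagr_zz \<phi> g z lam + Fb \<and>
        Lc = lagr_z \<phi> g z lam + fb \<and>
        Ac = grad_cols g z + F \<and>
        gc = g z + f \<and>
        Dinv = matrix_inv (matrix_inv (diag lam) ** diag s + G) \<and>
        float_mat \<FF> Hc \<and> float_vec \<FF> Lc \<and> float_mat \<FF> Ac \<and> float_vec \<FF> gc \<and>
        (\<forall>i. Dinv $ i $ i \<in> \<FF>) \<and> float_vec \<FF> dz \<and>
        (Hc + Ac ** Dinv ** transpose Ac + Fh) *v dz
          = - Lc - Ac *v (Dinv *v (gc - matrix_inv (diag lam) *v t)) + fh \<and>
        (\<forall>i. \<exists>y. fl_sum fl ({#gc $ i, - fl (/) (t $ i) (lam $ i)#} + fl_products fl Ac dz i) y \<and>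
             dlam $ i = fl (*) (Dinv $ i $ i) y) \<and>
        (\<forall>i. fl_sum fl ({#- fl (+) (gc $ i) (s $ i)#} + image_mset uminus (fl_products fl Ac dz i))
             (ds $ i)))"

end

theory Submission
  imports Defs
begin

text \<open>All estimates are asymptotic statements along a filter on the set of possible iterations, so
  that one \<open>O\<close>-constant serves every iterate. Put \<open>y = z - z\<^sup>*\<close>, \<open>A = \<nabla>g(z\<^sup>*)\<close>,
  \<open>w = u + \<mu>\<^sup>2\<close>. Comparing \<open>(\<lambda>, s)\<close> with a strictly complementary multiplier gives
  \<open>s\<^sub>B = O(\<mu> + |y|\<^sup>2)\<close>, hence \<open>A\<^sub>B\<^sup>T y = O(\<mu> + |y|\<^sup>2)\<close>, and the second-order condition on
  the kernel of \<open>A\<^sub>B\<^sup>T\<close> gives \<open>y = O(\<mu>)\<close>; so \<open>\<lambda>\<^sub>B\<close> and \<open>s\<^sub>N\<close> are bounded below and the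
  distance to the solution set is \<open>O(\<mu>)\<close>. The coefficient matrix of the step is of size
  \<open>1/\<mu>\<close> on the range of \<open>A\<^sub>B\<close> and uniformly positive on the kernel of \<open>A\<^sub>B\<^sup>T\<close>, up to
  perturbations of size \<open>\<mu> + u/\<mu>\<close>, so \<open>\<Delta>z, \<Delta>s = O(\<mu>)\<close>. The component of
  \<open>\<Delta>\<lambda>\<^sub>B\<close> in the kernel of \<open>A\<^sub>B\<close> is controlled because \<open>D\<^sub>B \<Delta>\<lambda>\<^sub>B\<close> is the sum of a vector
  of the range of \<open>A\<^sub>B\<^sup>T\<close> and an error \<open>O(w)\<close>; this gives \<open>\<Delta>\<lambda> = O(\<mu> + u/\<mu>)\<close>. Since the
  computed step satisfies the Newton equations up to \<open>O(w)\<close>, a step of length \<open>\<alpha>\<close> multiplies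
  residuals, complementarity products and \<open>\<mu>\<close> by \<open>1 - \<alpha>\<close> up to \<open>O(w)\<close>, and
  \<open>\<tau> (1 - \<alpha>) \<mu> \<ge> Chat w\<close> absorbs that error. The last claim is the distance estimate
  applied to the new point.\<close>

section \<open>Order estimates along a filter\<close>

text \<open>The obstacle is that multipliers need not be unique: the active gradients may be
  linearly dependent, and then the estimate \<open>\<Delta>z = O(\<mu>)\<close>, inserted into the
  formula for the multiplier step, gives only \<open>\<Delta>\<lambda> = O(1)\<close>. This is too
  weak. The new gradient residual contains the change of \<open>\<nabla>g\<close> times
  \<open>\<Delta>\<lambda>\<close>, the new products contain
  \<open>\<Delta>\<lambda>\<^sub>i \<Delta>s\<^sub>i\<close>, and both would be as large as
  \<open>\<mu>\<close> itself. The sharper bound \<open>O(u/\<mu> + \<mu>)\<close> is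
  \<open>O(w/\<mu>)\<close>, which turns both into \<open>O(w)\<close>; the same quotient appears in
  the bound on \<alpha>, since w is compared with \<tau> (1 - \<alpha>) \<mu>. A second difficulty
  is a circularity between \<open>\<Delta>z\<close> and the active part of the linearized constraint
  change. It is broken by two tests of the linear system. Kernel vectors almost annihilate the block
  of size \<open>1/\<mu>\<close>, which bounds \<open>\<Delta>z\<close> by the active part; testing
  with \<open>\<Delta>z\<close> itself exploits the sign of that block and bounds the active part. A
  point of the filter carries the rounding errors, \<alpha> and \<tau> along with the iterate, so
  every estimate is uniform in these as well.\<close>

declare transpose_matrix_vector [simp del]

text \<open>The constant may have either sign and the weight is taken in absolute value, so products of
  estimates need no sign conditions.\<close>

definition bigO :: "'a filter \<Rightarrow> ('a \<Rightarrow> 'b::real_normed_vector) \<Rightarrow> ('a \<Rightarrow> real) \<Rightarrow> bool" where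
  "bigO F v w \<longleftrightarrow> (\<exists>c. \<forall>\<^sub>F x in F. norm (v x) \<le> c * \<bar>w x\<bar>)"

lemma bigOI: "\<forall>\<^sub>F x in F. norm (v x) \<le> c * \<bar>w x\<bar> \<Longrightarrow> bigO F v w"
  by (auto simp: bigO_def)

lemma bigOE:
  assumes "bigO F v w"
  obtains c where "c > 0" "\<forall>\<^sub>F x in F. norm (v x) \<le> c * \<bar>w x\<bar>"
proof -
  obtain c where c: "\<forall>\<^sub>F x in F. norm (v x) \<le> c * \<bar>w x\<bar>"
    using assms by (auto simp: bigO_def)
  have "\<forall>\<^sub>F x in F. norm (v x) \<le> (\<bar>c\<bar> + 1) * \<bar>w x\<bar>"
    using c
  proof eventually_elim
    case (elim x)
    have "c * \<bar>w x\<bar> \<le> (\<bar>c\<bar> + 1) * \<bar>w x\<bar>" by (intro mult_right_mono) auto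
    with elim show ?case by linarith
  qed
  with that[of "\<bar>c\<bar> + 1"] show ?thesis by auto
qed

lemma bigO_mono: "\<forall>\<^sub>F x in F. norm (v x) \<le> c * w x \<Longrightarrow> \<forall>\<^sub>F x in F. 0 \<le> w x \<Longrightarrow> bigO F v w"
  by (rule bigOI[where c=c]) (auto elim: eventually_elim2)

lemma bigO_trans: "bigO F v w \<Longrightarrow> bigO F w w' \<Longrightarrow> bigO F v w'"
proof -
  assume a: "bigO F v w" and b: "bigO F w w'"
  obtain c where c: "c > 0" "\<forall>\<^sub>F x in F. norm (v x) \<le> c * \<bar>w x\<bar>" using bigOE[OF a] by auto
  obtain d where d: "d > 0" "\<forall>\<^sub>F x in F. norm (w x) \<le> d * \<bar>w' x\<bar>" using bigOE[OF b] by auto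
  show ?thesis
  proof (rule bigOI[where c="c * d"])
    show "\<forall>\<^sub>F x in F. norm (v x) \<le> c * d * \<bar>w' x\<bar>"
      using c(2) d(2)
    proof eventually_elim
      case (elim x)
      have "c * \<bar>w x\<bar> \<le> c * (d * \<bar>w' x\<bar>)" using elim c by (intro mult_left_mono) auto
      with elim show ?case by simp
    qed
  qed
qed

lemma bigO_cong: "\<forall>\<^sub>F x in F. v x = v' x \<Longrightarrow> bigO F v' w \<Longrightarrow> bigO F v w"
proof -
  assume a: "\<forall>\<^sub>F x in F. v x = v' x" and "bigO F v' w"
  then obtain c where "\<forall>\<^sub>F x in F. norm (v' x) \<le> c * \<bar>w x\<bar>" by (auto simp: bigO_def)
  with a have "\<forall>\<^sub>F x in F. norm (v x) \<le> c * \<bar>w x\<bar>" by eventually_elim simp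
  then show ?thesis by (rule bigOI)
qed

lemma bigO_eq: "bigO F v' w \<Longrightarrow> (\<And>x. v x = v' x) \<Longrightarrow> bigO F v w"
  by (rule bigO_cong) auto

lemma bigO_refl [simp]: "bigO F w w"
  by (rule bigOI[where c=1]) auto

lemma bigO_self_norm: "bigO F v (\<lambda>x. norm (v x))"
  by (rule bigOI[where c=1]) auto

lemma bigO_norm_iff [simp]: "bigO F (\<lambda>x. norm (v x)) w \<longleftrightarrow> bigO F v w"
  by (simp add: bigO_def)

lemma bigO_zero [simp]: "bigO F (\<lambda>_. 0) w"
  by (rule bigOI[where c=0]) auto

lemma bigO_add:
  assumes "bigO F v w" "bigO F v' w" shows "bigO F (\<lambda>x. v x + v' x) w"
proof -
  obtain c where c: "\<forall>\<^sub>F x in F. norm (v x) \<le> c * \<bar>w x\<bar>" using bigOE[OF assms(1)] by auto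
  obtain d where d: "\<forall>\<^sub>F x in F. norm (v' x) \<le> d * \<bar>w x\<bar>" using bigOE[OF assms(2)] by auto
  show ?thesis
    by (rule bigOI[where c="c + d"], use c d in eventually_elim)
       (auto simp: algebra_simps intro!: order.trans[OF norm_triangle_ineq])
qed

lemma bigO_minus: "bigO F v w \<Longrightarrow> bigO F (\<lambda>x. - v x) w"
  by (simp add: bigO_def)

lemma bigO_minus_iff [simp]: "bigO F (\<lambda>x. - v x) w = bigO F v w"
  by (simp add: bigO_def)

lemma bigO_diff: "bigO F v w \<Longrightarrow> bigO F v' w \<Longrightarrow> bigO F (\<lambda>x. v x - v' x) w"
  using bigO_add[of F v w "\<lambda>x. - v' x"] by simp

lemma bigO_sum: "(\<And>i. i \<in> I \<Longrightarrow> bigO F (\<lambda>x. v i x) w) \<Longrightarrow> bigO F (\<lambda>x. \<Sum>i\<in>I. v i x) w"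
  by (induction I rule: infinite_finite_induct) (auto intro: bigO_add)

lemma bigO_const: "bigO F (\<lambda>_. a) (\<lambda>_. 1)"
  by (rule bigOI[where c="norm a"]) auto

text \<open>Stated for an arbitrary bounded bilinear map, so that one proof covers products,
  scalings, inner products and matrix-vector products.\<close>

lemma (in bounded_bilinear) bigO_prod:
  assumes "bigO F v w" "bigO F v' w'" shows "bigO F (\<lambda>x. prod (v x) (v' x)) (\<lambda>x. w x * w' x)"
proof -
  obtain c where c: "c > 0" "\<forall>\<^sub>F x in F. norm (v x) \<le> c * \<bar>w x\<bar>" using bigOE[OF assms(1)] by auto
  obtain d where d: "d > 0" "\<forall>\<^sub>F x in F. norm (v' x) \<le> d * \<bar>w' x\<bar>" using bigOE[OF assms(2)] by auto
  obtain K where K: "K > 0" "\<And>a b. norm (prod a b) \<le> norm a * norm b * K"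
    using pos_bounded by auto
  show ?thesis
  proof (rule bigOI[where c="c * d * K"], use c(2) d(2) in eventually_elim)
    case (elim x)
    have "norm (prod (v x) (v' x)) \<le> norm (v x) * norm (v' x) * K" by (rule K)
    also have "\<dots> \<le> (c * \<bar>w x\<bar>) * (d * \<bar>w' x\<bar>) * K"
      using elim c d K by (intro mult_right_mono mult_mono) auto
    finally show ?case by (simp add: abs_mult mult_ac)
  qed
qed

lemmas bigO_mult = bounded_bilinear.bigO_prod[OF bounded_bilinear_mult]
lemmas bigO_scaleR = bounded_bilinear.bigO_prod[OF bounded_bilinear_scaleR]
lemmas bigO_inner = bounded_bilinear.bigO_prod[OF bounded_bilinear_inner]

text \<open>Here \<open>norm A\<close> is the Frobenius norm, for which the factor could be 1. The
  cheap factor comes from adding up the rowwise Cauchy-Schwarz bounds.\<close>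

lemma norm_matrix_vector_le: "norm (A *v x) \<le> real CARD('m) * norm A * norm x"
  for A :: "real^'n^'m" and x :: "real^'n"
proof -
  have "norm (A *v x) \<le> (\<Sum>i\<in>UNIV. \<bar>(A *v x) $ i\<bar>)" by (rule norm_le_l1_cart)
  also have "\<dots> \<le> (\<Sum>i\<in>(UNIV::'m set). norm A * norm x)"
  proof (rule sum_mono)
    fix i
    have "\<bar>(A *v x) $ i\<bar> \<le> norm (A $ i) * norm x"
      by (simp add: matrix_vector_mul_component Cauchy_Schwarz_ineq2)
    also have "\<dots> \<le> norm A * norm x"
      by (intro mult_right_mono Finite_Cartesian_Product.norm_nth_le) auto
    finally show "\<bar>(A *v x) $ i\<bar> \<le> norm A * norm x" .
  qed
  finally show ?thesis by simp
qed

lemma bounded_bilinear_matvec: "bounded_bilinear ((*v) :: real^'n^'m \<Rightarrow> real^'n \<Rightarrow> real^'m)"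
proof
  show "\<exists>K. \<forall>a b. norm ((a :: real^'n^'m) *v b) \<le> norm a * norm b * K"
    using norm_matrix_vector_le by (metis mult.assoc mult.commute)
qed (auto simp: matrix_vector_mult_add_rdistrib matrix_vector_right_distrib
      scaleR_matrix_vector_assoc matrix_vector_mult_scaleR)

lemmas bigO_matvec = bounded_bilinear.bigO_prod[OF bounded_bilinear_matvec]

lemma norm_transpose [simp]: "norm (transpose A) = norm A" for A :: "real^'n^'m"
proof -
  have norm_eq: "norm B = sqrt (\<Sum>i\<in>UNIV. \<Sum>j\<in>UNIV. (B $ i $ j)\<^sup>2)" for B :: "real^'a^'b"
    by (simp add: norm_vec_def L2_set_def sum_nonneg)
  show ?thesis
    unfolding norm_eq by (subst sum.swap) (simp add: transpose_def)
qed

lemma bigO_transpose [simp]: "bigO F (\<lambda>x. transpose (A x)) w \<longleftrightarrow> bigO F A w"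
  for A :: "'a \<Rightarrow> real^'n^'m"
  by (simp add: bigO_def)

lemma bigO_linear:
  fixes L :: "'b::euclidean_space \<Rightarrow> 'c::real_normed_vector"
  assumes "linear L" "bigO F v w" shows "bigO F (\<lambda>x. L (v x)) w"
proof -
  obtain B where B: "B > 0" "\<And>x. norm (L x) \<le> B * norm x" using linear_bounded_pos[OF assms(1)] by auto
  have "bigO F (\<lambda>x. L (v x)) (\<lambda>x. norm (v x))"
    by (rule bigOI[where c=B]) (use B in auto)
  then show ?thesis using bigO_trans assms(2) by fastforce
qed

lemma bigO_nth: "bigO F v w \<Longrightarrow> bigO F (\<lambda>x. v x $ i) w"
  for v :: "'a \<Rightarrow> 'b::real_normed_vector^'n"
proof -
  assume "bigO F v w"
  then obtain c where "\<forall>\<^sub>F x in F. norm (v x) \<le> c * \<bar>w x\<bar>" by (auto simp: bigO_def)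
  then have "\<forall>\<^sub>F x in F. norm (v x $ i) \<le> c * \<bar>w x\<bar>"
    by eventually_elim (rule order.trans[OF Finite_Cartesian_Product.norm_nth_le])
  then show ?thesis by (rule bigOI)
qed

lemma bigO_vec:
  fixes v :: "'a \<Rightarrow> 'b::real_normed_vector^'n"
  assumes "\<And>i. bigO F (\<lambda>x. v x $ i) w" shows "bigO F v w"
proof -
  have "bigO F (\<lambda>x. norm (v x)) (\<lambda>x. \<Sum>i\<in>UNIV. norm (v x $ i))"
    by (rule bigOI[where c=1])
      (auto simp: norm_vec_def sum_nonneg intro!: always_eventually L2_set_le_sum)
  moreover have "bigO F (\<lambda>x. \<Sum>i\<in>UNIV. norm (v x $ i)) w"
    by (intro bigO_sum) (simp add: assms)
  ultimately show ?thesis using bigO_trans bigO_norm_iff by blast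
qed

lemma bigO_tendsto: "(v \<longlongrightarrow> l) F \<Longrightarrow> bigO F v (\<lambda>_. 1)"
proof -
  assume "(v \<longlongrightarrow> l) F"
  then have *: "\<forall>\<^sub>F x in F. dist (v x) l < 1" by (rule tendstoD) simp
  show ?thesis
  proof (rule bigOI[where c="norm l + 1"], use * in eventually_elim)
    case (elim x)
    then show ?case using norm_triangle_sub[of "v x" l] by (simp add: dist_norm)
  qed
qed

lemma bigO_tendsto_0: "bigO F v w \<Longrightarrow> (w \<longlongrightarrow> 0) F \<Longrightarrow> (v \<longlongrightarrow> 0) F"
proof -
  assume a: "bigO F v w" and b: "(w \<longlongrightarrow> 0) F"
  obtain c where c: "c > 0" "\<forall>\<^sub>F x in F. norm (v x) \<le> c * \<bar>w x\<bar>" using bigOE[OF a] by auto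
  have "((\<lambda>x. c * \<bar>w x\<bar>) \<longlongrightarrow> 0) F" using b by (auto intro!: tendsto_eq_intros)
  then show ?thesis using c(2) by (rule Lim_null_comparison[rotated])
qed

lemma tendsto_0_bound:
  fixes v :: "'a \<Rightarrow> 'b::real_normed_vector"
  assumes "(v \<longlongrightarrow> 0) F" "e > 0" shows "\<forall>\<^sub>F x in F. norm (v x) \<le> e"
  using tendstoD[OF assms] by (auto elim: eventually_mono)

section \<open>Subvectors and partial inverses\<close>

text \<open>Subvectors are encoded by zeroing the other entries: the active set is a value, not a
  type, so it cannot index a vector.\<close>

definition mask :: "'i set \<Rightarrow> real^'i \<Rightarrow> real^'i" where
  "mask B v = (\<chi> i. if i \<in> B then v $ i else 0)"

lemma mask_nth: "mask B v $ i = (if i \<in> B then v $ i else 0)"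
  by (simp add: mask_def)

lemma linear_mask: "linear (mask B)"
  by (rule linearI) (auto simp: vec_eq_iff mask_nth)

lemma bigO_mask: "(\<And>i. i \<in> B \<Longrightarrow> bigO F (\<lambda>x. v x $ i) w) \<Longrightarrow> bigO F (\<lambda>x. mask B (v x)) w"
proof (rule bigO_vec)
  fix i
  assume "\<And>i. i \<in> B \<Longrightarrow> bigO F (\<lambda>x. v x $ i) w"
  then show "bigO F (\<lambda>x. mask B (v x) $ i) w" by (cases "i \<in> B") (simp_all add: mask_nth)
qed

lemma bigO_mask': "bigO F v w \<Longrightarrow> bigO F (\<lambda>x. mask B (v x)) w"
  by (rule bigO_linear[OF linear_mask])

lemma inner_mask: "mask B v \<bullet> w = v \<bullet> mask B w"
  by (simp add: inner_vec_def mask_nth if_distrib if_distribR sum.If_cases cong: if_cong)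

lemma mask_mask [simp]: "mask B (mask B v) = mask B v"
  by (simp add: vec_eq_iff mask_nth)

lemma inner_mask_right: "v \<bullet> mask B w = (\<Sum>i\<in>B. v $ i * w $ i)"
  for v w :: "real^'i"
proof -
  have "v \<bullet> mask B w = (\<Sum>i\<in>UNIV. if i \<in> B then v $ i * w $ i else 0)"
    unfolding inner_vec_def by (rule sum.cong) (auto simp: mask_nth)
  also have "\<dots> = (\<Sum>i\<in>B. v $ i * w $ i)" by (subst sum.inter_restrict[symmetric]) auto
  finally show ?thesis .
qed

text \<open>A substitute for the pseudoinverse. A linear map in finite dimension is bounded, so
  \<open>x - R (T x)\<close> is a point of the kernel whose distance from \<open>x\<close> is at
  most a constant times \<open>norm (T x)\<close>.\<close>

lemma linear_partial_right_inverse: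
  fixes T :: "'a::euclidean_space \<Rightarrow> 'b::euclidean_space"
  assumes "linear T"
  obtains R where "linear R" "\<And>x. T (x - R (T x)) = 0"
proof -
  interpret linear T by fact
  obtain R where R: "linear R" "\<And>x. x \<in> range T \<Longrightarrow> T (R x) = x"
    using linear_exists_right_inverse_on[OF assms subspace_UNIV] by blast
  have "T (x - R (T x)) = 0" for x
    using R(2)[of "T x"] by (simp add: diff)
  with R(1) that show ?thesis by blast
qed

text \<open>Once \<open>norm (y x)\<close> is below \<open>1 / (2 * c)\<close>, the quadratic term
  is at most half of the left-hand side.\<close>

lemma bigO_absorb_square:
  assumes "bigO F y (\<lambda>x. m x + (norm (y x))\<^sup>2)" "(y \<longlongrightarrow> 0) F" "\<forall>\<^sub>F x in F. 0 \<le> m x"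
  shows "bigO F y m"
proof -
  obtain c where c: "c > 0" "\<forall>\<^sub>F x in F. norm (y x) \<le> c * \<bar>m x + (norm (y x))\<^sup>2\<bar>"
    using bigOE[OF assms(1)] by auto
  have *: "\<forall>\<^sub>F x in F. norm (y x) \<le> 1 / (2 * c)"
    using assms(2) by (rule tendsto_0_bound) (use c in auto)
  show ?thesis
  proof (rule bigOI[where c="2 * c"], use c(2) assms(3) * in eventually_elim)
    case (elim x)
    have "c * (norm (y x))\<^sup>2 \<le> norm (y x) / 2"
      using mult_left_mono[OF elim(3), of "c * norm (y x)"] c by (simp add: power2_eq_square mult_ac)
    with elim show ?case by (simp add: algebra_simps)
  qed
qed

section \<open>Taylor estimates for the Lagrangian\<close>

lemma has_derivative_grad:
  assumes "f differentiable (at z)"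
  shows "(f has_derivative (\<lambda>h. grad f z \<bullet> h)) (at z)"
proof -
  let ?D = "frechet_derivative f (at z)"
  have D: "(f has_derivative ?D) (at z)" using assms by (simp add: frechet_derivative_works)
  then interpret linear ?D by (rule has_derivative_linear)
  have "?D h = grad f z \<bullet> h" for h
  proof -
    have "?D h = ?D (\<Sum>i\<in>UNIV. h $ i *\<^sub>R axis i 1)"
      by (metis basis_expansion scalar_mult_eq_scaleR)
    also have "\<dots> = (\<Sum>i\<in>UNIV. h $ i * ?D (axis i 1))" by (simp add: sum scale)
    finally show ?thesis by (simp add: inner_vec_def grad_def mult.commute)
  qed
  with D show ?thesis by (metis (no_types, lifting) ext)
qed

lemma grad_eqI:
  assumes "(f has_derivative (\<lambda>h. a \<bullet> h)) (at z)"
  shows "grad f z = a"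
proof -
  have "frechet_derivative f (at z) = (\<lambda>h. a \<bullet> h)"
    using assms by (metis frechet_derivative_at)
  then show ?thesis by (simp add: grad_def vec_eq_iff inner_axis)
qed

lemma has_derivative_hess:
  assumes "grad f differentiable (at z)"
  shows "(grad f has_derivative (\<lambda>h. hess f z *v h)) (at z)"
  using assms unfolding hess_def by (simp add: jacobian_works)

lemma hess_eqI:
  assumes "(grad f has_derivative (\<lambda>h. M *v h)) (at z)"
  shows "hess f z = M"
proof -
  have "frechet_derivative (grad f) (at z) = (\<lambda>h. M *v h)"
    using assms by (metis frechet_derivative_at)
  then show ?thesis by (simp add: hess_def jacobian_def)
qed

lemma twice_lipschitz_diff_derivs:
  assumes "twice_lipschitz_diff f"
  shows "(f has_derivative (\<lambda>h. grad f z \<bullet> h)) (at z)"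
    and "(grad f has_derivative (\<lambda>h. hess f z *v h)) (at z)"
  using assms by (auto simp only: twice_lipschitz_diff_def intro!: has_derivative_grad has_derivative_hess)

lemma onorm_matvec_le: "onorm ((*v) A) \<le> real CARD('m) * norm A"
  for A :: "real^'n^'m"
  by (rule onorm_bound) (auto simp: norm_matrix_vector_le)

text \<open>The Lipschitz condition bounds the Hessian on the ball, which makes the gradient
  Lipschitz there. The mean value inequality for a function minus its linearization, applied on the
  segment from \<open>a\<close> to \<open>b\<close>, then gives the two quadratic
  remainders.\<close>

lemma twice_lipschitz_diff_taylor:
  fixes f :: "real^'n \<Rightarrow> real"
  assumes "twice_lipschitz_diff f"
  obtains \<rho> L where "\<rho> > 0"
    "\<And>a b. a \<in> ball z \<rho> \<Longrightarrow> b \<in> ball z \<rho> \<Longrightarrow> norm (hess f b - hess f a) \<le> L * norm (b - a)"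
    "\<And>a b. a \<in> ball z \<rho> \<Longrightarrow> b \<in> ball z \<rho> \<Longrightarrow>
       norm (grad f b - grad f a - hess f a *v (b - a)) \<le> L * (norm (b - a))\<^sup>2"
    "\<And>a b. a \<in> ball z \<rho> \<Longrightarrow> b \<in> ball z \<rho> \<Longrightarrow> norm (grad f b - grad f a) \<le> L * norm (b - a)"
    "\<And>a b. a \<in> ball z \<rho> \<Longrightarrow> b \<in> ball z \<rho> \<Longrightarrow>
       norm (f b - f a - grad f a \<bullet> (b - a)) \<le> L * (norm (b - a))\<^sup>2"
proof -
  obtain \<rho> L where rho: "\<rho> > 0" and lip: "L-lipschitz_on (ball z \<rho>) (hess f)"
    using assms unfolding twice_lipschitz_diff_def by blast
  have d1: "(f has_derivative (\<lambda>h. grad f a \<bullet> h)) (at a)"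
    and d2: "(grad f has_derivative (\<lambda>h. hess f a *v h)) (at a)" for a
    using assms by (rule twice_lipschitz_diff_derivs)+
  have L0: "L \<ge> 0" using lip by (rule lipschitz_on_nonneg)
  have seg: "closed_segment a b \<subseteq> ball z \<rho>" if "a \<in> ball z \<rho>" "b \<in> ball z \<rho>" for a b
    using that by (simp add: closed_segment_subset)
  have param: "a + t *\<^sub>R (b - a) \<in> closed_segment a b" if "t \<in> {0..1}" for a b :: "real^'n" and t
    using that by (auto simp: closed_segment_def algebra_simps intro!: exI[of _ t])
  have H: "norm (hess f b - hess f a) \<le> L * norm (b - a)"
    if "a \<in> ball z \<rho>" "b \<in> ball z \<rho>" for a b
    using lipschitz_onD[OF lip that(2,1)] by (simp add: dist_norm)
  define M where "M = norm (hess f z) + L * \<rho>"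
  have M: "norm (hess f a) \<le> M" if "a \<in> ball z \<rho>" for a
  proof -
    have "norm (hess f a - hess f z) \<le> L * norm (a - z)" using that rho by (intro H) auto
    also have "\<dots> \<le> L * \<rho>" using that L0 by (intro mult_left_mono) (auto simp: dist_norm norm_minus_commute)
    finally show ?thesis using norm_triangle_sub[of "hess f a" "hess f z"] by (simp add: M_def)
  qed
  have M0: "M \<ge> 0" using L0 rho by (simp add: M_def)
  \<comment> \<open>The price of passing from \<open>norm\<close> of a Hessian to its operator
    norm.\<close>
  define k where "k = real CARD('n)"
  have k: "k \<ge> 1" unfolding k_def by (simp add: Suc_leI)
  have G2: "norm (grad f b - grad f a - hess f a *v (b - a)) \<le> k * L * (norm (b - a))\<^sup>2"
    if ab: "a \<in> ball z \<rho>" "b \<in> ball z \<rho>" for a b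
  proof -
    have "norm (grad f b - grad f a - hess f a *v (b - a)) \<le> norm (b - a) * (k * (L * norm (b - a)))"
    proof (rule differentiable_bound_linearization[where S = "closed_segment a b" and f' = "\<lambda>x h. hess f x *v h"])
      fix x assume x: "x \<in> closed_segment a b"
      show "(grad f has_derivative (*v) (hess f x)) (at x within closed_segment a b)"
        using d2 by (rule has_derivative_at_withinI)
      have "(*v) (hess f x) - (*v) (hess f a) = (*v) (hess f x - hess f a)"
        by (auto simp: fun_eq_iff matrix_vector_mult_diff_rdistrib)
      then have "onorm ((*v) (hess f x) - (*v) (hess f a)) \<le> k * norm (hess f x - hess f a)"
        by (simp add: onorm_matvec_le k_def)
      also have "\<dots> \<le> k * (L * norm (x - a))"
        using x seg[OF ab] k ab by (intro mult_left_mono H) auto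
      also have "\<dots> \<le> k * (L * norm (b - a))"
        using k L0 segment_bound(1)[OF x] by (intro mult_left_mono) auto
      finally show "onorm ((*v) (hess f x) - (*v) (hess f a)) \<le> k * (L * norm (b - a))" .
    qed (use param in auto)
    then show ?thesis by (simp add: power2_eq_square mult_ac)
  qed
  have G1: "norm (grad f b - grad f a) \<le> k * M * norm (b - a)"
    if ab: "a \<in> ball z \<rho>" "b \<in> ball z \<rho>" for a b
  proof -
    have "norm (grad f b - grad f a) \<le> k * M * norm (b - a)"
    proof (rule differentiable_bound[where S = "ball z \<rho>" and f' = "\<lambda>x h. hess f x *v h"])
      fix x assume x: "x \<in> ball z \<rho>"
      show "(grad f has_derivative (*v) (hess f x)) (at x within ball z \<rho>)"
        using d2 by (rule has_derivative_at_withinI)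
      show "onorm ((*v) (hess f x)) \<le> k * M"
        using order.trans[OF onorm_matvec_le mult_left_mono[OF M[OF x]]] k by (simp add: k_def)
    qed (use ab in auto)
    then show ?thesis .
  qed
  have F2: "norm (f b - f a - grad f a \<bullet> (b - a)) \<le> k * M * (norm (b - a))\<^sup>2"
    if ab: "a \<in> ball z \<rho>" "b \<in> ball z \<rho>" for a b
  proof -
    have "norm (f b - f a - grad f a \<bullet> (b - a)) \<le> norm (b - a) * (k * M * norm (b - a))"
    proof (rule differentiable_bound_linearization[where S = "closed_segment a b" and f' = "\<lambda>x h. grad f x \<bullet> h"])
      fix x assume x: "x \<in> closed_segment a b"
      show "(f has_derivative (\<bullet>) (grad f x)) (at x within closed_segment a b)"
        using d1 by (rule has_derivative_at_withinI)
      have "(\<bullet>) (grad f x) - (\<bullet>) (grad f a) = (\<bullet>) (grad f x - grad f a)"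
        by (auto simp: fun_eq_iff inner_diff_left)
      then have "onorm ((\<bullet>) (grad f x) - (\<bullet>) (grad f a)) \<le> norm (grad f x - grad f a)"
        by (auto intro!: onorm_bound simp: Cauchy_Schwarz_ineq2)
      also have "\<dots> \<le> k * M * norm (x - a)"
        using x seg[OF ab] ab by (intro G1) auto
      also have "\<dots> \<le> k * M * norm (b - a)"
        using k M0 segment_bound(1)[OF x] by (intro mult_left_mono) auto
      finally show "onorm ((\<bullet>) (grad f x) - (\<bullet>) (grad f a)) \<le> k * M * norm (b - a)" .
    qed (use param in auto)
    then show ?thesis by (simp add: power2_eq_square mult_ac)
  qed
  define L' where "L' = k * (L + M)"
  have "k * L \<le> L'" "k * M \<le> L'" "L \<le> L'"
    using k L0 M0 mult_right_mono[OF k, of L] by (auto simp: L'_def algebra_simps add_increasing2)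
  note le = this
  show ?thesis
  proof (rule that[of \<rho> L'])
    fix a b assume ab: "a \<in> ball z \<rho>" "b \<in> ball z \<rho>"
    show "norm (hess f b - hess f a) \<le> L' * norm (b - a)"
      using H[OF ab] le(3) by (meson mult_right_mono norm_ge_zero order_trans)
    show "norm (grad f b - grad f a - hess f a *v (b - a)) \<le> L' * (norm (b - a))\<^sup>2"
      using G2[OF ab] le(1) by (meson mult_right_mono zero_le_power2 order_trans)
    show "norm (grad f b - grad f a) \<le> L' * norm (b - a)"
      using G1[OF ab] le(2) by (meson mult_right_mono norm_ge_zero order_trans)
    show "norm (f b - f a - grad f a \<bullet> (b - a)) \<le> L' * (norm (b - a))\<^sup>2"
      using F2[OF ab] le(2) by (meson mult_right_mono zero_le_power2 order_trans)
  qed (rule rho)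
qed

text \<open>Both points move, since expansions are needed around \<open>zs\<close> and, for the
  damped step, around the current iterate.\<close>

lemma taylor_bigO:
  fixes f :: "real^'n \<Rightarrow> real"
  assumes f: "twice_lipschitz_diff f" and a: "(a \<longlongrightarrow> z) F" and b: "(b \<longlongrightarrow> z) F"
  shows "bigO F (\<lambda>x. hess f (b x) - hess f (a x)) (\<lambda>x. norm (b x - a x))"
    and "bigO F (\<lambda>x. grad f (b x) - grad f (a x) - hess f (a x) *v (b x - a x)) (\<lambda>x. (norm (b x - a x))\<^sup>2)"
    and "bigO F (\<lambda>x. grad f (b x) - grad f (a x)) (\<lambda>x. norm (b x - a x))"
    and "bigO F (\<lambda>x. f (b x) - f (a x) - grad f (a x) \<bullet> (b x - a x)) (\<lambda>x. (norm (b x - a x))\<^sup>2)"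
proof -
  obtain \<rho> L where rho: "\<rho> > 0" and *:
    "\<And>a b. a \<in> ball z \<rho> \<Longrightarrow> b \<in> ball z \<rho> \<Longrightarrow> norm (hess f b - hess f a) \<le> L * norm (b - a)"
    "\<And>a b. a \<in> ball z \<rho> \<Longrightarrow> b \<in> ball z \<rho> \<Longrightarrow>
       norm (grad f b - grad f a - hess f a *v (b - a)) \<le> L * (norm (b - a))\<^sup>2"
    "\<And>a b. a \<in> ball z \<rho> \<Longrightarrow> b \<in> ball z \<rho> \<Longrightarrow> norm (grad f b - grad f a) \<le> L * norm (b - a)"
    "\<And>a b. a \<in> ball z \<rho> \<Longrightarrow> b \<in> ball z \<rho> \<Longrightarrow>
       norm (f b - f a - grad f a \<bullet> (b - a)) \<le> L * (norm (b - a))\<^sup>2"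
    by (rule twice_lipschitz_diff_taylor[OF f, of z]) (rule that)
  have ev: "\<forall>\<^sub>F x in F. a x \<in> ball z \<rho> \<and> b x \<in> ball z \<rho>"
    using tendstoD[OF a rho] tendstoD[OF b rho]
    by eventually_elim (simp add: dist_commute)
  show "bigO F (\<lambda>x. hess f (b x) - hess f (a x)) (\<lambda>x. norm (b x - a x))"
    by (rule bigOI[where c=L], use ev in eventually_elim) (simp add: *)
  show "bigO F (\<lambda>x. grad f (b x) - grad f (a x) - hess f (a x) *v (b x - a x)) (\<lambda>x. (norm (b x - a x))\<^sup>2)"
    by (rule bigOI[where c=L], use ev in eventually_elim) (simp add: *)
  show "bigO F (\<lambda>x. grad f (b x) - grad f (a x)) (\<lambda>x. norm (b x - a x))"
    by (rule bigOI[where c=L], use ev in eventually_elim) (simp add: *)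
  show "bigO F (\<lambda>x. f (b x) - f (a x) - grad f (a x) \<bullet> (b x - a x)) (\<lambda>x. (norm (b x - a x))\<^sup>2)"
    by (rule bigOI[where c=L], use ev in eventually_elim) (use * in simp)
qed

lemma transpose_grad_cols_nth: "(transpose (grad_cols g z) *v w) $ i = grad (\<lambda>x. g x $ i) z \<bullet> w"
  by (simp add: matrix_vector_mul_component transpose_def grad_cols_def)

lemma inner_grad_cols: "w \<bullet> (grad_cols g z *v v) = (transpose (grad_cols g z) *v w) \<bullet> v"
  by (metis dot_lmul_matrix transpose_matrix_vector)

lemma grad_cols_matvec: "grad_cols g z *v v = (\<Sum>i\<in>UNIV. v $ i *\<^sub>R grad (\<lambda>x. g x $ i) z)"
  by (simp add: vec_eq_iff matrix_vector_mult_def grad_cols_def mult.commute)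

locale smooth_nlp =
  fixes \<phi> :: "real^'n \<Rightarrow> real" and g :: "real^'n \<Rightarrow> real^'m"
  assumes smooth_obj: "twice_lipschitz_diff \<phi>"
    and smooth_constr: "\<And>i. twice_lipschitz_diff (\<lambda>z. g z $ i)"
begin

abbreviation "J \<equiv> grad_cols g"

lemma lagr_z_eq: "lagr_z \<phi> g z lam = grad \<phi> z + J z *v lam"
proof -
  have "((\<lambda>y. \<phi> y + (\<Sum>i\<in>UNIV. lam $ i * g y $ i)) has_derivative
     (\<lambda>h. grad \<phi> z \<bullet> h + (\<Sum>i\<in>UNIV. lam $ i * (grad (\<lambda>x. g x $ i) z \<bullet> h)))) (at z)"
    by (intro has_derivative_add has_derivative_sum has_derivative_mult_right
        twice_lipschitz_diff_derivs smooth_obj smooth_constr)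
  moreover have "(\<lambda>y. lagrangian \<phi> g y lam) = (\<lambda>y. \<phi> y + (\<Sum>i\<in>UNIV. lam $ i * g y $ i))"
    by (simp add: lagrangian_def inner_vec_def)
  moreover have "(\<lambda>h. grad \<phi> z \<bullet> h + (\<Sum>i\<in>UNIV. lam $ i * (grad (\<lambda>x. g x $ i) z \<bullet> h))) =
      (\<lambda>h. (grad \<phi> z + J z *v lam) \<bullet> h)"
    by (simp add: inner_add_left grad_cols_matvec inner_sum_left)
  ultimately show ?thesis unfolding lagr_z_def by (intro grad_eqI) simp
qed

lemma lagr_zz_eq: "lagr_zz \<phi> g z lam = hess \<phi> z + (\<Sum>i\<in>UNIV. lam $ i *\<^sub>R hess (\<lambda>z. g z $ i) z)"
proof -
  have "grad (\<lambda>y. lagrangian \<phi> g y lam) = (\<lambda>z. grad \<phi> z + (\<Sum>i\<in>UNIV. lam $ i *\<^sub>R grad (\<lambda>x. g x $ i) z))"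
    by (rule ext) (simp add: lagr_z_eq[unfolded lagr_z_def] grad_cols_matvec)
  moreover have "((\<lambda>z. grad \<phi> z + (\<Sum>i\<in>UNIV. lam $ i *\<^sub>R grad (\<lambda>x. g x $ i) z)) has_derivative
     (\<lambda>h. hess \<phi> z *v h + (\<Sum>i\<in>UNIV. lam $ i *\<^sub>R (hess (\<lambda>x. g x $ i) z *v h)))) (at z)"
    by (intro has_derivative_add has_derivative_sum has_derivative_scaleR_right
        twice_lipschitz_diff_derivs smooth_obj smooth_constr)
  moreover have "(\<lambda>h. hess \<phi> z *v h + (\<Sum>i\<in>UNIV. lam $ i *\<^sub>R (hess (\<lambda>x. g x $ i) z *v h))) =
     (\<lambda>h. (hess \<phi> z + (\<Sum>i\<in>UNIV. lam $ i *\<^sub>R hess (\<lambda>z. g z $ i) z)) *v h)"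
    by (rule ext) (simp only: matrix_vector_mult_add_rdistrib bounded_bilinear.sum_left[OF bounded_bilinear_matvec]
        scaleR_matrix_vector_assoc)
  ultimately show ?thesis unfolding lagr_zz_def by (intro hess_eqI) simp
qed

text \<open>The Hessian is affine in the multiplier, so at a fixed point close multipliers have
  close Hessians.\<close>

lemma lagr_zz_diff_mult: "lagr_zz \<phi> g z lam - lagr_zz \<phi> g z lam' = (\<Sum>i\<in>UNIV. (lam - lam') $ i *\<^sub>R hess (\<lambda>z. g z $ i) z)"
  by (simp add: lagr_zz_eq sum_subtractf scaleR_diff_left)

context
  fixes F :: "'a filter" and a b :: "'a \<Rightarrow> real^'n" and z0
  assumes a: "(a \<longlongrightarrow> z0) F" and b: "(b \<longlongrightarrow> z0) F"
begin

lemma J_bigO: "bigO F (\<lambda>x. J (b x) - J (a x)) (\<lambda>x. norm (b x - a x))"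
proof -
  have "bigO F (\<lambda>x. grad (\<lambda>z. g z $ i) (b x) $ j - grad (\<lambda>z. g z $ i) (a x) $ j) (\<lambda>x. norm (b x - a x))" for i j
    using bigO_nth[OF taylor_bigO(3)[OF smooth_constr a b]] by simp
  then show ?thesis
    by (intro bigO_vec) (simp add: grad_cols_def)
qed

lemma g_bigO: "bigO F (\<lambda>x. g (b x) - g (a x) - transpose (J (a x)) *v (b x - a x)) (\<lambda>x. (norm (b x - a x))\<^sup>2)"
  by (rule bigO_vec)
    (use taylor_bigO(4)[OF smooth_constr a b] in \<open>simp add: transpose_grad_cols_nth\<close>)

context
  fixes lam :: "'a \<Rightarrow> real^'m"
  assumes lam: "bigO F lam (\<lambda>_. 1)"
begin

lemma lagr_zz_bigO:
  "bigO F (\<lambda>x. lagr_zz \<phi> g (b x) (lam x) - lagr_zz \<phi> g (a x) (lam x)) (\<lambda>x. norm (b x - a x))"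
proof -
  have "bigO F (\<lambda>x. lam x $ i *\<^sub>R (hess (\<lambda>z. g z $ i) (b x) - hess (\<lambda>z. g z $ i) (a x)))
     (\<lambda>x. 1 * norm (b x - a x))" for i
    by (intro bigO_scaleR lam[THEN bigO_nth] taylor_bigO[OF smooth_constr a b])
  then have "bigO F (\<lambda>x. (hess \<phi> (b x) - hess \<phi> (a x)) + (\<Sum>i\<in>UNIV. lam x $ i *\<^sub>R (hess (\<lambda>z. g z $ i) (b x) - hess (\<lambda>z. g z $ i) (a x))))
     (\<lambda>x. norm (b x - a x))"
    by (intro bigO_add bigO_sum taylor_bigO[OF smooth_obj a b]) simp
  then show ?thesis
    by (rule bigO_eq) (simp add: lagr_zz_eq sum_subtractf scaleR_diff_right algebra_simps)
qed

text \<open>The same multiplier stands at both points, so it only has to be bounded. This matters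
  because the multipliers of the iterates need not converge.\<close>

lemma lagr_z_bigO:
  "bigO F (\<lambda>x. lagr_z \<phi> g (b x) (lam x) - lagr_z \<phi> g (a x) (lam x) - lagr_zz \<phi> g (a x) (lam x) *v (b x - a x))
     (\<lambda>x. (norm (b x - a x))\<^sup>2)"
proof -
  have "bigO F (\<lambda>x. lam x $ i *\<^sub>R (grad (\<lambda>z. g z $ i) (b x) - grad (\<lambda>z. g z $ i) (a x) - hess (\<lambda>z. g z $ i) (a x) *v (b x - a x)))
     (\<lambda>x. 1 * (norm (b x - a x))\<^sup>2)" for i
    by (intro bigO_scaleR lam[THEN bigO_nth] taylor_bigO[OF smooth_constr a b])
  then have "bigO F (\<lambda>x. (grad \<phi> (b x) - grad \<phi> (a x) - hess \<phi> (a x) *v (b x - a x)) + (\<Sum>i\<in>UNIV. lam x $ i *\<^sub>R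
        (grad (\<lambda>z. g z $ i) (b x) - grad (\<lambda>z. g z $ i) (a x) - hess (\<lambda>z. g z $ i) (a x) *v (b x - a x))))
     (\<lambda>x. (norm (b x - a x))\<^sup>2)"
    by (intro bigO_add bigO_sum taylor_bigO[OF smooth_obj a b]) simp
  then show ?thesis
    by (rule bigO_eq)
      (simp add: lagr_z_eq lagr_zz_eq grad_cols_matvec sum_subtractf scaleR_diff_right sum.distrib
        matrix_vector_mult_add_rdistrib bounded_bilinear.sum_left[OF bounded_bilinear_matvec]
        scaleR_matrix_vector_assoc algebra_simps)
qed

end

end

end

section \<open>Central points near the solution set\<close>

text \<open>Turns coercivity into a bound: after testing with \<open>p\<close>, one factor
  \<open>norm (p x)\<close> is cancelled.\<close>

lemma bigO_absorb:
  assumes "bigO F (\<lambda>x. (norm (p x))\<^sup>2) (\<lambda>x. norm (p x) * w x)"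
  shows "bigO F p w"
proof -
  obtain c where c: "\<forall>\<^sub>F x in F. norm ((norm (p x))\<^sup>2) \<le> c * \<bar>norm (p x) * w x\<bar>" "c > 0"
    using bigOE[OF assms] by metis
  show ?thesis
  proof (rule bigOI[where c=c], use c(1) in eventually_elim)
    case (elim x)
    then have "norm (p x) * norm (p x) \<le> norm (p x) * (c * \<bar>w x\<bar>)"
      by (simp add: power2_eq_square abs_mult mult_ac)
    then show ?case using c(2) by (cases "p x = 0") auto
  qed
qed

section \<open>The multiplier set and the active gradients\<close>

locale regular_nlp = smooth_nlp \<phi> g
  for \<phi> :: "real^'n \<Rightarrow> real" and g :: "real^'n \<Rightarrow> real^'m" +
  fixes zs :: "real^'n"
  assumes multipliers_nonempty: "multipliers \<phi> g zs \<noteq> {}"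
    and mfcq: "mfcq g zs"
    and second_order: "second_order \<phi> g zs"
    and strict_compl: "strict_compl \<phi> g zs"
begin

abbreviation "A \<equiv> J zs"
abbreviation "B \<equiv> active g zs"
abbreviation "S \<equiv> multipliers \<phi> g zs"

lemma mem_S_iff: "lam \<in> S \<longleftrightarrow> lagr_z \<phi> g zs lam = 0 \<and> g zs \<le> 0 \<and> 0 \<le> lam \<and> lam \<bullet> g zs = 0"
  by (simp add: multipliers_def kkt_def)

lemma g_zs_nonpos: "g zs $ i \<le> 0"
  using multipliers_nonempty mem_S_iff by (auto simp: less_eq_vec_def)

lemma g_zs_neg: "i \<notin> B \<Longrightarrow> g zs $ i < 0"
  using g_zs_nonpos[of i] by (auto simp: active_def order_less_le)

lemma S_nonneg: "lam \<in> S \<Longrightarrow> 0 \<le> lam $ i"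
  by (auto simp: mem_S_iff less_eq_vec_def)

lemma S_inactive: assumes "lam \<in> S" "i \<notin> B" shows "lam $ i = 0"
proof -
  have "(\<Sum>i\<in>UNIV. - (lam $ i * g zs $ i)) = 0"
    using assms by (simp add: mem_S_iff inner_vec_def sum_negf)
  moreover have "0 \<le> - (lam $ i * g zs $ i)" for i
    using S_nonneg[OF assms(1)] g_zs_nonpos by (simp add: mult_nonneg_nonpos)
  ultimately have "lam $ i * g zs $ i = 0"
    using sum_nonneg_eq_0_iff[of UNIV "\<lambda>i. - (lam $ i * g zs $ i)"] by auto
  then show ?thesis using g_zs_neg[OF assms(2)] by auto
qed

text \<open>The gradient is affine in the multiplier and vanishes at \<open>l\<close>, which
  eliminates the gradient of \<phi>.\<close>

lemma lagr_z_zs: "l \<in> S \<Longrightarrow> lagr_z \<phi> g zs lam = A *v (lam - l)"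
  by (simp add: mem_S_iff lagr_z_eq matrix_vector_mult_diff_distrib eq_neg_iff_add_eq_0[symmetric])

text \<open>Pairing stationarity with the direction from the constraint qualification writes the
  fixed number \<open>grad \<phi> zs \<bullet> y\<close> as a sum of nonnegative terms
  \<open>lam $ i * - a i\<close>. Each of them is therefore bounded, and \<open>a i\<close> is
  negative on the active set.\<close>

lemma S_bounded: obtains M where "\<And>lam. lam \<in> S \<Longrightarrow> norm lam \<le> M"
proof -
  obtain y where y: "\<And>i. i \<in> B \<Longrightarrow> grad (\<lambda>x. g x $ i) zs \<bullet> y < 0"
    using mfcq by (auto simp: mfcq_def)
  define a where "a i = grad (\<lambda>x. g x $ i) zs \<bullet> y" for i
  \<comment> \<open>For inactive \<open>i\<close> the quotient is arbitrary, possibly a division by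
    zero with value 0; it only has to dominate \<open>lam $ i = 0\<close>.\<close>
  define M where "M = (\<Sum>i\<in>UNIV. \<bar>(grad \<phi> zs \<bullet> y) / a i\<bar>)"
  have "norm lam \<le> M" if lam: "lam \<in> S" for lam
  proof -
    have "grad \<phi> zs + A *v lam = 0" using lam by (simp add: mem_S_iff lagr_z_eq)
    then have "grad \<phi> zs \<bullet> y + (A *v lam) \<bullet> y = 0" by (metis inner_add_left inner_zero_left)
    then have sum0: "(\<Sum>i\<in>UNIV. lam $ i * - a i) = grad \<phi> zs \<bullet> y"
      by (simp add: grad_cols_matvec inner_sum_left a_def sum_negf)
    have nn: "0 \<le> lam $ i * - a i" for i
      using S_nonneg[OF lam] S_inactive[OF lam] y by (cases "i \<in> B") (auto simp: a_def mult_nonneg_nonpos order.strict_implies_order)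
    have "\<bar>lam $ i\<bar> \<le> \<bar>(grad \<phi> zs \<bullet> y) / a i\<bar>" for i
    proof (cases "i \<in> B")
      case True
      then have ai: "a i < 0" using y by (simp add: a_def)
      have "lam $ i * - a i \<le> grad \<phi> zs \<bullet> y"
        unfolding sum0[symmetric] by (rule member_le_sum) (use nn in auto)
      with ai S_nonneg[OF lam, of i] show ?thesis
        by (simp add: abs_div field_simps)
    next
      case False
      then show ?thesis using S_inactive[OF lam] by simp
    qed
    then have "(\<Sum>i\<in>UNIV. \<bar>lam $ i\<bar>) \<le> M" unfolding M_def by (intro sum_mono)
    with norm_le_l1_cart[of lam] show ?thesis by linarith
  qed
  with that show ?thesis by blast
qed

text \<open>\<open>T\<close> and \<open>T'\<close> are \<open>A\<^sub>B\<^sup>T\<close> and \<open>A\<^sub>B\<close>; \<open>v - R (T v)\<close> lies in the kernel of \<open>T\<close> at distance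
  \<open>O(|T v|)\<close> from \<open>v\<close>.\<close>

definition T where "T v = mask B (transpose A *v v)"
definition T' where "T' x = A *v mask B x"

lemma linear_T: "linear T"
  unfolding T_def by (intro linear_compose[OF _ linear_mask, unfolded o_def] matrix_vector_mul_linear)

lemma linear_T': "linear T'"
  unfolding T'_def by (intro linear_compose[OF linear_mask, unfolded o_def] matrix_vector_mul_linear)

definition R where "R = (SOME R. linear R \<and> (\<forall>x. T (x - R (T x)) = 0))"
definition R' where "R' = (SOME R. linear R \<and> (\<forall>x. T' (x - R (T' x)) = 0))"

lemma R: "linear R" "T (x - R (T x)) = 0"
proof -
  have "\<exists>R. linear R \<and> (\<forall>x. T (x - R (T x)) = 0)"
    using linear_partial_right_inverse[OF linear_T] by blast
  from someI_ex[OF this] show "linear R" "T (x - R (T x)) = 0" by (auto simp: R_def)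
qed

lemma R': "linear R'" "T' (x - R' (T' x)) = 0"
proof -
  have "\<exists>R. linear R \<and> (\<forall>x. T' (x - R (T' x)) = 0)"
    using linear_partial_right_inverse[OF linear_T'] by blast
  from someI_ex[OF this] show "linear R'" "T' (x - R' (T' x)) = 0" by (auto simp: R'_def)
qed

text \<open>Strict complementarity makes every active constraint strongly active, so the cone in the
  second-order condition becomes the subspace where \<open>T\<close> vanishes.\<close>

lemma curvature:
  obtains \<xi> where "\<xi> > 0"
    "\<And>lam w. lam \<in> S \<Longrightarrow> T w = 0 \<Longrightarrow> \<xi> * (norm w)\<^sup>2 \<le> w \<bullet> (lagr_zz \<phi> g zs lam *v w)"
proof -
  obtain \<xi> where xi: "\<xi> > 0" "\<And>lam w. lam \<in> S \<Longrightarrow>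
        (\<forall>i \<in> active_pos \<phi> g zs. grad (\<lambda>x. g x $ i) zs \<bullet> w = 0) \<Longrightarrow>
        (\<forall>i \<in> active g zs - active_pos \<phi> g zs. grad (\<lambda>x. g x $ i) zs \<bullet> w \<le> 0) \<Longrightarrow>
        \<xi> * (norm w)\<^sup>2 \<le> w \<bullet> (lagr_zz \<phi> g zs lam *v w)"
    using second_order unfolding second_order_def by meson
  have eq: "active_pos \<phi> g zs = B"
    using strict_compl by (auto simp: strict_compl_def active_pos_def)
  have "\<xi> * (norm w)\<^sup>2 \<le> w \<bullet> (lagr_zz \<phi> g zs lam *v w)" if "lam \<in> S" "T w = 0" for lam w
  proof (rule xi(2)[OF that(1)])
    have "grad (\<lambda>x. g x $ i) zs \<bullet> w = 0" if "i \<in> B" for i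
    proof -
      have "T w $ i = 0" using \<open>T w = 0\<close> by simp
      with that show ?thesis by (simp add: T_def mask_nth transpose_grad_cols_nth)
    qed
    then show "\<forall>i\<in>active_pos \<phi> g zs. grad (\<lambda>x. g x $ i) zs \<bullet> w = 0"
      "\<forall>i \<in> active g zs - active_pos \<phi> g zs. grad (\<lambda>x. g x $ i) zs \<bullet> w \<le> 0" by (auto simp: eq)
  qed
  with xi(1) that show ?thesis by blast
qed

text \<open>A vector of the kernel of \<open>T\<close> does not see the active multipliers, so
  testing with it leaves only the small inactive ones.\<close>

lemma kernel_T_inner: "T w = 0 \<Longrightarrow> w \<bullet> (A *v v) = (transpose A *v w) \<bullet> mask (- B) v"
proof -
  assume "T w = 0"
  then have "mask (- B) (transpose A *v w) = transpose A *v w"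
    by (auto simp: T_def mask_nth vec_eq_iff split: if_splits)
  then show ?thesis by (metis inner_grad_cols inner_mask)
qed

end

section \<open>Sizes of slacks, multipliers and distances along central iterates\<close>

locale central_family = regular_nlp \<phi> g zs
  for \<phi> :: "real^'n \<Rightarrow> real" and g :: "real^'n \<Rightarrow> real^'m" and zs :: "real^'n" +
  fixes F :: "'a filter" and z :: "'a \<Rightarrow> real^'n" and lam s :: "'a \<Rightarrow> real^'m" and C \<gamma> :: real
  assumes gamma: "\<gamma> > 0"
    and central: "\<forall>\<^sub>F x in F. centrality \<phi> g C \<gamma> (z x) (lam x) (s x)"
    and dist_tendsto: "((\<lambda>x. dist_sol \<phi> g zs (z x) (lam x)) \<longlongrightarrow> 0) F"
    and mu_tendsto: "((\<lambda>x. mu (lam x) (s x)) \<longlongrightarrow> 0) F"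
begin

abbreviation "\<mu> x \<equiv> mu (lam x) (s x)"

text \<open>An almost nearest multiplier. The positive tolerance \<open>\<mu> x\<close> ensures
  existence without showing that the infimum is attained.\<close>

definition ls where
  "ls x = (SOME l. l \<in> S \<and> dist (z x, lam x) (zs, l) \<le> dist_sol \<phi> g zs (z x) (lam x) + \<mu> x)"

abbreviation "y x \<equiv> z x - zs"
abbreviation "H x \<equiv> lagr_zz \<phi> g zs (lam x)"

lemma positive: "\<forall>\<^sub>F x in F. 0 < lam x $ i \<and> 0 < s x $ i"
  using central by eventually_elim (simp add: centrality_def)

lemma product_le: "\<forall>\<^sub>F x in F. lam x $ i * s x $ i \<le> CARD('m) * \<mu> x"
proof -
  have "\<forall>\<^sub>F x in F. \<forall>i. 0 < lam x $ i \<and> 0 < s x $ i"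
    using central by eventually_elim (simp add: centrality_def)
  then show ?thesis
  proof eventually_elim
    case (elim x)
    then have "lam x $ i * s x $ i \<le> (\<Sum>i\<in>UNIV. lam x $ i * s x $ i)"
      by (intro member_le_sum) (auto simp: less_imp_le)
    then show ?case by (simp add: mu_def inner_vec_def)
  qed
qed

lemma product_ge: "\<forall>\<^sub>F x in F. \<gamma> * \<mu> x \<le> lam x $ i * s x $ i"
  using central by eventually_elim (simp add: centrality_def)

lemma mu_pos: "\<forall>\<^sub>F x in F. 0 < \<mu> x"
  \<comment> \<open>Any index serves, because the index type is nonempty.\<close>
  using product_le[of undefined] positive[of undefined]
  by eventually_elim (metis mult_pos_pos less_le_trans of_nat_0_less_iff zero_less_card_finite zero_less_mult_pos)

lemma mu_1: "bigO F \<mu> (\<lambda>_. 1)"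
  by (rule bigO_tendsto[OF mu_tendsto])

lemma ls: "\<forall>\<^sub>F x in F. ls x \<in> S \<and> dist (z x, lam x) (zs, ls x) \<le> dist_sol \<phi> g zs (z x) (lam x) + \<mu> x"
  using mu_pos
proof eventually_elim
  case (elim x)
  have "{zs} \<times> S \<noteq> {}" using multipliers_nonempty by auto
  then have "\<exists>a \<in> {zs} \<times> S. dist (z x, lam x) a < dist_sol \<phi> g zs (z x) (lam x) + \<mu> x"
    using elim cInf_lessD[of "dist (z x, lam x) ` ({zs} \<times> S)" "dist_sol \<phi> g zs (z x) (lam x) + \<mu> x"]
    by (auto simp: dist_sol_def infdist_notempty)
  then have "\<exists>l. l \<in> S \<and> dist (z x, lam x) (zs, l) \<le> dist_sol \<phi> g zs (z x) (lam x) + \<mu> x"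
    by (auto intro: less_imp_le)
  from someI_ex[OF this] show ?case by (simp add: ls_def)
qed

lemma ls_mem: "\<forall>\<^sub>F x in F. ls x \<in> S"
  using ls by eventually_elim simp

lemma dist_ls_tendsto: "((\<lambda>x. dist (z x, lam x) (zs, ls x)) \<longlongrightarrow> 0) F"
proof (rule Lim_null_comparison)
  show "((\<lambda>x. dist_sol \<phi> g zs (z x) (lam x) + \<mu> x) \<longlongrightarrow> 0) F"
    using tendsto_add[OF dist_tendsto mu_tendsto] by simp
qed (use ls in eventually_elim, simp)

lemma z_tendsto: "(z \<longlongrightarrow> zs) F"
proof (rule LIM_zero_cancel)
  show "((\<lambda>x. z x - zs) \<longlongrightarrow> 0) F"
    by (rule Lim_null_comparison[OF _ dist_ls_tendsto], rule always_eventually)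
      (metis dist_fst_le dist_norm fst_conv)
qed

lemma lam_ls_tendsto: "((\<lambda>x. lam x - ls x) \<longlongrightarrow> 0) F"
  by (rule Lim_null_comparison[OF _ dist_ls_tendsto], rule always_eventually)
    (metis dist_snd_le dist_norm snd_conv)

lemma y_tendsto: "(y \<longlongrightarrow> 0) F"
  using z_tendsto by (simp add: LIM_zero)

text \<open>The multipliers approach the bounded set \<open>S\<close>, though not necessarily one
  point of it.\<close>

lemma lam_1: "bigO F lam (\<lambda>_. 1)"
proof -
  obtain M where M: "\<And>lam. lam \<in> S \<Longrightarrow> norm lam \<le> M" using S_bounded by blast
  have "bigO F ls (\<lambda>_. 1)"
    by (rule bigOI[where c=M], use ls_mem in eventually_elim) (use M in simp)
  from bigO_add[OF bigO_tendsto[OF lam_ls_tendsto] this] show ?thesis by simp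
qed

lemma r_f_mu: "bigO F (\<lambda>x. lagr_z \<phi> g (z x) (lam x)) \<mu>"
  by (rule bigO_mono[where c=C], use central in eventually_elim, simp add: centrality_def r_f_def,
      use mu_pos in eventually_elim, simp)

lemma r_g_mu: "bigO F (\<lambda>x. g (z x) + s x) \<mu>"
  by (rule bigO_mono[where c=C], use central in eventually_elim, simp add: centrality_def r_g_def,
      use mu_pos in eventually_elim, simp)

text \<open>The residual of a central point plus the Taylor remainder at \<open>zs\<close>: the
  working error weight until \<open>y\<close> is known to be \<open>O(\<mu>)\<close>.\<close>

abbreviation "\<omega> x \<equiv> \<mu> x + (norm (y x))\<^sup>2"

lemma mu_omega: "bigO F v \<mu> \<Longrightarrow> bigO F v \<omega>"
  by (erule bigO_trans, rule bigOI[where c=1], use mu_pos in eventually_elim) simp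

lemma y2_omega: "bigO F v (\<lambda>x. (norm (y x))\<^sup>2) \<Longrightarrow> bigO F v \<omega>"
  by (erule bigO_trans, rule bigOI[where c=1], use mu_pos in eventually_elim) simp

lemma H_1: "bigO F H (\<lambda>_. 1)"
proof -
  have "bigO F (\<lambda>x. lam x $ i *\<^sub>R hess (\<lambda>z. g z $ i) zs) (\<lambda>_. 1 * 1)" for i
    by (intro bigO_scaleR bigO_nth lam_1 bigO_const)
  then show ?thesis unfolding lagr_zz_eq by (intro bigO_add bigO_const bigO_sum) simp
qed

lemma stationarity: "bigO F (\<lambda>x. lagr_z \<phi> g zs (lam x) + H x *v y x) \<omega>"
  by (rule bigO_eq[OF bigO_diff[OF mu_omega[OF r_f_mu] y2_omega[OF lagr_z_bigO[OF tendsto_const z_tendsto lam_1]]]])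
    simp

lemma slack: "bigO F (\<lambda>x. s x + g zs + transpose A *v y x) \<omega>"
  by (rule bigO_eq[OF bigO_diff[OF mu_omega[OF r_g_mu] y2_omega[OF g_bigO[OF tendsto_const z_tendsto]]]])
    simp

lemma omega_tendsto: "(\<omega> \<longlongrightarrow> 0) F"
proof -
  have "(\<omega> \<longlongrightarrow> 0 + (norm (0 :: real^'n))\<^sup>2) F"
    by (intro tendsto_add tendsto_power tendsto_norm mu_tendsto y_tendsto)
  then show ?thesis by simp
qed

lemma y_1: "bigO F y (\<lambda>_. 1)"
  by (rule bigO_tendsto[OF y_tendsto])

lemma s_tendsto: "(s \<longlongrightarrow> - g zs) F"
proof -
  have "((\<lambda>x. (s x + g zs + transpose A *v y x) - transpose A *v y x) \<longlongrightarrow> 0 - transpose A *v 0) F"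
    by (intro tendsto_diff bigO_tendsto_0[OF slack omega_tendsto]
        bounded_linear.tendsto[OF matrix_vector_mul_bounded_linear] y_tendsto)
  then have "((\<lambda>x. s x + g zs) \<longlongrightarrow> 0) F" by simp
  from tendsto_diff[OF this tendsto_const[of "g zs"]] show ?thesis by simp
qed

lemma s_1: "bigO F s (\<lambda>_. 1)"
  by (rule bigO_tendsto[OF s_tendsto])

lemma s_inactive:
  assumes "i \<notin> B" obtains c where "c > 0" "\<forall>\<^sub>F x in F. c \<le> s x $ i"
proof -
  have "((\<lambda>x. s x $ i) \<longlongrightarrow> (- g zs) $ i) F" by (rule tendsto_vec_nth[OF s_tendsto])
  then have "\<forall>\<^sub>F x in F. - g zs $ i / 2 < s x $ i"
    by (rule order_tendstoD) (use g_zs_neg[OF assms] in simp)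
  then have "\<forall>\<^sub>F x in F. - g zs $ i / 2 \<le> s x $ i" by eventually_elim simp
  with that[of "- g zs $ i / 2"] g_zs_neg[OF assms] show ?thesis by simp
qed

lemma lam_inactive: "i \<notin> B \<Longrightarrow> bigO F (\<lambda>x. lam x $ i) \<mu>"
proof -
  assume "i \<notin> B"
  then obtain c where c: "c > 0" "\<forall>\<^sub>F x in F. c \<le> s x $ i" by (rule s_inactive)
  show ?thesis
  proof (rule bigO_mono[where c = "CARD('m) / c"], use c(2) product_le[of i] positive[of i] in eventually_elim)
    case (elim x)
    have "lam x $ i * c \<le> lam x $ i * s x $ i" using elim by (intro mult_left_mono) auto
    with elim have "lam x $ i * c \<le> CARD('m) * \<mu> x" by linarith
    with c elim show ?case by (simp add: field_simps)
  qed (use mu_pos in eventually_elim, simp)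
qed

lemma mask_lam_inactive: "bigO F (\<lambda>x. mask (- B) (lam x)) \<mu>"
  by (rule bigO_mask) (simp add: lam_inactive)

text \<open>The lower centrality bound prevents both factors of a product from being too small. With
  \<open>w = 1\<close> it gives a multiple of \<mu> below the other factor; with
  \<open>w = \<mu>\<close> it keeps the active multipliers away from 0.\<close>

lemma lower_bound_from_product:
  assumes prod: "\<forall>\<^sub>F x in F. \<gamma> * \<mu> x \<le> a x * b x" and a: "bigO F a w"
    and pos: "\<forall>\<^sub>F x in F. 0 < a x \<and> 0 < b x"
  obtains c where "c > 0" "\<forall>\<^sub>F x in F. c * \<mu> x \<le> \<bar>w x\<bar> * b x"
proof -
  obtain d where d: "d > 0" "\<forall>\<^sub>F x in F. norm (a x) \<le> d * \<bar>w x\<bar>" using bigOE[OF a] by auto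
  have "\<forall>\<^sub>F x in F. (\<gamma> / d) * \<mu> x \<le> \<bar>w x\<bar> * b x"
    using prod d(2) pos
  proof eventually_elim
    case (elim x)
    have "a x * b x \<le> d * \<bar>w x\<bar> * b x" using elim by (intro mult_right_mono) auto
    with elim have "\<gamma> * \<mu> x \<le> d * \<bar>w x\<bar> * b x" by linarith
    with d(1) show ?case by (simp add: field_simps)
  qed
  with that[of "\<gamma> / d"] gamma d(1) show ?thesis by simp
qed

lemma lam_inactive_lower: obtains c where "c > 0" "\<forall>\<^sub>F x in F. c * \<mu> x \<le> lam x $ i"
  by (rule lower_bound_from_product[of "\<lambda>x. s x $ i" "\<lambda>x. lam x $ i" "\<lambda>_. 1"])
    (use product_ge[of i] positive[of i] in \<open>auto simp: mult.commute intro: bigO_nth s_1 elim: eventually_mono\<close>)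

lemma s_active_lower: obtains c where "c > 0" "\<forall>\<^sub>F x in F. c * \<mu> x \<le> s x $ i"
  by (rule lower_bound_from_product[of "\<lambda>x. lam x $ i" "\<lambda>x. s x $ i" "\<lambda>_. 1"])
    (use product_ge[of i] positive[of i] in \<open>auto intro: bigO_nth lam_1 elim: eventually_mono\<close>)

text \<open>Monotonicity of the KKT system: \<open>(\<lambda> - \<lambda>\<^sub>0) \<bullet> (s + g(z\<^sup>*)) = O(\<omega>)\<close>, and its only
  terms of unknown size are \<open>\<lambda>\<^sub>0 \<bullet> s\<close> and \<open>\<lambda> \<bullet> g(z\<^sup>*)\<close>, which pull in the same direction.\<close>

lemma s_active_omega: "i \<in> B \<Longrightarrow> bigO F (\<lambda>x. s x $ i) \<omega>"
proof -
  assume i: "i \<in> B"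
  obtain l0 where l0: "l0 \<in> S" "\<And>i. i \<in> B \<Longrightarrow> l0 $ i > 0"
    using strict_compl by (auto simp: strict_compl_def)
  have lam_l0: "bigO F (\<lambda>x. lam x - l0) (\<lambda>_. 1)" by (intro bigO_diff lam_1 bigO_const)
  have 1: "bigO F (\<lambda>x. (lam x - l0) \<bullet> (s x + g zs + transpose A *v y x)) (\<lambda>x. 1 * \<omega> x)"
    by (intro bigO_inner lam_l0 slack)
  have 2: "bigO F (\<lambda>x. y x \<bullet> (lagr_z \<phi> g zs (lam x) + H x *v y x)) (\<lambda>x. 1 * \<omega> x)"
    by (intro bigO_inner y_1 stationarity)
  have 3: "bigO F (\<lambda>x. y x \<bullet> (H x *v y x)) (\<lambda>x. norm (y x) * (1 * norm (y x)))"
    by (intro bigO_inner bigO_matvec H_1 bigO_self_norm)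
  \<comment> \<open>In the combination \<open>1 - 2 + 3\<close> the terms linear in \<open>y\<close>
    cancel: the gradient at \<open>zs\<close> is \<open>A *v (lam x - l0)\<close>, and its pairing
    with \<open>y x\<close> is that of \<open>lam x - l0\<close> with
    \<open>transpose A *v y x\<close>.\<close>
  have 4: "bigO F (\<lambda>x. (lam x - l0) \<bullet> (s x + g zs)) \<omega>"
    by (rule bigO_eq[OF bigO_add[OF bigO_diff[OF 1[simplified] 2[simplified]] y2_omega[OF 3[simplified, folded power2_eq_square]]]])
      (simp add: lagr_z_zs[OF l0(1)] inner_add_right inner_grad_cols inner_commute)
  obtain c where c: "c > 0" "\<forall>\<^sub>F x in F. norm ((lam x - l0) \<bullet> (s x + g zs)) \<le> c * \<bar>\<omega> x\<bar>"
    using bigOE[OF 4] by auto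
  have "\<forall>\<^sub>F x in F. \<forall>i. 0 < lam x $ i \<and> 0 < s x $ i"
    using central by eventually_elim (simp add: centrality_def)
  with c(2) mu_pos have ev: "\<forall>\<^sub>F x in F. l0 $ i * s x $ i \<le> (CARD('m) + c) * \<omega> x"
  proof eventually_elim
    case (elim x)
    have "l0 $ i * s x $ i \<le> (\<Sum>i\<in>UNIV. l0 $ i * s x $ i)"
      using elim S_nonneg[OF l0(1)] by (intro member_le_sum) (auto simp: less_imp_le)
    then have "l0 $ i * s x $ i \<le> l0 \<bullet> s x" by (simp add: inner_vec_def)
    \<comment> \<open>Uses \<open>l0 \<bullet> g zs = 0\<close>.\<close>
    also have "l0 \<bullet> s x = lam x \<bullet> s x + lam x \<bullet> g zs - (lam x - l0) \<bullet> (s x + g zs)"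
      using l0(1) by (simp add: mem_S_iff inner_add_right inner_diff_left)
    also have "lam x \<bullet> g zs \<le> 0"
      unfolding inner_vec_def using elim g_zs_nonpos by (intro sum_nonpos) (auto simp: mult_nonneg_nonpos less_imp_le)
    also have "lam x \<bullet> s x = CARD('m) * \<mu> x" by (simp add: mu_def)
    finally have "l0 $ i * s x $ i \<le> CARD('m) * \<mu> x + c * \<bar>\<omega> x\<bar>" using elim by auto
    also have "\<dots> \<le> CARD('m) * \<omega> x + c * \<omega> x" using elim by (simp add: mult_left_mono)
    finally show ?case by (simp add: algebra_simps)
  qed
  show ?thesis
    by (rule bigO_mono[where c = "(CARD('m) + c) / l0 $ i"], use ev positive[of i] in eventually_elim)
       (use l0(2)[OF i] mu_pos in \<open>auto simp: field_simps elim: eventually_mono\<close>)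
qed

text \<open>On the active set \<open>g zs\<close> vanishes, so the linearized slack equation
  expresses \<open>T (y x)\<close> through the active slacks.\<close>

lemma T_y_omega: "bigO F (\<lambda>x. T (y x)) \<omega>"
proof -
  have "bigO F (\<lambda>x. mask B (s x + g zs + transpose A *v y x) - mask B (s x)) \<omega>"
    by (intro bigO_diff bigO_mask'[OF slack] bigO_mask s_active_omega)
  then show ?thesis
    by (rule bigO_eq) (auto simp: T_def vec_eq_iff mask_nth active_def)
qed

text \<open>The matrix \<open>M x\<close> differs by o(1) from the Hessian at the exact multiplier
  \<open>ls x\<close>, so on the kernel of \<open>T\<close> at least half of \<xi> survives. It is
  applied to \<open>y\<close> with \<open>M = H\<close> and to the step with the small part of the
  system matrix.\<close>

lemma curvature_family:
  assumes p: "\<forall>\<^sub>F x in F. T (p x) = 0" and M: "((\<lambda>x. M x - H x) \<longlongrightarrow> 0) F"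
    and O: "bigO F (\<lambda>x. p x \<bullet> (M x *v p x)) (\<lambda>x. norm (p x) * w x)"
  shows "bigO F p w"
proof -
  obtain \<xi> where xi: "\<xi> > 0"
    "\<And>lam w. lam \<in> S \<Longrightarrow> T w = 0 \<Longrightarrow> \<xi> * (norm w)\<^sup>2 \<le> w \<bullet> (lagr_zz \<phi> g zs lam *v w)"
    using curvature by blast
  have "((\<lambda>x. H x - lagr_zz \<phi> g zs (ls x)) \<longlongrightarrow> (\<Sum>i\<in>UNIV. 0 $ i *\<^sub>R hess (\<lambda>z. g z $ i) zs)) F"
    unfolding lagr_zz_diff_mult
    by (intro tendsto_sum tendsto_scaleR tendsto_const tendsto_vec_nth lam_ls_tendsto)
  with M have "((\<lambda>x. (M x - H x) + (H x - lagr_zz \<phi> g zs (ls x))) \<longlongrightarrow> 0 + 0) F"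
    by (intro tendsto_add) auto
  then have D: "((\<lambda>x. M x - lagr_zz \<phi> g zs (ls x)) \<longlongrightarrow> 0) F" by simp
  define k where "k = real CARD('n)"
  have k: "k > 0" by (simp add: k_def)
  have small: "\<forall>\<^sub>F x in F. norm (M x - lagr_zz \<phi> g zs (ls x)) \<le> \<xi> / (2 * k)"
    using D by (rule tendsto_0_bound) (use xi k in simp)
  have "bigO F (\<lambda>x. (norm (p x))\<^sup>2) (\<lambda>x. p x \<bullet> (M x *v p x))"
  proof (rule bigOI[where c="2 / \<xi>"], use small ls_mem p in eventually_elim)
    case (elim x)
    have "\<bar>p x \<bullet> ((M x - lagr_zz \<phi> g zs (ls x)) *v p x)\<bar> \<le> norm (p x) * norm ((M x - lagr_zz \<phi> g zs (ls x)) *v p x)"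
      by (rule Cauchy_Schwarz_ineq2)
    also have "\<dots> \<le> norm (p x) * (k * (\<xi> / (2 * k)) * norm (p x))"
      using elim k unfolding k_def
      by (intro mult_left_mono order.trans[OF norm_matrix_vector_le] mult_right_mono) auto
    also have "\<dots> = \<xi> / 2 * (norm (p x))\<^sup>2" using k by (simp add: power2_eq_square)
    finally have "\<bar>p x \<bullet> (M x *v p x) - p x \<bullet> (lagr_zz \<phi> g zs (ls x) *v p x)\<bar> \<le> \<xi> / 2 * (norm (p x))\<^sup>2"
      by (simp only: matrix_vector_mult_diff_rdistrib inner_diff_right)
    with xi(2)[OF elim(2,3)] have "\<xi> / 2 * (norm (p x))\<^sup>2 \<le> p x \<bullet> (M x *v p x)"
      unfolding abs_le_iff by linarith
    then have "\<xi> / 2 * (norm (p x))\<^sup>2 \<le> \<bar>p x \<bullet> (M x *v p x)\<bar>" by linarith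
    with xi(1) show ?case by (simp add: field_simps)
  qed
  from bigO_absorb[OF bigO_trans[OF this O]] show ?thesis .
qed

text \<open>Up to \<open>q = O(\<omega>)\<close>, \<open>y\<close> is a kernel vector
  \<open>p\<close>. Tested with \<open>p\<close>, stationarity retains only the inactive
  multipliers, which are \<open>O(\<mu>)\<close>, and curvature bounds \<open>p\<close>. The square
  hidden in \<omega> is absorbed because \<open>y\<close> tends to 0.\<close>

lemma y_mu: "bigO F y \<mu>"
proof (rule bigO_absorb_square[OF _ y_tendsto])
  define q where "q x = R (T (y x))" for x
  define p where "p x = y x - q x" for x
  have q: "bigO F q \<omega>" unfolding q_def by (rule bigO_linear[OF R(1) T_y_omega])
  have Tp: "T (p x) = 0" for x unfolding p_def q_def by (rule R(2))
  have 1: "bigO F (\<lambda>x. p x \<bullet> (lagr_z \<phi> g zs (lam x) + H x *v y x)) (\<lambda>x. norm (p x) * \<omega> x)"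
    by (intro bigO_inner bigO_self_norm stationarity)
  have "bigO F (\<lambda>x. (transpose A *v p x) \<bullet> mask (- B) (lam x)) (\<lambda>x. (1 * norm (p x)) * \<omega> x)"
    by (intro bigO_inner bigO_matvec bigO_const bigO_self_norm mu_omega mask_lam_inactive)
  moreover have "\<forall>\<^sub>F x in F. p x \<bullet> lagr_z \<phi> g zs (lam x) = (transpose A *v p x) \<bullet> mask (- B) (lam x)"
    using ls_mem
  proof eventually_elim
    case (elim x)
    then have "mask (- B) (lam x - ls x) = mask (- B) (lam x)"
      using S_inactive by (auto simp: vec_eq_iff mask_nth)
    then show ?case by (simp add: lagr_z_zs[OF elim] kernel_T_inner[OF Tp])
  qed
  ultimately have 2: "bigO F (\<lambda>x. p x \<bullet> lagr_z \<phi> g zs (lam x)) (\<lambda>x. norm (p x) * \<omega> x)"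
    using bigO_cong by fastforce
  have 3: "bigO F (\<lambda>x. p x \<bullet> (H x *v q x)) (\<lambda>x. norm (p x) * (1 * \<omega> x))"
    by (intro bigO_inner bigO_matvec H_1 q bigO_self_norm)
  have "bigO F (\<lambda>x. p x \<bullet> (H x *v p x)) (\<lambda>x. norm (p x) * \<omega> x)"
    by (rule bigO_eq[OF bigO_diff[OF bigO_diff[OF 1 2] 3[simplified]]])
      (simp add: p_def matrix_vector_mult_diff_distrib inner_add_right inner_diff_right)
  then have "bigO F p \<omega>"
    by (intro curvature_family[of p H]) (auto simp: Tp)
  from bigO_add[OF this q] show "bigO F y \<omega>" by (simp add: p_def)
qed (use mu_pos in eventually_elim, simp)

lemma omega_mu: "bigO F v \<omega> \<Longrightarrow> bigO F v \<mu>"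
proof (erule bigO_trans)
  have "bigO F (\<lambda>x. norm (y x) * norm (y x)) (\<lambda>x. \<mu> x * 1)"
    by (intro bigO_mult) (simp_all add: y_mu y_1)
  then show "bigO F \<omega> \<mu>" by (intro bigO_add) (simp_all add: power2_eq_square)
qed

lemma s_active: "i \<in> B \<Longrightarrow> bigO F (\<lambda>x. s x $ i) \<mu>"
  by (rule omega_mu[OF s_active_omega])

lemma lam_active:
  assumes "i \<in> B" obtains c where "c > 0" "\<forall>\<^sub>F x in F. c \<le> lam x $ i"
proof -
  obtain c where c: "c > 0" "\<forall>\<^sub>F x in F. c * \<mu> x \<le> \<bar>\<mu> x\<bar> * lam x $ i"
    by (rule lower_bound_from_product[of "\<lambda>x. s x $ i" "\<lambda>x. lam x $ i" \<mu>])
      (use product_ge[of i] positive[of i] s_active[OF assms] in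
        \<open>auto simp: mult.commute elim: eventually_mono\<close>)
  have "\<forall>\<^sub>F x in F. c \<le> lam x $ i"
    using c(2) mu_pos by eventually_elim (simp add: mult.commute)
  with that c(1) show ?thesis by blast
qed

text \<open>As \<open>\<lambda>\<^sub>B\<close> is bounded below, a correction of \<open>\<lambda>\<^sub>B\<close> of size \<open>O(\<mu>)\<close> that restores
  \<open>\<nabla>\<phi>(z\<^sup>*) + A\<^sub>B \<lambda>\<^sub>B = 0\<close> keeps it positive; no error bound of Hoffman type is needed.\<close>

lemma dist_sol_mu: "bigO F (\<lambda>x. dist_sol \<phi> g zs (z x) (lam x)) \<mu>"
proof -
  obtain l0 where l0: "l0 \<in> S" using multipliers_nonempty by auto
  define d where "d x = mask B (lam x) - l0" for x
  define e where "e x = R' (T' (d x))" for x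
  \<comment> \<open>As \<open>mask B (lam x)\<close> minus a small vector, \<open>l' x\<close> is
    close to \<open>lam x\<close> and positive on the active set; as \<open>l0\<close> plus the mask
    of the kernel vector \<open>d x - e x\<close>, it satisfies stationarity exactly.\<close>
  define l' where "l' x = mask B (lam x) - mask B (e x)" for x
  have l'_eq: "l' x = l0 + mask B (d x - e x)" for x
    by (auto simp: l'_def d_def vec_eq_iff mask_nth S_inactive[OF l0])
  have "bigO F (\<lambda>x. H x *v y x) (\<lambda>x. 1 * \<mu> x)" by (intro bigO_matvec H_1 y_mu)
  from bigO_diff[OF omega_mu[OF stationarity] this[simplified]]
  have 1: "bigO F (\<lambda>x. lagr_z \<phi> g zs (lam x)) \<mu>" by simp
  have "bigO F (\<lambda>x. A *v mask (- B) (lam x)) (\<lambda>x. 1 * \<mu> x)"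
    by (intro bigO_matvec bigO_const mask_lam_inactive)
  then have "bigO F (\<lambda>x. lagr_z \<phi> g zs (lam x) - A *v mask (- B) (lam x)) \<mu>"
    using 1 by (intro bigO_diff) auto
  moreover have "T' (d x) = lagr_z \<phi> g zs (lam x) - A *v mask (- B) (lam x)" for x
  proof -
    have "mask B (d x) = lam x - l0 - mask (- B) (lam x)"
      by (auto simp: d_def vec_eq_iff mask_nth S_inactive[OF l0])
    then show ?thesis by (simp add: T'_def lagr_z_zs[OF l0] matrix_vector_mult_diff_distrib)
  qed
  ultimately have T'd: "bigO F (\<lambda>x. T' (d x)) \<mu>" by simp
  have e: "bigO F e \<mu>" unfolding e_def by (rule bigO_linear[OF R'(1) T'd])
  have "\<forall>\<^sub>F x in F. 0 \<le> l' x $ i" for i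
  proof (cases "i \<in> B")
    case True
    obtain c where c: "c > 0" "\<forall>\<^sub>F x in F. c \<le> lam x $ i" using lam_active[OF True] .
    have "(e \<longlongrightarrow> 0) F" by (rule bigO_tendsto_0[OF e mu_tendsto])
    then have "\<forall>\<^sub>F x in F. norm (e x) \<le> c" by (rule tendsto_0_bound) (rule c)
    with c(2) show ?thesis
    proof eventually_elim
      case (elim x)
      then show ?case using component_le_norm_cart[of "e x" i] True by (simp add: l'_def mask_nth)
    qed
  qed (simp add: l'_def mask_nth)
  then have "\<forall>\<^sub>F x in F. \<forall>i. 0 \<le> l' x $ i" by (simp add: eventually_all_finite)
  then have l'S: "\<forall>\<^sub>F x in F. l' x \<in> S"
  proof eventually_elim
    case (elim x)
    have "lagr_z \<phi> g zs (l' x) = T' (d x - e x)"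
      by (simp add: lagr_z_zs[OF l0] l'_eq T'_def)
    also have "\<dots> = 0" unfolding e_def by (rule R')
    finally have "lagr_z \<phi> g zs (l' x) = 0" .
    moreover have "mask B (l' x) = l' x" by (auto simp: l'_def vec_eq_iff mask_nth)
    then have "l' x \<bullet> g zs = mask B (l' x) \<bullet> g zs" by simp
    moreover have "\<dots> = l' x \<bullet> mask B (g zs)" by (rule inner_mask)
    moreover have "mask B (g zs) = 0" by (simp add: vec_eq_iff mask_nth active_def)
    ultimately show ?case
      using elim l0 by (auto simp: mem_S_iff less_eq_vec_def)
  qed
  have "bigO F (\<lambda>x. norm (y x) + norm (mask (- B) (lam x) + mask B (e x))) \<mu>"
    using y_mu bigO_add[OF mask_lam_inactive bigO_mask'[OF e]] by (intro bigO_add) auto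
  moreover have "bigO F (\<lambda>x. dist_sol \<phi> g zs (z x) (lam x)) (\<lambda>x. norm (y x) + norm (mask (- B) (lam x) + mask B (e x)))"
  proof (rule bigO_mono[where c=1], use l'S in eventually_elim)
    case (elim x)
    have "dist_sol \<phi> g zs (z x) (lam x) \<le> dist (z x, lam x) (zs, l' x)"
      unfolding dist_sol_def by (rule infdist_le) (use elim in simp)
    also have "\<dots> \<le> dist (z x) zs + dist (lam x) (l' x)"
      unfolding dist_prod_def by (simp add: sqrt_sum_squares_le_sum)
    also have "dist (lam x) (l' x) = norm (mask (- B) (lam x) + mask B (e x))"
    proof -
      have "lam x - l' x = mask (- B) (lam x) + mask B (e x)"
        by (auto simp: l'_def vec_eq_iff mask_nth)
      then show ?thesis by (simp add: dist_norm)
    qed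
    finally show ?case by (simp add: dist_norm dist_sol_def infdist_nonneg)
  qed simp
  ultimately show ?thesis using bigO_trans by blast
qed

end

section \<open>Rounding errors\<close>

lemma float_model_ops:
  assumes "float_model \<FF> fl u" "x \<in> \<FF>" "y \<in> \<FF>"
  shows "fl (+) x y \<in> \<FF>" "\<bar>fl (+) x y - (x + y)\<bar> \<le> u * \<bar>x + y\<bar>"
    and "fl (-) x y \<in> \<FF>" "\<bar>fl (-) x y - (x - y)\<bar> \<le> u * \<bar>x - y\<bar>"
    and "fl (*) x y \<in> \<FF>" "\<bar>fl (*) x y - x * y\<bar> \<le> u * \<bar>x * y\<bar>"
    and "y \<noteq> 0 \<Longrightarrow> fl (/) x y \<in> \<FF>" "y \<noteq> 0 \<Longrightarrow> \<bar>fl (/) x y - x / y\<bar> \<le> u * \<bar>x / y\<bar>"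
proof -
  have *: "fl op x y \<in> \<FF> \<and> \<bar>fl op x y - op x y\<bar> \<le> u * \<bar>op x y\<bar>"
    if op: "op \<in> {(+), (-), (*), (/)}" "op = (/) \<longrightarrow> y \<noteq> 0" for op
  proof -
    have "fl op x y \<in> \<FF> \<and> (\<exists>e. \<bar>e\<bar> \<le> u \<and> fl op x y = op x y * (1 + e))"
      using assms op unfolding float_model_def by blast
    then obtain e where e: "\<bar>e\<bar> \<le> u" "fl op x y = op x y * (1 + e)" "fl op x y \<in> \<FF>"
      by blast
    have "fl op x y - op x y = e * op x y" using e by (simp add: algebra_simps)
    then have "\<bar>fl op x y - op x y\<bar> = \<bar>e\<bar> * \<bar>op x y\<bar>" by (simp add: abs_mult)
    with e show ?thesis by (simp add: mult_right_mono)
  qed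
  \<comment> \<open>In the model the condition on the second operand is guarded by
    \<open>op = (/)\<close>. The other three operations are free of it only because they differ from
    division as functions.\<close>
  have ne: "(+) \<noteq> ((/) :: real \<Rightarrow> real \<Rightarrow> real)" "(-) \<noteq> ((/) :: real \<Rightarrow> real \<Rightarrow> real)"
    "(*) \<noteq> ((/) :: real \<Rightarrow> real \<Rightarrow> real)"
  proof -
    show "(+) \<noteq> ((/) :: real \<Rightarrow> real \<Rightarrow> real)"
    proof
      assume "(+) = ((/) :: real \<Rightarrow> real \<Rightarrow> real)"
      from fun_cong[OF fun_cong[OF this], of 1 1] show False by simp
    qed
    show "(-) \<noteq> ((/) :: real \<Rightarrow> real \<Rightarrow> real)"
    proof
      assume "(-) = ((/) :: real \<Rightarrow> real \<Rightarrow> real)"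
      from fun_cong[OF fun_cong[OF this], of 1 1] show False by simp
    qed
    show "(*) \<noteq> ((/) :: real \<Rightarrow> real \<Rightarrow> real)"
    proof
      assume "(*) = ((/) :: real \<Rightarrow> real \<Rightarrow> real)"
      from fun_cong[OF fun_cong[OF this], of 2 2] show False by simp
    qed
  qed
  show "fl (+) x y \<in> \<FF>" "\<bar>fl (+) x y - (x + y)\<bar> \<le> u * \<bar>x + y\<bar>"
    using *[of "(+)"] ne by auto
  show "fl (-) x y \<in> \<FF>" "\<bar>fl (-) x y - (x - y)\<bar> \<le> u * \<bar>x - y\<bar>"
    using *[of "(-)"] ne by auto
  show "fl (*) x y \<in> \<FF>" "\<bar>fl (*) x y - x * y\<bar> \<le> u * \<bar>x * y\<bar>"
    using *[of "(*)"] ne by auto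
  show "y \<noteq> 0 \<Longrightarrow> fl (/) x y \<in> \<FF>" "y \<noteq> 0 \<Longrightarrow> \<bar>fl (/) x y - x / y\<bar> \<le> u * \<bar>x / y\<bar>"
    using *[of "(/)"] by auto
qed

text \<open>The induction step for summation in any order. One more rounding at most doubles the
  accumulated errors, as \<open>u \<le> 1\<close>, and adds u times the sum of moduli, so the factor
  \<open>P - 1\<close> becomes \<open>2 * P - 1\<close>. This is at most \<open>P * Q - 1\<close>
  because the other operand has at least one term, that is \<open>Q \<ge> 2\<close>.\<close>

lemma rounded_sum_error:
  fixes x y a b Sa Sb u :: real and p q :: nat
  assumes "\<bar>x - a\<bar> \<le> (2 ^ p - 1) * (u * Sa)" "\<bar>y - b\<bar> \<le> (2 ^ q - 1) * (u * Sb)"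
    and "\<bar>a\<bar> \<le> Sa" "\<bar>b\<bar> \<le> Sb" "0 < p" "0 < q" "0 \<le> u" "u \<le> 1"
    and r: "\<bar>w - (x + y)\<bar> \<le> u * \<bar>x + y\<bar>"
  shows "\<bar>w - (a + b)\<bar> \<le> (2 ^ (p + q) - 1) * (u * (Sa + Sb))"
proof -
  define P :: real where "P = 2 ^ p"
  define Q :: real where "Q = 2 ^ q"
  have "2 ^ 1 \<le> P" "2 ^ 1 \<le> Q" unfolding P_def Q_def by (intro power_increasing; use assms in simp)+
  then have PQ: "P \<ge> 2" "Q \<ge> 2" by auto
  have prod: "2 ^ (p + q) = P * Q" by (simp add: P_def Q_def power_add)
  have S0: "0 \<le> u * Sa" "0 \<le> u * Sb" using assms by auto
  have PQ2: "2 * P \<le> P * Q" "2 * Q \<le> P * Q" using PQ mult_mono[of 2 Q P P] mult_mono[of 2 P Q Q] by (auto simp: mult.commute)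
  define ex where "ex = \<bar>x - a\<bar>"
  define ey where "ey = \<bar>y - b\<bar>"
  define m where "m = \<bar>x + y\<bar>"
  have "m \<le> Sa + Sb + (ex + ey)" using assms(3,4) unfolding ex_def ey_def m_def by linarith
  then have "u * m \<le> u * (Sa + Sb + (ex + ey))" using assms by (intro mult_left_mono) auto
  also have "\<dots> = u * Sa + u * Sb + u * (ex + ey)" by (simp add: algebra_simps)
  finally have "u * m \<le> u * Sa + u * Sb + u * (ex + ey)" .
  moreover have "u * (ex + ey) \<le> 1 * (ex + ey)" using assms by (intro mult_right_mono) (auto simp: ex_def ey_def)
  moreover have "\<bar>w - (a + b)\<bar> \<le> \<bar>w - (x + y)\<bar> + ex + ey" unfolding ex_def ey_def by linarith
  ultimately have "\<bar>w - (a + b)\<bar> \<le> u * Sa + u * Sb + 2 * (ex + ey)"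
    using r[folded m_def] by argo
  also have "\<dots> \<le> u * Sa + u * Sb + 2 * ((P - 1) * (u * Sa) + (Q - 1) * (u * Sb))"
    using assms(1,2) by (simp add: ex_def ey_def P_def Q_def)
  also have "\<dots> = (2 * P - 1) * (u * Sa) + (2 * Q - 1) * (u * Sb)" by (simp add: algebra_simps)
  also have "\<dots> \<le> (P * Q - 1) * (u * Sa) + (P * Q - 1) * (u * Sb)"
    using PQ2 S0 by (intro add_mono mult_right_mono) auto
  finally show ?thesis unfolding prod by (simp add: algebra_simps)
qed

lemma sum_mset_abs_ge: "\<bar>sum_mset X\<bar> \<le> sum_mset (image_mset abs X)" for X :: "real multiset"
  by (induction X) auto

text \<open>The claim that the multiset is nonempty is carried through the induction since each
  rounded addition needs two nonempty operands.\<close>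

lemma fl_sum_error:
  assumes fm: "float_model \<FF> fl u" and u: "u \<le> 1" and "fl_sum fl X y" "\<forall>x\<in>#X. x \<in> \<FF>"
  shows "y \<in> \<FF> \<and> 0 < size X \<and> \<bar>y - sum_mset X\<bar> \<le> (2 ^ size X - 1) * (u * sum_mset (image_mset abs X))"
  using assms(3,4)
proof (induction rule: fl_sum.induct)
  case (single x)
  then show ?case using fm by (auto simp: float_model_def)
next
  case (add A x B y)
  then show ?case
    using rounded_sum_error[of x "sum_mset A" "size A" u _ y "sum_mset B" "size B", OF _ _ sum_mset_abs_ge sum_mset_abs_ge]
      float_model_ops(1,2)[OF fm, of x y] fm u
    by (auto simp: float_model_def)
next
  case (sub A x B y)
  \<comment> \<open>The summands are the negatives of the elements of \<open>B\<close>; closure of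
    \<open>\<FF>\<close> under negation recovers the elements.\<close>
  have "x \<in> \<FF>" if "x \<in># B" for x
    using sub.prems fm that unfolding float_model_def by (metis UnCI add.inverse_inverse image_eqI set_image_mset set_mset_union)
  with sub have IH: "x \<in> \<FF>" "0 < size A" "\<bar>x - sum_mset A\<bar> \<le> (2 ^ size A - 1) * (u * sum_mset (image_mset abs A))"
    "y \<in> \<FF>" "0 < size B" "\<bar>y - sum_mset B\<bar> \<le> (2 ^ size B - 1) * (u * sum_mset (image_mset abs B))"
    by auto
  have *: "sum_mset (image_mset uminus B) = - sum_mset B" for B :: "real multiset"
    by (induction B) auto
  have "\<bar>fl (-) x y - (sum_mset A + - sum_mset B)\<bar> \<le> (2 ^ (size A + size B) - 1) *
      (u * (sum_mset (image_mset abs A) + sum_mset (image_mset abs B)))"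
    using IH float_model_ops(4)[OF fm IH(1,4)] fm u sum_mset_abs_ge[of A] sum_mset_abs_ge[of B]
    by (intro rounded_sum_error[of x _ _ _ _ "- y"]) (auto simp: float_model_def abs_minus_commute)
  then show ?case
    using IH float_model_ops(3)[OF fm IH(1,4)]
    by (simp add: * image_mset.compositionality o_def)
qed

lemma fl_products_error:
  fixes A :: "real^'m^'n" and v :: "real^'n"
  assumes fm: "float_model \<FF> fl u" and u: "u \<le> 1" and A: "float_mat \<FF> A" and v: "float_vec \<FF> v"
  defines "P \<equiv> real CARD('n) * (norm A * norm v)"
  shows "\<forall>x\<in>#fl_products fl A v i. x \<in> \<FF>"
    and "\<bar>sum_mset (fl_products fl A v i) - (transpose A *v v) $ i\<bar> \<le> u * P"
    and "sum_mset (image_mset abs (fl_products fl A v i)) \<le> 2 * P"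
    and "size (fl_products fl A v i) = CARD('n)"
proof -
  have F: "A $ j $ i \<in> \<FF>" "v $ j \<in> \<FF>" for j using A v by (auto simp: float_mat_def float_vec_def)
  define a where "a j = A $ j $ i * v $ j" for j
  define b where "b j = fl (*) (A $ j $ i) (v $ j)" for j
  have ab: "\<bar>b j - a j\<bar> \<le> u * \<bar>a j\<bar>" for j
    unfolding a_def b_def by (rule float_model_ops[OF fm F])
  have a: "\<bar>a j\<bar> \<le> norm A * norm v" for j
    unfolding a_def abs_mult using Finite_Cartesian_Product.norm_nth_le[of A j] component_le_norm_cart[of "A $ j" i]
    by (intro mult_mono component_le_norm_cart) auto
  have aP: "(\<Sum>j\<in>UNIV. \<bar>a j\<bar>) \<le> P"
    using sum_mono[of UNIV "\<lambda>j. \<bar>a j\<bar>" "\<lambda>_. norm A * norm v"] a by (simp add: P_def)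
  have u0: "u \<ge> 0" using fm by (simp add: float_model_def)
  have Ts: "(transpose A *v v) $ i = (\<Sum>j\<in>UNIV. a j)"
    by (simp add: matrix_vector_mult_def transpose_def a_def)
  show "\<forall>x\<in>#fl_products fl A v i. x \<in> \<FF>"
    using float_model_ops(5)[OF fm F] by (auto simp: fl_products_def)
  have "\<bar>(\<Sum>j\<in>UNIV. b j) - (\<Sum>j\<in>UNIV. a j)\<bar> \<le> (\<Sum>j\<in>UNIV. \<bar>b j - a j\<bar>)"
    by (simp flip: sum_subtractf)
  also have "\<dots> \<le> u * (\<Sum>j\<in>UNIV. \<bar>a j\<bar>)" unfolding sum_distrib_left using ab by (intro sum_mono)
  also have "\<dots> \<le> u * P" using aP u0 by (rule mult_left_mono)
  finally show "\<bar>sum_mset (fl_products fl A v i) - (transpose A *v v) $ i\<bar> \<le> u * P"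
    by (simp add: fl_products_def Ts b_def sum_unfold_sum_mset)
  have "\<bar>b j\<bar> \<le> 2 * \<bar>a j\<bar>" for j
    using ab[of j] mult_right_mono[OF u, of "\<bar>a j\<bar>"] by linarith
  then have "(\<Sum>j\<in>UNIV. \<bar>b j\<bar>) \<le> (\<Sum>j\<in>UNIV. 2 * \<bar>a j\<bar>)" by (intro sum_mono)
  also have "\<dots> \<le> 2 * P" using aP by (simp flip: sum_distrib_left)
  finally show "sum_mset (image_mset abs (fl_products fl A v i)) \<le> 2 * P"
    by (simp add: fl_products_def b_def sum_unfold_sum_mset image_mset.compositionality o_def)
  show "size (fl_products fl A v i) = CARD('n)" by (simp add: fl_products_def)
qed

text \<open>A sum of \<open>k\<close> terms has relative error at most \<open>(2 ^ k - 1) u\<close>; here \<open>k \<le> CARD('n) + 2\<close>, and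
  the remaining factors absorb the rounding of the products and of the quotient.\<close>

definition round_const :: "'n itself \<Rightarrow> real" where
  "round_const _ = 2 ^ (CARD('n) + 6) * real CARD('n)"

lemma abs_diff_add3_le:
  fixes y a b c a' b' e1 e2 e3 :: real
  assumes "\<bar>y - (c + a + b)\<bar> \<le> e1" "\<bar>a - a'\<bar> \<le> e2" "\<bar>b - b'\<bar> \<le> e3"
  shows "\<bar>y - (c + a' + b')\<bar> \<le> e1 + e2 + e3"
  using assms by linarith

lemma abs_diff_add_le:
  fixes a q b b' S p :: real
  assumes "\<bar>b - b'\<bar> \<le> p'" "\<bar>b\<bar> \<le> S" "p' \<le> p"
  shows "\<bar>a - q + b'\<bar> \<le> S + \<bar>a\<bar> + \<bar>q\<bar> + p"
proof -
  have "\<bar>b'\<bar> \<le> S + p" using assms by linarith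
  then show ?thesis by linarith
qed

lemma fl_multiplier_step:
  fixes A :: "real^'m^'n" and v :: "real^'n"
  assumes fm: "float_model \<FF> fl u" and u: "u \<le> 1" and A: "float_mat \<FF> A" and v: "float_vec \<FF> v"
    and a: "a \<in> \<FF>" and t: "t \<in> \<FF>" and l: "l \<in> \<FF>" "l \<noteq> 0" and d: "d \<in> \<FF>"
    and y: "fl_sum fl ({#a, - fl (/) t l#} + fl_products fl A v i) y"
  shows "\<bar>fl (*) d y - d * (a - t / l + (transpose A *v v) $ i)\<bar>
    \<le> round_const TYPE('n) * (u * (\<bar>d\<bar> * (\<bar>a\<bar> + \<bar>t / l\<bar> + norm A * norm v)))"
proof -
  let ?X = "fl_products fl A v i"
  define n where "n = real CARD('n)"
  define P where "P = n * (norm A * norm v)"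
  define N :: real where "N = 2 ^ (CARD('n) + 2)"
  note prod = fl_products_error[OF fm u A v, of i, folded n_def, folded P_def]
  have n1: "n \<ge> 1" unfolding n_def by (simp add: Suc_leI)
  have P0: "P \<ge> 0" by (simp add: P_def n_def)
  have u0: "u \<ge> 0" using fm by (simp add: float_model_def)
  have q: "fl (/) t l \<in> \<FF>" "\<bar>fl (/) t l - t / l\<bar> \<le> u * \<bar>t / l\<bar>"
    using float_model_ops(7,8)[OF fm t l(1)] l(2) by auto
  have mq: "- fl (/) t l \<in> \<FF>" using q(1) fm by (simp add: float_model_def)
  define E where "E = a - t / l + (transpose A *v v) $ i"
  \<comment> \<open>Bounds the sum of the moduli of the exact terms. Rounding the quotient and the
    products at most doubles it, hence the \<open>2 * W\<close> below.\<close>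
  define W where "W = \<bar>a\<bar> + \<bar>t / l\<bar> + P"
  have W0: "W \<ge> 0" using P0 by (simp add: W_def)
  have q2: "\<bar>fl (/) t l\<bar> \<le> 2 * \<bar>t / l\<bar>"
    using q(2) mult_right_mono[OF u, of "\<bar>t / l\<bar>"] by linarith
  have y1: "y \<in> \<FF>" "\<bar>y - (a - fl (/) t l + sum_mset ?X)\<bar> \<le>
     (N - 1) * (u * (\<bar>a\<bar> + \<bar>fl (/) t l\<bar> + sum_mset (image_mset abs ?X)))"
    using fl_sum_error[OF fm u y] a mq prod(1,4) by (auto simp: N_def algebra_simps)
  have N1: "N \<ge> 1" unfolding N_def by (rule one_le_power) simp
  have "(N - 1) * (u * (\<bar>a\<bar> + \<bar>fl (/) t l\<bar> + sum_mset (image_mset abs ?X))) \<le> (N - 1) * (u * (2 * W))"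
  proof (intro mult_left_mono)
    show "\<bar>a\<bar> + \<bar>fl (/) t l\<bar> + sum_mset (image_mset abs ?X) \<le> 2 * W"
      unfolding W_def distrib_left using prod(3) q2 by (intro add_mono) (auto simp: P_def)
  qed (use N1 u0 in auto)
  with y1(2) have "\<bar>y - (a - fl (/) t l + sum_mset ?X)\<bar> \<le> (N - 1) * (u * (2 * W))" by linarith
  moreover have "u * W = u * \<bar>a\<bar> + u * \<bar>t / l\<bar> + u * P" by (simp add: W_def algebra_simps)
  moreover have "0 \<le> u * \<bar>a\<bar>" using u0 by simp
  moreover have "\<bar>y - (a + - (t / l) + (transpose A *v v) $ i)\<bar> \<le> (N - 1) * (u * (2 * W)) + u * \<bar>t / l\<bar> + u * P"
    by (rule abs_diff_add3_le[where a = "- fl (/) t l", OF _ _ prod(2)])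
      (use calculation(1) q(2) in \<open>simp_all add: abs_minus_commute\<close>)
  ultimately have "\<bar>y - E\<bar> \<le> (N - 1) * (u * (2 * W)) + u * W"
    unfolding E_def by simp
  then have yE: "\<bar>y - E\<bar> \<le> (2 * N - 1) * (u * W)" by (simp add: algebra_simps)
  have "P * u \<le> P * 1" using P0 u by (intro mult_left_mono) auto
  then have "\<bar>E\<bar> \<le> sum_mset (image_mset abs ?X) + \<bar>a\<bar> + \<bar>t / l\<bar> + P"
    using prod(2) sum_mset_abs_ge[of ?X] unfolding E_def mult.commute[of P u]
    by (intro abs_diff_add_le) auto
  then have "\<bar>E\<bar> \<le> W + 2 * P" using prod(3) by (simp add: W_def)
  moreover have "2 * P \<le> 2 * W" by (simp add: W_def)
  ultimately have E3: "\<bar>E\<bar> \<le> 3 * W" by linarith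
  have "u * W \<le> 1 * W" using u W0 by (intro mult_right_mono) auto
  then have "(2 * N - 1) * (u * W) \<le> (2 * N - 1) * W" using N1 by (intro mult_left_mono) auto
  with yE E3 have y3: "\<bar>y\<bar> \<le> (2 * N + 2) * W" by (simp add: algebra_simps)
  have "\<bar>fl (*) d y - d * y\<bar> \<le> u * \<bar>d * y\<bar>" by (rule float_model_ops[OF fm d y1(1)])
  also have "\<dots> \<le> u * (\<bar>d\<bar> * ((2 * N + 2) * W))"
    unfolding abs_mult using y3 u0 by (intro mult_left_mono) auto
  finally have 1: "\<bar>fl (*) d y - d * y\<bar> \<le> u * (\<bar>d\<bar> * ((2 * N + 2) * W))" .
  have "\<bar>d * y - d * E\<bar> = \<bar>d\<bar> * \<bar>y - E\<bar>" by (simp add: abs_mult flip: right_diff_distrib)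
  also have "\<dots> \<le> \<bar>d\<bar> * ((2 * N - 1) * (u * W))" using yE by (intro mult_left_mono) auto
  finally have "\<bar>fl (*) d y - d * E\<bar> \<le> u * (\<bar>d\<bar> * ((2 * N + 2) * W)) + \<bar>d\<bar> * ((2 * N - 1) * (u * W))"
    using 1 by linarith
  also have "\<dots> = (4 * N + 1) * (u * (\<bar>d\<bar> * W))" by (simp add: algebra_simps)
  \<comment> \<open>\<open>16 * N\<close> is the power of 2 in \<open>round_const\<close>, and
    \<open>n\<close> is its other factor, which comes from \<open>P\<close>.\<close>
  also have "\<dots> \<le> (16 * N) * (u * (\<bar>d\<bar> * (n * (\<bar>a\<bar> + \<bar>t / l\<bar> + norm A * norm v))))"
  proof (intro mult_mono)
    have "1 * (\<bar>a\<bar> + \<bar>t / l\<bar>) \<le> n * (\<bar>a\<bar> + \<bar>t / l\<bar>)" using n1 by (intro mult_right_mono) auto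
    then show "W \<le> n * (\<bar>a\<bar> + \<bar>t / l\<bar> + norm A * norm v)" by (simp add: W_def P_def algebra_simps)
  qed (use N1 u0 W0 in auto)
  also have "\<dots> = round_const TYPE('n) * (u * (\<bar>d\<bar> * (\<bar>a\<bar> + \<bar>t / l\<bar> + norm A * norm v)))"
    by (simp add: round_const_def N_def n_def power_add)
  finally show ?thesis by (simp add: E_def)
qed

lemma fl_slack_step:
  fixes A :: "real^'m^'n" and v :: "real^'n"
  assumes fm: "float_model \<FF> fl u" and u: "u \<le> 1" and A: "float_mat \<FF> A" and v: "float_vec \<FF> v"
    and a: "a \<in> \<FF>" and s: "s \<in> \<FF>"
    and y: "fl_sum fl ({#- fl (+) a s#} + image_mset uminus (fl_products fl A v i)) y"
  shows "\<bar>y - (- (a + s) - (transpose A *v v) $ i)\<bar>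
    \<le> round_const TYPE('n) * (u * (\<bar>a + s\<bar> + norm A * norm v))"
proof -
  let ?X = "fl_products fl A v i"
  define n where "n = real CARD('n)"
  define P where "P = n * (norm A * norm v)"
  define N :: real where "N = 2 ^ (CARD('n) + 1)"
  note prod = fl_products_error[OF fm u A v, of i, folded n_def, folded P_def]
  have n1: "n \<ge> 1" unfolding n_def by (simp add: Suc_leI)
  have P0: "P \<ge> 0" by (simp add: P_def n_def)
  have u0: "u \<ge> 0" using fm by (simp add: float_model_def)
  have q: "fl (+) a s \<in> \<FF>" "\<bar>fl (+) a s - (a + s)\<bar> \<le> u * \<bar>a + s\<bar>"
    using float_model_ops(1,2)[OF fm a s] by auto
  have neg: "x \<in> \<FF> \<Longrightarrow> - x \<in> \<FF>" for x using fm by (simp add: float_model_def)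
  define W where "W = \<bar>a + s\<bar> + P"
  have W0: "W \<ge> 0" using P0 by (simp add: W_def)
  have q2: "\<bar>fl (+) a s\<bar> \<le> 2 * \<bar>a + s\<bar>"
  proof -
    have "u * \<bar>a + s\<bar> \<le> 1 * \<bar>a + s\<bar>" by (rule mult_right_mono[OF u]) simp
    then show ?thesis
      using q(2) abs_triangle_ineq[of "fl (+) a s - (a + s)" "a + s"] by simp
  qed
  have *: "sum_mset (image_mset uminus X) = - sum_mset X" for X :: "real multiset"
    by (induction X) auto
  have y1: "\<bar>y - (- fl (+) a s - sum_mset ?X)\<bar> \<le>
     (N - 1) * (u * (\<bar>fl (+) a s\<bar> + sum_mset (image_mset abs ?X)))"
    using fl_sum_error[OF fm u y] neg q(1) prod(1,4)
    by (auto simp: N_def * image_mset.compositionality o_def)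
  have N1: "N \<ge> 1" unfolding N_def by (rule one_le_power) simp
  have "(N - 1) * (u * (\<bar>fl (+) a s\<bar> + sum_mset (image_mset abs ?X))) \<le> (N - 1) * (u * (2 * W))"
  proof (intro mult_left_mono)
    show "\<bar>fl (+) a s\<bar> + sum_mset (image_mset abs ?X) \<le> 2 * W"
      unfolding W_def distrib_left using prod(3) q2 by (intro add_mono) (auto simp: P_def)
  qed (use N1 u0 in auto)
  moreover have "u * W = u * \<bar>a + s\<bar> + u * P" by (simp add: W_def algebra_simps)
  moreover have "\<bar>y - (0 + - (a + s) + - (transpose A *v v) $ i)\<bar> \<le>
      (N - 1) * (u * (\<bar>fl (+) a s\<bar> + sum_mset (image_mset abs ?X))) + u * \<bar>a + s\<bar> + u * P"
    by (rule abs_diff_add3_le[of _ _ "- fl (+) a s" "- sum_mset ?X"])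
      (use y1 q(2) prod(2) in \<open>simp_all add: abs_minus_commute\<close>)
  ultimately have "\<bar>y - (- (a + s) - (transpose A *v v) $ i)\<bar> \<le> (N - 1) * (u * (2 * W)) + u * W"
    by simp
  also have "\<dots> = (2 * N - 1) * (u * W)" by (simp add: algebra_simps)
  \<comment> \<open>This sum has one term fewer than that of the multiplier step, so a further
    factor 2 leads to the common constant.\<close>
  also have "\<dots> \<le> (32 * N) * (u * (n * (\<bar>a + s\<bar> + norm A * norm v)))"
  proof (intro mult_mono)
    have "1 * \<bar>a + s\<bar> \<le> n * \<bar>a + s\<bar>" using n1 by (intro mult_right_mono) auto
    then show "W \<le> n * (\<bar>a + s\<bar> + norm A * norm v)" by (simp add: W_def P_def algebra_simps)
  qed (use N1 u0 W0 in auto)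
  also have "\<dots> = round_const TYPE('n) * (u * (\<bar>a + s\<bar> + norm A * norm v))"
    by (simp add: round_const_def N_def n_def power_add)
  finally show ?thesis .
qed

text \<open>\<^const>\<open>computed_step\<close> with the floating-point evaluations replaced by their error bounds.\<close>

definition rounded_step ::
    "(real^'n \<Rightarrow> real) \<Rightarrow> (real^'n \<Rightarrow> real^'m) \<Rightarrow> real^'n \<Rightarrow> real \<Rightarrow> real \<Rightarrow>
     real^'n \<Rightarrow> real^'m \<Rightarrow> real^'m \<Rightarrow> real^'m \<Rightarrow> real^'n \<Rightarrow> real^'m \<Rightarrow> real^'m \<Rightarrow>
     real^'n^'n \<Rightarrow> real^'n \<Rightarrow> real^'m^'n \<Rightarrow> real^'m \<Rightarrow> real^'m^'m \<Rightarrow> real^'n^'n \<Rightarrow> real^'n \<Rightarrow> bool" where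
  "rounded_step \<phi> g zs K u z lam s t dz dlam ds Fb fb F f G Fh fh \<longleftrightarrow>
     norm Fb \<le> K * u \<and> norm fb \<le> K * u \<and> norm F \<le> K * u \<and> norm f \<le> K * u \<and>
     diag_bounded K u (mu lam s) (active g zs) G \<and>
     norm Fh \<le> K * (u / mu lam s) \<and> norm fh \<le> K * u \<and>
     (let A = grad_cols g z + F; Dinv = matrix_inv (matrix_inv (diag lam) ** diag s + G) in
      (lagr_zz \<phi> g z lam + Fb + A ** Dinv ** transpose A + Fh) *v dz
          = - (lagr_z \<phi> g z lam + fb) - A *v (Dinv *v (g z + f - matrix_inv (diag lam) *v t)) + fh \<and>
      (\<forall>i. \<bar>dlam $ i - Dinv $ i $ i * ((g z + f) $ i - t $ i / lam $ i + (transpose A *v dz) $ i)\<bar>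
         \<le> round_const TYPE('n) * (u * (\<bar>Dinv $ i $ i\<bar> * (\<bar>(g z + f) $ i\<bar> + \<bar>t $ i / lam $ i\<bar> + norm A * norm dz)))) \<and>
      (\<forall>i. \<bar>ds $ i - (- ((g z + f) $ i + s $ i) - (transpose A *v dz) $ i)\<bar>
         \<le> round_const TYPE('n) * (u * (\<bar>(g z + f) $ i + s $ i\<bar> + norm A * norm dz))))"

text \<open>From here on only real inequalities remain. The errors are returned as explicit objects,
  so that they can become components of the iterations over which the filter ranges.\<close>

lemma computed_step_rounded:
  assumes cs: "computed_step \<phi> g zs K \<FF> fl u z lam s t dz dlam ds"
    and fm: "float_model \<FF> fl u" and u: "u \<le> 1"
    and fv: "float_vec \<FF> lam" "float_vec \<FF> s" "float_vec \<FF> t" and pos: "\<And>i. lam $ i > 0"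
  obtains Fb fb F f G Fh fh where "rounded_step \<phi> g zs K u z lam s t dz dlam ds Fb fb F f G Fh fh"
proof -
  from cs obtain Fb fb F f G Fh fh Hc Lc Ac gc Dinv where *:
        "norm Fb \<le> K * u \<and> norm fb \<le> K * u \<and> norm F \<le> K * u \<and> norm f \<le> K * u \<and>
        diag_bounded K u (mu lam s) (active g zs) G \<and>
        norm Fh \<le> K * (u / mu lam s) \<and> norm fh \<le> K * u"
        "Hc = lagr_zz \<phi> g z lam + Fb" "Lc = lagr_z \<phi> g z lam + fb" "Ac = grad_cols g z + F"
        "gc = g z + f" "Dinv = matrix_inv (matrix_inv (diag lam) ** diag s + G)"
        "float_mat \<FF> Ac" "float_vec \<FF> gc" "\<And>i. Dinv $ i $ i \<in> \<FF>" "float_vec \<FF> dz"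
        "(Hc + Ac ** Dinv ** transpose Ac + Fh) *v dz
          = - Lc - Ac *v (Dinv *v (gc - matrix_inv (diag lam) *v t)) + fh"
        "\<And>i. \<exists>y. fl_sum fl ({#gc $ i, - fl (/) (t $ i) (lam $ i)#} + fl_products fl Ac dz i) y \<and>
             dlam $ i = fl (*) (Dinv $ i $ i) y"
        "\<And>i. fl_sum fl ({#- fl (+) (gc $ i) (s $ i)#} + image_mset uminus (fl_products fl Ac dz i))
             (ds $ i)"
    unfolding computed_step_def by blast
  have el: "lam $ i \<in> \<FF>" "s $ i \<in> \<FF>" "t $ i \<in> \<FF>" "gc $ i \<in> \<FF>" for i
    using fv *(8) by (auto simp: float_vec_def)
  have 1: "\<bar>dlam $ i - Dinv $ i $ i * (gc $ i - t $ i / lam $ i + (transpose Ac *v dz) $ i)\<bar>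
     \<le> round_const TYPE('a) * (u * (\<bar>Dinv $ i $ i\<bar> * (\<bar>gc $ i\<bar> + \<bar>t $ i / lam $ i\<bar> + norm Ac * norm dz)))" for i
  proof -
    obtain y where y: "fl_sum fl ({#gc $ i, - fl (/) (t $ i) (lam $ i)#} + fl_products fl Ac dz i) y"
             "dlam $ i = fl (*) (Dinv $ i $ i) y" using *(12)[of i] by blast
    show ?thesis unfolding y(2)
      using fl_multiplier_step[OF fm u *(7,10) el(4,3,1) _ *(9) y(1)] pos[of i] by simp
  qed
  have 2: "\<bar>ds $ i - (- (gc $ i + s $ i) - (transpose Ac *v dz) $ i)\<bar>
     \<le> round_const TYPE('a) * (u * (\<bar>gc $ i + s $ i\<bar> + norm Ac * norm dz))" for i
    using fl_slack_step[OF fm u *(7,10) el(4,2) *(13)] .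
  have "rounded_step \<phi> g zs K u z lam s t dz dlam ds Fb fb F f G Fh fh"
    unfolding rounded_step_def Let_def using *(1,11) 1 2 unfolding *(2-6) by blast
  with that show ?thesis by blast
qed

section \<open>Inverses of diagonal matrices\<close>

lemma diag_mult_vec: "diag v *v w = (\<chi> i. v $ i * w $ i)"
proof -
  have "(\<Sum>j\<in>UNIV. (if i = j then v $ i else 0) * w $ j) = (\<Sum>j\<in>UNIV. if i = j then v $ i * w $ j else 0)" for i
    by (rule sum.cong) auto
  then show ?thesis by (simp add: diag_def matrix_vector_mult_def vec_eq_iff)
qed

lemma diag_mult_diag: "diag a ** diag b = diag (\<chi> i. a $ i * b $ i)" for a b :: "real^'m"
  by (simp add: matrix_eq diag_mult_vec mult.assoc flip: matrix_vector_mul_assoc)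

lemma matrix_inv_diag:
  fixes v :: "real^'m"
  assumes "\<And>i. v $ i \<noteq> 0"
  shows "matrix_inv (diag v) = diag (\<chi> i. 1 / v $ i)"
proof -
  have one: "diag (\<chi> i. 1) = (mat 1 :: real^'m^'m)"
    by (simp add: diag_def mat_def vec_eq_iff)
  have "diag v ** diag (\<chi> i. 1 / v $ i) = mat 1 \<and> diag (\<chi> i. 1 / v $ i) ** diag v = mat 1"
    using assms by (simp add: diag_mult_diag one)
  note inv = this
  then have "\<exists>M. diag v ** M = mat 1 \<and> M ** diag v = mat 1" by blast
  from someI_ex[OF this] have "matrix_inv (diag v) ** diag v = mat 1"
    by (simp add: matrix_inv_def)
  then have "matrix_inv (diag v) ** diag v ** diag (\<chi> i. 1 / v $ i) = diag (\<chi> i. 1 / v $ i)"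
    by (simp add: matrix_mul_lid)
  moreover have "matrix_inv (diag v) ** diag v ** diag (\<chi> i. 1 / v $ i) = matrix_inv (diag v)"
    using inv by (simp flip: matrix_mul_assoc)
  ultimately show ?thesis by simp
qed

lemma scaled_diag_perturbed:
  assumes "\<And>i j. i \<noteq> j \<Longrightarrow> G $ i $ j = 0" "\<And>i. lam $ i \<noteq> 0"
    "\<And>i. s $ i / lam $ i + G $ i $ i \<noteq> 0"
  shows "matrix_inv (matrix_inv (diag lam) ** diag s + G) = diag (\<chi> i. 1 / (s $ i / lam $ i + G $ i $ i))"
proof -
  have "matrix_inv (diag lam) ** diag s + G = diag (\<chi> i. s $ i / lam $ i + G $ i $ i)"
    unfolding matrix_inv_diag[OF assms(2)] diag_mult_diag
    using assms(1) by (simp add: diag_def vec_eq_iff)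
  with assms(3) show ?thesis by (simp add: matrix_inv_diag)
qed

section \<open>Size of the computed step\<close>

lemma bigO_mult1: "bigO F a (\<lambda>_. 1) \<Longrightarrow> bigO F b w \<Longrightarrow> bigO F (\<lambda>x. a x * b x :: real) w"
  using bigO_mult[of F a "\<lambda>_. 1" b w] by simp

lemma bigO_mult1': "bigO F a w \<Longrightarrow> bigO F b (\<lambda>_. 1) \<Longrightarrow> bigO F (\<lambda>x. a x * b x :: real) w"
  using bigO_mult[of F a w b "\<lambda>_. 1"] by simp

lemma bigO_matvec1: "bigO F A (\<lambda>_. 1) \<Longrightarrow> bigO F v w \<Longrightarrow> bigO F (\<lambda>x. A x *v v x) w"
  for A :: "'a \<Rightarrow> real^'n^'m"
  using bigO_matvec[of F A "\<lambda>_. 1" v w] by simp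

lemma bigO_scaleR1: "bigO F a (\<lambda>_. 1) \<Longrightarrow> bigO F v w \<Longrightarrow> bigO F (\<lambda>x. a x *\<^sub>R v x) w"
  using bigO_scaleR[of F a "\<lambda>_. 1" v w] by simp

lemma bigO_weight_add:
  assumes "bigO F v w" "\<forall>\<^sub>F x in F. 0 \<le> w x" "\<forall>\<^sub>F x in F. 0 \<le> w' x"
  shows "bigO F v (\<lambda>x. w x + w' x)" "bigO F v (\<lambda>x. w' x + w x)"
proof -
  have "bigO F w (\<lambda>x. w x + w' x)" "bigO F w (\<lambda>x. w' x + w x)"
    by (rule bigOI[where c=1], use assms(2,3) in eventually_elim, simp)+
  with assms(1) show "bigO F v (\<lambda>x. w x + w' x)" "bigO F v (\<lambda>x. w' x + w x)"
    by (auto intro: bigO_trans)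
qed

lemma bigO_absorb_self:
  assumes "bigO F y (\<lambda>x. a x + m x * norm (y x))" "(m \<longlongrightarrow> 0) F" "\<forall>\<^sub>F x in F. 0 \<le> a x"
  shows "bigO F y a"
proof -
  obtain c where c: "c > 0" "\<forall>\<^sub>F x in F. norm (y x) \<le> c * \<bar>a x + m x * norm (y x)\<bar>"
    using bigOE[OF assms(1)] by auto
  have small: "\<forall>\<^sub>F x in F. norm (m x) \<le> 1 / (2 * c)"
    using assms(2) by (rule tendsto_0_bound) (use c(1) in auto)
  show ?thesis
  proof (rule bigOI[where c="2 * c"], use c(2) assms(3) small in eventually_elim)
    case (elim x)
    have "\<bar>m x * norm (y x)\<bar> \<le> 1 / (2 * c) * norm (y x)"
      unfolding abs_mult using elim c(1) by (intro mult_mono) auto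
    then have "c * \<bar>a x + m x * norm (y x)\<bar> \<le> c * (a x + 1 / (2 * c) * norm (y x))"
      using elim c(1) by (intro mult_left_mono) auto
    also have "\<dots> = c * a x + norm (y x) / 2" using c by (simp add: field_simps)
    finally show ?case using elim by simp
  qed
qed

text \<open>Either \<open>X x \<le> m x\<close>, or \<open>X x + m x \<le> 2 * X x\<close>. In the
  second case the term with \<open>k\<close> is at most half of the left-hand side, and cancelling a
  factor \<open>X x\<close> finishes.\<close>

lemma bigO_absorb_quadratic:
  fixes X m k :: "'a \<Rightarrow> real"
  assumes sq: "bigO F (\<lambda>x. (X x)\<^sup>2) (\<lambda>x. m x * (X x + m x) + k x * (X x + m x)\<^sup>2)"
    and k: "(k \<longlongrightarrow> 0) F" and X: "\<forall>\<^sub>F x in F. 0 \<le> X x" and m: "\<forall>\<^sub>F x in F. 0 \<le> m x"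
  shows "bigO F X m"
proof -
  obtain c where c: "c > 0" "\<forall>\<^sub>F x in F. norm ((X x)\<^sup>2) \<le> c * \<bar>m x * (X x + m x) + k x * (X x + m x)\<^sup>2\<bar>"
    using bigOE[OF sq] by auto
  have small: "\<forall>\<^sub>F x in F. norm (k x) \<le> 1 / (8 * c)"
    using k by (rule tendsto_0_bound) (use c(1) in auto)
  show ?thesis
  proof (rule bigOI[where c="4 * c + 1"], use c(2) X m small in eventually_elim)
    case (elim x)
    show ?case
    proof (cases "X x \<le> m x")
      case True
      have "0 \<le> 4 * c * m x" using elim c by simp
      with True elim show ?thesis by (simp add: algebra_simps)
    next
      case False
      then have Xp: "X x > 0" using elim by simp
      have "(X x + m x)\<^sup>2 \<le> (2 * X x)\<^sup>2" using elim False by (intro power_mono) auto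
      then have "\<bar>k x * (X x + m x)\<^sup>2\<bar> \<le> 1 / (8 * c) * (2 * X x)\<^sup>2"
        unfolding abs_mult using elim c(1) by (intro mult_mono) auto
      moreover have "\<bar>m x * (X x + m x)\<bar> \<le> m x * (2 * X x)"
        unfolding abs_mult using elim False by (intro mult_mono) auto
      ultimately have "\<bar>m x * (X x + m x) + k x * (X x + m x)\<^sup>2\<bar> \<le> m x * (2 * X x) + 1 / (8 * c) * (2 * X x)\<^sup>2"
        by linarith
      then have "c * \<bar>m x * (X x + m x) + k x * (X x + m x)\<^sup>2\<bar> \<le> c * (m x * (2 * X x) + 1 / (8 * c) * (2 * X x)\<^sup>2)"
        using c by (intro mult_left_mono) auto
      also have "\<dots> = 2 * c * m x * X x + (X x)\<^sup>2 / 2"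
        using c by (simp add: field_simps power2_eq_square)
      finally have "X x * X x \<le> (4 * c * m x) * X x"
        using elim by (simp add: power2_eq_square)
      then have "X x \<le> 4 * c * m x" using Xp by simp
      then show ?thesis using elim by (simp add: algebra_simps)
    qed
  qed
qed

section \<open>The condensed system and its diagonal scaling\<close>

locale step_family = central_family \<phi> g zs F z lam s C \<gamma>
  for \<phi> :: "real^'n \<Rightarrow> real" and g :: "real^'n \<Rightarrow> real^'m" and zs :: "real^'n"
    and F :: "'a filter" and z :: "'a \<Rightarrow> real^'n" and lam s :: "'a \<Rightarrow> real^'m" and C \<gamma> :: real +
  fixes K :: real and u :: "'a \<Rightarrow> real" and t :: "'a \<Rightarrow> real^'m"
    and dz :: "'a \<Rightarrow> real^'n" and dlam ds :: "'a \<Rightarrow> real^'m"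
    and Fb :: "'a \<Rightarrow> real^'n^'n" and fb :: "'a \<Rightarrow> real^'n" and Fe :: "'a \<Rightarrow> real^'m^'n"
    and fe :: "'a \<Rightarrow> real^'m" and G :: "'a \<Rightarrow> real^'m^'m" and Fh :: "'a \<Rightarrow> real^'n^'n"
    and fh :: "'a \<Rightarrow> real^'n"
  assumes u_pos: "\<forall>\<^sub>F x in F. 0 < u x"
    and u_mu_tendsto: "((\<lambda>x. u x / \<mu> x) \<longlongrightarrow> 0) F"
    and t_le: "\<forall>\<^sub>F x in F. norm (t x) \<le> K * (\<mu> x)\<^sup>2"
    and step: "\<forall>\<^sub>F x in F. rounded_step \<phi> g zs K (u x) (z x) (lam x) (s x) (t x) (dz x) (dlam x) (ds x)
        (Fb x) (fb x) (Fe x) (fe x) (G x) (Fh x) (fh x)"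
begin

lemma mu_nonneg: "\<forall>\<^sub>F x in F. 0 \<le> \<mu> x"
  using mu_pos by eventually_elim simp

lemma u_mu: "bigO F u \<mu>"
proof (rule bigO_cong)
  show "\<forall>\<^sub>F x in F. u x = u x / \<mu> x * \<mu> x" using mu_pos by eventually_elim simp
  show "bigO F (\<lambda>x. u x / \<mu> x * \<mu> x) \<mu>" by (intro bigO_mult1 bigO_tendsto[OF u_mu_tendsto] bigO_refl)
qed

lemma u_1: "bigO F u (\<lambda>_. 1)"
  by (rule bigO_trans[OF u_mu mu_1])

lemma u_tendsto: "(u \<longlongrightarrow> 0) F"
  by (rule bigO_tendsto_0[OF u_mu mu_tendsto])

lemma Fb_u: "bigO F Fb u" and fb_u: "bigO F fb u" and Fe_u: "bigO F Fe u" and fe_u: "bigO F fe u"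
  and fh_u: "bigO F fh u" and Fh_u: "bigO F Fh (\<lambda>x. u x / \<mu> x)"
  by (rule bigO_mono[where c=K], use step in eventually_elim, simp add: rounded_step_def,
    (use u_pos mu_pos in eventually_elim, simp))+

lemma t_mu2: "bigO F t (\<lambda>x. \<mu> x * \<mu> x)"
  by (rule bigO_mono[where c=K], use t_le in eventually_elim, simp add: power2_eq_square, simp)

text \<open>\<open>E i\<close> is the \<open>i\<close>-th diagonal entry of the computed \<open>D\<^sup>-\<^sup>1\<close>, \<open>dv i\<close> its reciprocal.\<close>

definition D where "D i x = s x $ i / lam x $ i"
definition dv where "dv i x = D i x + G x $ i $ i"
definition E where "E i x = 1 / dv i x"

lemma inverse_mu_cancel: "bigO F v (\<lambda>x. inverse (\<mu> x) * (\<mu> x * w x)) \<Longrightarrow> bigO F v w"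
  by (erule bigO_trans, rule bigO_cong[OF _ bigO_refl], use mu_pos in eventually_elim) simp

lemma D_active:
  assumes "i \<in> B" shows "bigO F (D i) \<mu>" "\<exists>c>0. \<forall>\<^sub>F x in F. c * \<mu> x \<le> D i x"
proof -
  obtain c where c: "c > 0" "\<forall>\<^sub>F x in F. c \<le> lam x $ i" by (rule lam_active[OF assms])
  have "bigO F (\<lambda>x. 1 / lam x $ i) (\<lambda>_. 1)"
    by (rule bigOI[where c="1/c"], use c(2) in eventually_elim) (use c(1) in \<open>simp add: field_simps\<close>)
  from bigO_mult1[OF this s_active[OF assms]]
  show "bigO F (D i) \<mu>" by (simp add: D_def[abs_def])
  obtain c where c: "c > 0" "\<forall>\<^sub>F x in F. c * \<mu> x \<le> s x $ i" by (rule s_active_lower)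
  obtain d where d: "d > 0" "\<forall>\<^sub>F x in F. norm (lam x $ i) \<le> d * \<bar>1\<bar>" using bigOE[OF bigO_nth[OF lam_1]] by metis
  have "\<forall>\<^sub>F x in F. c / d * \<mu> x \<le> D i x"
    using c(2) d(2) positive[of i] mu_pos
  proof eventually_elim
    case (elim x)
    have "c * \<mu> x * lam x $ i \<le> s x $ i * d" using elim d c by (intro mult_mono) auto
    with d elim show ?case by (simp add: D_def field_simps)
  qed
  with c d show "\<exists>c>0. \<forall>\<^sub>F x in F. c * \<mu> x \<le> D i x" by (intro exI[of _ "c / d"]) simp
qed

lemma D_inactive:
  assumes "i \<notin> B" shows "\<exists>c>0. \<forall>\<^sub>F x in F. c * inverse (\<mu> x) \<le> D i x"
proof -
  obtain c where c: "c > 0" "\<forall>\<^sub>F x in F. c \<le> s x $ i" by (rule s_inactive[OF assms])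
  obtain d where d: "d > 0" "\<forall>\<^sub>F x in F. norm (lam x $ i) \<le> d * \<bar>\<mu> x\<bar>" using bigOE[OF lam_inactive[OF assms]] by metis
  have "\<forall>\<^sub>F x in F. c / d * inverse (\<mu> x) \<le> D i x"
    using c(2) d(2) positive[of i] mu_pos
  proof eventually_elim
    case (elim x)
    have "c * lam x $ i \<le> s x $ i * (d * \<mu> x)" using elim d c by (intro mult_mono) auto
    with d elim show ?case by (simp add: D_def field_simps)
  qed
  with c d show ?thesis by (intro exI[of _ "c / d"]) simp
qed

lemma D_pos: "\<forall>\<^sub>F x in F. 0 < D i x"
  using positive[of i] by eventually_elim (simp add: D_def)

text \<open>Both bounds on \<open>G\<close> say that \<open>D\<close> is computed with relative
  error \<open>O(u)\<close>: its active entries are at least of order \<mu>, its inactive ones at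
  least of order \<open>1/\<mu>\<close>. In the proof \<delta> stands for this order.\<close>

lemma G_D: "bigO F (\<lambda>x. G x $ i $ i) (\<lambda>x. u x * D i x)"
proof -
  have diag: "\<forall>\<^sub>F x in F. diag_bounded K (u x) (\<mu> x) B (G x)"
    using step by eventually_elim (simp only: rounded_step_def)
  have "\<exists>\<delta>. (\<forall>\<^sub>F x in F. norm (G x $ i $ i) \<le> K * (u x * \<delta> x)) \<and> (\<forall>\<^sub>F x in F. 0 \<le> \<delta> x) \<and>
    (\<exists>c>0. \<forall>\<^sub>F x in F. c * \<delta> x \<le> D i x)"
  proof (cases "i \<in> B")
    case True
    have "\<forall>\<^sub>F x in F. norm (G x $ i $ i) \<le> K * (u x * \<mu> x)"
      using diag
    proof eventually_elim
      case (elim x)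
      then have "\<bar>G x $ i $ i\<bar> \<le> K * (\<mu> x * u x)" using True unfolding diag_bounded_def by blast
      then show ?case by (simp add: mult.commute[of "\<mu> x"])
    qed
    with mu_nonneg D_active(2)[OF True] show ?thesis by (intro exI[of _ \<mu>]) blast
  next
    case False
    have "\<forall>\<^sub>F x in F. norm (G x $ i $ i) \<le> K * (u x * inverse (\<mu> x))"
      using diag
    proof eventually_elim
      case (elim x)
      then have "\<bar>G x $ i $ i\<bar> \<le> K * (u x / \<mu> x)" using False unfolding diag_bounded_def by blast
      then show ?case by (simp add: divide_inverse)
    qed
    moreover have "\<forall>\<^sub>F x in F. 0 \<le> inverse (\<mu> x)" using mu_pos by eventually_elim simp
    ultimately show ?thesis using D_inactive[OF False] by (intro exI[of _ "\<lambda>x. inverse (\<mu> x)"]) blast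
  qed
  then obtain \<delta> where \<delta>: "\<forall>\<^sub>F x in F. norm (G x $ i $ i) \<le> K * (u x * \<delta> x)" "\<forall>\<^sub>F x in F. 0 \<le> \<delta> x" and
    lower: "\<exists>c>0. \<forall>\<^sub>F x in F. c * \<delta> x \<le> D i x" by blast
  obtain c where c: "c > 0" "\<forall>\<^sub>F x in F. c * \<delta> x \<le> D i x" using lower by auto
  have 1: "bigO F (\<lambda>x. G x $ i $ i) (\<lambda>x. u x * \<delta> x)"
  proof (rule bigO_mono[where c=K])
    show "\<forall>\<^sub>F x in F. 0 \<le> u x * \<delta> x" using u_pos \<delta>(2) by eventually_elim simp
  qed (rule \<delta>(1))
  have "bigO F \<delta> (D i)"
  proof (rule bigOI[where c="1/c"], use c(2) \<delta>(2) D_pos[of i] in eventually_elim)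
    case (elim x)
    have "\<delta> x \<le> D i x / c" using elim(1) c(1) by (simp add: pos_le_divide_eq mult.commute)
    with elim show ?case by simp
  qed
  then have "bigO F (\<lambda>x. u x * \<delta> x) (\<lambda>x. u x * D i x)" using bigO_mult[of F u u \<delta> "D i"] by simp
  with 1 show ?thesis by (rule bigO_trans)
qed

lemma dv_bounds: "\<forall>\<^sub>F x in F. 0 < dv i x \<and> D i x \<le> 2 * dv i x \<and> dv i x \<le> 2 * D i x"
proof -
  obtain c where c: "c > 0" "\<forall>\<^sub>F x in F. norm (G x $ i $ i) \<le> c * \<bar>u x * D i x\<bar>" using bigOE[OF G_D] by metis
  have "\<forall>\<^sub>F x in F. norm (u x) \<le> 1 / (2 * c)" using u_tendsto by (rule tendsto_0_bound) (use c in simp)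
  with c(2) D_pos[of i] u_pos show ?thesis
  proof eventually_elim
    case (elim x)
    have "c * u x * D i x \<le> 1 / 2 * D i x" using elim c by (intro mult_right_mono) (auto simp: field_simps)
    then have "c * (u x * D i x) \<le> D i x / 2" by (simp add: mult.assoc)
    moreover have "\<bar>u x * D i x\<bar> = u x * D i x" using elim by simp
    ultimately have "\<bar>G x $ i $ i\<bar> \<le> D i x / 2" using elim(1) by simp
    then have "G x $ i $ i \<le> D i x / 2" "- G x $ i $ i \<le> D i x / 2" by auto
    note G = this
    have "0 < dv i x" using G elim(2) unfolding dv_def distrib_left by linarith
    moreover have "D i x \<le> 2 * dv i x" using G elim(2) unfolding dv_def distrib_left by linarith
    moreover have "dv i x \<le> 2 * D i x" using G elim(2) unfolding dv_def distrib_left by linarith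
    ultimately show ?case by blast
  qed
qed

lemma dv_pos: "\<forall>\<^sub>F x in F. 0 < dv i x"
  using dv_bounds[of i] by eventually_elim simp

lemma E_pos: "\<forall>\<^sub>F x in F. 0 < E i x"
  using dv_pos[of i] by eventually_elim (simp add: E_def)

lemma dv_active: assumes "i \<in> B"
  shows "bigO F (dv i) \<mu>" "\<exists>c>0. \<forall>\<^sub>F x in F. c * \<mu> x \<le> dv i x"
proof -
  have "bigO F (dv i) (D i)"
    by (rule bigOI[where c=2], use dv_bounds[of i] D_pos[of i] in eventually_elim) simp
  from bigO_trans[OF this D_active(1)[OF assms]] show "bigO F (dv i) \<mu>" .
  obtain c where c: "c > 0" "\<forall>\<^sub>F x in F. c * \<mu> x \<le> D i x" using D_active(2)[OF assms] by auto
  have "\<forall>\<^sub>F x in F. c / 2 * \<mu> x \<le> dv i x" using c(2) dv_bounds[of i] by eventually_elim simp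
  then show "\<exists>c>0. \<forall>\<^sub>F x in F. c * \<mu> x \<le> dv i x" using c(1) by (intro exI[of _ "c / 2"]) simp
qed

lemma E_active: assumes "i \<in> B"
  shows "bigO F (E i) (\<lambda>x. inverse (\<mu> x))" "\<exists>c>0. \<forall>\<^sub>F x in F. c \<le> E i x * \<mu> x"
proof -
  obtain c where c: "c > 0" "\<forall>\<^sub>F x in F. c * \<mu> x \<le> dv i x" using dv_active(2)[OF assms] by auto
  show "bigO F (E i) (\<lambda>x. inverse (\<mu> x))"
    by (rule bigOI[where c="1/c"], use c(2) dv_pos[of i] mu_pos in eventually_elim)
      (use c(1) in \<open>simp add: E_def field_simps\<close>)
  obtain c where c: "c > 0" "\<forall>\<^sub>F x in F. norm (dv i x) \<le> c * \<bar>\<mu> x\<bar>" using bigOE[OF dv_active(1)[OF assms]] by metis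
  have "\<forall>\<^sub>F x in F. 1 / c \<le> E i x * \<mu> x" using c(2) dv_pos[of i] mu_pos
    by eventually_elim (use c(1) in \<open>simp add: E_def field_simps\<close>)
  then show "\<exists>c>0. \<forall>\<^sub>F x in F. c \<le> E i x * \<mu> x" using c(1) by (intro exI[of _ "1 / c"]) simp
qed

lemma E_inactive: assumes "i \<notin> B" shows "bigO F (E i) \<mu>"
proof -
  obtain c where c: "c > 0" "\<forall>\<^sub>F x in F. c * inverse (\<mu> x) \<le> D i x" using D_inactive[OF assms] by auto
  show ?thesis
  proof (rule bigOI[where c="2/c"], use c(2) dv_bounds[of i] mu_pos in eventually_elim)
    case (elim x)
    then have "c * inverse (\<mu> x) \<le> 2 * dv i x" by linarith
    with elim c(1) show ?case by (simp add: E_def field_simps)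
  qed
qed

text \<open>With the exact \<open>D\<close> in place of \<open>dv\<close> the quotient
  \<open>s / D\<close> would be \<open>lam\<close>; the relative error \<open>O(u)\<close> in
  \<open>D\<close> perturbs it by \<open>O(u)\<close>. This makes the computed step satisfy
  linearized complementarity.\<close>

lemma s_E: "bigO F (\<lambda>x. s x $ i * E i x - lam x $ i) u"
proof -
  have "bigO F (\<lambda>x. - (lam x $ i * (G x $ i $ i * E i x))) u"
  proof -
    have "bigO F (\<lambda>x. G x $ i $ i * E i x) (\<lambda>x. (u x * D i x) * E i x)"
      by (intro bigO_mult G_D bigO_refl)
    moreover have "bigO F (\<lambda>x. D i x * E i x) (\<lambda>_. 1)"
      by (rule bigOI[where c=2], use dv_bounds[of i] D_pos[of i] in eventually_elim) (simp add: E_def field_simps)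
    then have "bigO F (\<lambda>x. (u x * D i x) * E i x) u"
      using bigO_mult1'[OF bigO_refl[of F u]] by (simp add: mult.assoc)
    ultimately have "bigO F (\<lambda>x. G x $ i $ i * E i x) u" by (rule bigO_trans)
    from bigO_mult1[OF bigO_nth[OF lam_1] this] show ?thesis by (rule bigO_minus)
  qed
  moreover have "\<forall>\<^sub>F x in F. s x $ i * E i x - lam x $ i = - (lam x $ i * (G x $ i $ i * E i x))"
    using dv_pos[of i] positive[of i]
    by eventually_elim (simp add: E_def field_simps, simp add: dv_def D_def field_simps)
  ultimately show ?thesis by (rule bigO_cong[rotated])
qed

abbreviation "L x \<equiv> lagr_z \<phi> g (z x) (lam x)"
abbreviation "Hz x \<equiv> lagr_zz \<phi> g (z x) (lam x)"
abbreviation "Ac x \<equiv> J (z x) + Fe x"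
abbreviation "gc x \<equiv> g (z x) + fe x"
definition "tq x = (\<chi> i. t x $ i / lam x $ i)"
definition "M x = Hz x + Fb x + Fh x"
definition "va x = transpose (Ac x) *v dz x"
definition "e x = gc x - tq x + va x"
text \<open>The multiplier step formed from the computed data, before its own evaluation is
  rounded.\<close>

definition "Ee x = (\<chi> i. E i x * e x $ i)"
definition "rhs x = - (L x + fb x) + fh x"

text \<open>Undoes the elimination behind the condensed system: the large block is hidden in
  \<open>Ee\<close>, and what remains has the form of the stationarity row of the full Newton
  system, with the bounded matrix \<open>M\<close> for the Hessian.\<close>

lemma step_simplified:
  "\<forall>\<^sub>F x in F. M x *v dz x + Ac x *v Ee x = rhs x \<and>
     (\<forall>i. \<bar>dlam x $ i - Ee x $ i\<bar> \<le> round_const TYPE('n) * (u x * (\<bar>E i x\<bar> * (\<bar>gc x $ i\<bar> + \<bar>tq x $ i\<bar> + norm (Ac x) * norm (dz x))))) \<and>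
     (\<forall>i. \<bar>ds x $ i + (gc x $ i + s x $ i) + va x $ i\<bar>
         \<le> round_const TYPE('n) * (u x * (\<bar>gc x $ i + s x $ i\<bar> + norm (Ac x) * norm (dz x))))"
proof -
  have "\<forall>\<^sub>F x in F. \<forall>i. 0 < dv i x" using dv_pos by (simp add: eventually_all_finite)
  moreover have "\<forall>\<^sub>F x in F. \<forall>i. 0 < lam x $ i \<and> 0 < s x $ i" using positive by (simp add: eventually_all_finite)
  ultimately show ?thesis using step
  proof eventually_elim
    case (elim x)
    let ?Dinv = "matrix_inv (matrix_inv (diag (lam x)) ** diag (s x) + G x)"
    have ne: "lam x $ i \<noteq> 0" "dv i x \<noteq> 0" for i using elim(1,2) by (auto simp: less_le)
    have Dinv: "?Dinv = diag (\<chi> i. E i x)"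
      unfolding E_def dv_def D_def
      by (rule scaled_diag_perturbed) (use elim(3) ne in \<open>auto simp: rounded_step_def diag_bounded_def dv_def D_def\<close>)
    have Dnth: "?Dinv $ i $ i = E i x" for i unfolding Dinv by (simp add: diag_def)
    have tq: "matrix_inv (diag (lam x)) *v t x = tq x"
      using ne(1) by (simp add: matrix_inv_diag diag_mult_vec tq_def vec_eq_iff)
    have De: "?Dinv *v (gc x - tq x) + ?Dinv *v va x = Ee x"
      unfolding Dinv by (simp add: diag_mult_vec Ee_def e_def vec_eq_iff algebra_simps)
    have "(Hz x + Fb x + Ac x ** ?Dinv ** transpose (Ac x) + Fh x) *v dz x
        = - (L x + fb x) - Ac x *v (?Dinv *v (gc x - matrix_inv (diag (lam x)) *v t x)) + fh x"
      using elim(3) by (simp only: rounded_step_def Let_def)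
    moreover have "(Hz x + Fb x + Ac x ** ?Dinv ** transpose (Ac x) + Fh x) *v dz x = M x *v dz x + Ac x *v (?Dinv *v va x)"
      by (simp add: M_def va_def matrix_vector_mult_add_rdistrib flip: matrix_vector_mul_assoc)
    moreover have *: "a + (d + b) = c + e'" if "a + b = c - d + e'" for a b c d e' :: "real^'n"
      using that by (simp add: algebra_simps)
    ultimately have "M x *v dz x + (Ac x *v (?Dinv *v (gc x - tq x)) + Ac x *v (?Dinv *v va x)) = rhs x"
      unfolding tq rhs_def by (intro *) simp
    then have 1: "M x *v dz x + Ac x *v Ee x = rhs x"
      unfolding De[symmetric] by (simp add: matrix_vector_right_distrib)
    have 2: "\<bar>dlam x $ i - E i x * (gc x $ i - t x $ i / lam x $ i + va x $ i)\<bar>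
       \<le> round_const TYPE('n) * (u x * (\<bar>E i x\<bar> * (\<bar>gc x $ i\<bar> + \<bar>t x $ i / lam x $ i\<bar> + norm (Ac x) * norm (dz x))))" for i
      using elim(3) by (simp only: rounded_step_def Let_def va_def Dnth)
    have 3: "\<bar>ds x $ i - (- (gc x $ i + s x $ i) - va x $ i)\<bar>
         \<le> round_const TYPE('n) * (u x * (\<bar>gc x $ i + s x $ i\<bar> + norm (Ac x) * norm (dz x)))" for i
      using elim(3) by (simp only: rounded_step_def Let_def va_def)
    have "tq x $ i = t x $ i / lam x $ i" "Ee x $ i = E i x * (gc x $ i - t x $ i / lam x $ i + va x $ i)"
      "ds x $ i - (- (gc x $ i + s x $ i) - va x $ i) = ds x $ i + (gc x $ i + s x $ i) + va x $ i" for i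
      by (simp_all add: tq_def Ee_def e_def)
    with 1 2 3 show ?case by (simp only: simp_thms)
  qed
qed

end

lemma inner_matvec: "w \<bullet> (X *v v) = (transpose X *v w) \<bullet> v" for X :: "real^'m^'n"
  by (metis dot_lmul_matrix transpose_matrix_vector)

lemma transpose_diff: "transpose (X - Y) = transpose X - transpose Y"
  by (simp add: transpose_def vec_eq_iff)

lemma bigO_weaken:
  assumes "bigO F v w" "\<forall>\<^sub>F x in F. 0 \<le> w x \<and> w x \<le> w' x" shows "bigO F v w'"
proof (rule bigO_trans[OF assms(1)])
  show "bigO F w w'" by (rule bigOI[where c=1], use assms(2) in eventually_elim) simp
qed

lemma inner_split_mask: "v \<bullet> w = mask B v \<bullet> mask B w + mask (- B) v \<bullet> mask (- B) w"
proof -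
  have "w = mask B w + mask (- B) w" by (auto simp: vec_eq_iff mask_nth)
  then have "v \<bullet> w = v \<bullet> mask B w + v \<bullet> mask (- B) w" by (metis inner_add_right)
  also have "\<dots> = v \<bullet> mask B (mask B w) + v \<bullet> mask (- B) (mask (- B) w)" by simp
  finally show ?thesis unfolding inner_mask[symmetric] .
qed

section \<open>Bounds for the primal, slack and multiplier steps\<close>

context step_family
begin

lemma J_A: "bigO F (\<lambda>x. J (z x) - A) \<mu>"
  by (rule bigO_trans[OF J_bigO[OF tendsto_const z_tendsto]]) (simp add: y_mu)

lemma J_1: "bigO F (\<lambda>x. J (z x)) (\<lambda>_. 1)"
  using bigO_add[OF bigO_trans[OF J_A mu_1] bigO_const[of F A]] by simp

lemma Ac_A: "bigO F (\<lambda>x. Ac x - A) \<mu>"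
  using bigO_add[OF J_A bigO_trans[OF Fe_u u_mu]] by (simp add: algebra_simps)

lemma Ac_1: "bigO F Ac (\<lambda>_. 1)"
  by (intro bigO_add J_1 bigO_trans[OF Fe_u u_1])

lemma g_active: assumes "i \<in> B" shows "bigO F (\<lambda>x. g (z x) $ i) \<mu>"
  using bigO_diff[OF bigO_nth[OF r_g_mu] s_active[OF assms], of i] by simp

lemma g_1: "bigO F (\<lambda>x. g (z x)) (\<lambda>_. 1)"
  using bigO_diff[OF bigO_trans[OF r_g_mu mu_1] s_1] by simp

lemma gc_active: assumes "i \<in> B" shows "bigO F (\<lambda>x. gc x $ i) \<mu>"
  using bigO_add[OF g_active[OF assms] bigO_nth[OF bigO_trans[OF fe_u u_mu], of i]] by simp

lemma gc_1: "bigO F gc (\<lambda>_. 1)"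
  by (intro bigO_add g_1 bigO_trans[OF fe_u u_1])

lemma mu2_mu: "bigO F (\<lambda>x. \<mu> x * \<mu> x) \<mu>"
  by (intro bigO_mult1 mu_1 bigO_refl)

lemma tq_active: assumes "i \<in> B" shows "bigO F (\<lambda>x. tq x $ i) (\<lambda>x. \<mu> x * \<mu> x)"
proof -
  obtain c where c: "c > 0" "\<forall>\<^sub>F x in F. c \<le> lam x $ i" by (rule lam_active[OF assms])
  have "bigO F (\<lambda>x. 1 / lam x $ i) (\<lambda>_. 1)"
    by (rule bigOI[where c="1/c"], use c(2) in eventually_elim) (use c(1) in \<open>simp add: field_simps\<close>)
  from bigO_mult1[OF this bigO_nth[OF t_mu2, of i]] show ?thesis by (simp add: tq_def)
qed

text \<open>An inactive multiplier is bounded below only by a multiple of \<mu>, so the division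
  costs one order.\<close>

lemma tq_mu: "bigO F tq \<mu>"
proof (rule bigO_vec)
  fix i
  obtain c where c: "c > 0" "\<forall>\<^sub>F x in F. c * \<mu> x \<le> lam x $ i" by (rule lam_inactive_lower)
  have "bigO F (\<lambda>x. 1 / lam x $ i) (\<lambda>x. inverse (\<mu> x))"
  proof (rule bigOI[where c="1/c"], use c(2) mu_pos positive[of i] in eventually_elim)
    case (elim x)
    have "1 / lam x $ i \<le> 1 / (c * \<mu> x)" using elim c(1) by (intro divide_left_mono) auto
    with elim show ?case by (simp add: divide_inverse)
  qed
  from bigO_mult[OF this bigO_nth[OF t_mu2, of i]]
  show "bigO F (\<lambda>x. tq x $ i) \<mu>" by (rule inverse_mu_cancel[OF bigO_eq]) (simp add: tq_def)
qed

lemma rhs_mu: "bigO F rhs \<mu>"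
  unfolding rhs_def by (intro bigO_add bigO_minus r_f_mu bigO_trans[OF fb_u u_mu] bigO_trans[OF fh_u u_mu])

lemma M_H: "((\<lambda>x. M x - H x) \<longlongrightarrow> 0) F"
proof -
  have "((\<lambda>x. Hz x - H x) \<longlongrightarrow> 0) F"
    using bigO_tendsto_0[OF lagr_zz_bigO[OF tendsto_const z_tendsto lam_1] tendsto_norm_zero[OF y_tendsto]] .
  moreover have "(Fb \<longlongrightarrow> 0) F" "(Fh \<longlongrightarrow> 0) F"
    using bigO_tendsto_0[OF Fb_u u_tendsto] bigO_tendsto_0[OF Fh_u u_mu_tendsto] .
  ultimately have "((\<lambda>x. (Hz x - H x) + Fb x + Fh x) \<longlongrightarrow> 0 + 0 + 0) F" by (intro tendsto_add)
  then show ?thesis by (simp add: M_def algebra_simps)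
qed

lemma M_1: "bigO F M (\<lambda>_. 1)"
  using bigO_add[OF bigO_tendsto[OF M_H] H_1] by simp

text \<open>The quantity penalized by the block of size \<open>1/\<mu>\<close>; it is treated as an
  unknown until \<open>V_mu\<close>.\<close>

definition "V x = norm (mask B (va x))"
text \<open>\<open>Ek\<close> is the part of \<open>Ee\<close> of known size, \<open>Ev\<close> the
  part that depends on the unknown step.\<close>

definition "Ek x = (\<chi> i. E i x * (gc x - tq x) $ i)"
definition "Ev x = (\<chi> i. E i x * va x $ i)"

lemma Ee_eq: "Ee x = Ek x + Ev x"
  by (simp add: Ee_def Ek_def Ev_def e_def vec_eq_iff algebra_simps)

lemma V_nonneg: "0 \<le> V x"
  by (simp add: V_def)

lemma va_dz: "bigO F va (\<lambda>x. norm (dz x))"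
  unfolding va_def by (intro bigO_matvec1 bigO_self_norm) (simp add: Ac_1)

lemma va_V: assumes "i \<in> B" shows "bigO F (\<lambda>x. va x $ i) V"
proof (rule bigOI[where c=1], rule always_eventually, rule allI)
  fix x show "norm (va x $ i) \<le> 1 * \<bar>V x\<bar>"
    using component_le_norm_cart[of "mask B (va x)" i] assms by (simp add: V_def mask_nth)
qed

lemma gt_active: "i \<in> B \<Longrightarrow> bigO F (\<lambda>x. (gc x - tq x) $ i) \<mu>"
  using bigO_diff[OF gc_active[of i] bigO_nth[OF tq_mu, of i]] by simp

lemma gt_1: "bigO F (\<lambda>x. gc x - tq x) (\<lambda>_. 1)"
  by (intro bigO_diff gc_1 bigO_trans[OF tq_mu mu_1])

lemma inverse_mu_mult: "bigO F (\<lambda>x. inverse (\<mu> x) * \<mu> x) (\<lambda>_. 1)"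
  by (rule bigOI[where c=1], use mu_pos in eventually_elim) simp

lemma Ek_active: assumes "i \<in> B" shows "bigO F (\<lambda>x. Ek x $ i) (\<lambda>_. 1)"
  using bigO_trans[OF bigO_mult[OF E_active(1)[OF assms] gt_active[OF assms]] inverse_mu_mult] by (simp add: Ek_def)

lemma Ek_inactive: assumes "i \<notin> B" shows "bigO F (\<lambda>x. Ek x $ i) \<mu>"
  using bigO_mult1'[OF E_inactive[OF assms] bigO_nth[OF gt_1, of i]] by (simp add: Ek_def)

lemma Ev_active: assumes "i \<in> B" shows "bigO F (\<lambda>x. Ev x $ i) (\<lambda>x. inverse (\<mu> x) * V x)"
  using bigO_mult[OF E_active(1)[OF assms] va_V[OF assms]] by (simp add: Ev_def)

lemma Ev_inactive: assumes "i \<notin> B" shows "bigO F (\<lambda>x. Ev x $ i) (\<lambda>x. \<mu> x * norm (dz x))"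
  using bigO_mult[OF E_inactive[OF assms] bigO_nth[OF va_dz, of i]] by (simp add: Ev_def)

lemma step_inner: "\<forall>\<^sub>F x in F. p x \<bullet> (M x *v dz x) = p x \<bullet> rhs x - (transpose (Ac x) *v p x) \<bullet> Ee x"
  using step_simplified
proof eventually_elim
  case (elim x)
  then have "p x \<bullet> (M x *v dz x) + p x \<bullet> (Ac x *v Ee x) = p x \<bullet> rhs x" by (simp only: inner_add_right[symmetric])
  then show ?case unfolding inner_matvec[of "p x" "Ac x"] by simp
qed

lemma AcT_diff: "bigO F (\<lambda>x. transpose (Ac x) *v p x - transpose A *v p x) (\<lambda>x. \<mu> x * norm (p x))"
proof -
  have "bigO F (\<lambda>x. transpose (Ac x - A) *v p x) (\<lambda>x. \<mu> x * norm (p x))"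
    by (intro bigO_matvec bigO_self_norm) (simp only: bigO_transpose Ac_A)
  then show ?thesis by (simp only: transpose_diff matrix_vector_mult_diff_rdistrib)
qed

text \<open>Test the linear system with the projection of \<open>\<Delta>z\<close> to the kernel of \<open>T\<close>, on which the
  large block of the matrix acts with size \<open>O(1)\<close> only.\<close>

lemma dz_V: "bigO F dz (\<lambda>x. V x + \<mu> x)"
proof -
  define q where "q x = R (T (dz x))" for x
  define p where "p x = dz x - q x" for x
  \<comment> \<open>The last term refers back to \<open>dz\<close>; its factor tends to 0, so it is
    absorbed at the end.\<close>
  define W where "W x = V x + \<mu> x + \<mu> x * norm (dz x)" for x
  have Tp: "T (p x) = 0" for x unfolding p_def q_def by (rule R)
  have nn: "\<forall>\<^sub>F x in F. 0 \<le> \<mu> x * norm (dz x)" using mu_nonneg by eventually_elim simp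
  have W1: "bigO F V W" "bigO F \<mu> W" "bigO F (\<lambda>x. \<mu> x * norm (dz x)) W"
    by (rule bigO_weaken[OF bigO_refl], use mu_nonneg nn in eventually_elim, simp add: W_def V_nonneg)+
  have "bigO F (\<lambda>x. mask B (va x) - mask B (transpose (Ac x) *v dz x - transpose A *v dz x)) W"
  proof (rule bigO_diff[OF _ bigO_mask'])
    show "bigO F (\<lambda>x. mask B (va x)) W"
      by (rule bigO_trans[OF _ W1(1)]) (simp add: V_def[abs_def] bigO_self_norm)
    show "bigO F (\<lambda>x. transpose (Ac x) *v dz x - transpose A *v dz x) W"
      by (rule bigO_trans[OF AcT_diff W1(3)])
  qed
  then have "bigO F (\<lambda>x. T (dz x)) W"
    by (rule bigO_eq) (auto simp: T_def va_def vec_eq_iff mask_nth)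
  then have q: "bigO F q W" unfolding q_def by (rule bigO_linear[OF R(1)])
  \<comment> \<open>Since \<open>T (p x) = 0\<close>, the active part of
    \<open>transpose (Ac x) *v p x\<close> is only the \<open>O(\<mu>)\<close> perturbation of
    \<open>A\<close>. This factor \<mu> compensates the \<open>1/\<mu>\<close> in the active part of
    \<open>Ee\<close>.\<close>
  have "bigO F (\<lambda>x. mask B (transpose (Ac x) *v p x - transpose A *v p x)) (\<lambda>x. \<mu> x * norm (p x))"
    by (rule bigO_mask'[OF AcT_diff])
  then have mp: "bigO F (\<lambda>x. mask B (transpose (Ac x) *v p x)) (\<lambda>x. \<mu> x * norm (p x))"
  proof (rule bigO_eq)
    fix x
    have "mask B (transpose A *v p x) = 0" using Tp[of x] by (simp add: T_def)
    then show "mask B (transpose (Ac x) *v p x) = mask B (transpose (Ac x) *v p x - transpose A *v p x)"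
      by (simp add: linear_diff[OF linear_mask])
  qed
  have "bigO F (\<lambda>x. mask B (Ee x)) (\<lambda>x. inverse (\<mu> x) * V x + 1)"
  proof (rule bigO_mask)
    fix i assume i: "i \<in> B"
    have "\<forall>\<^sub>F x in F. 0 \<le> inverse (\<mu> x) * V x" using mu_pos by eventually_elim (simp add: V_nonneg)
    from bigO_add[OF bigO_weight_add(2)[OF Ek_active[OF i] _ this] bigO_weight_add(1)[OF Ev_active[OF i] this]]
    show "bigO F (\<lambda>x. Ee x $ i) (\<lambda>x. inverse (\<mu> x) * V x + 1)" by (simp add: Ee_eq)
  qed
  from bigO_inner[OF mp this]
  have 1: "bigO F (\<lambda>x. mask B (transpose (Ac x) *v p x) \<bullet> mask B (Ee x)) (\<lambda>x. norm (p x) * W x)"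
  proof (rule bigO_weaken)
    show "\<forall>\<^sub>F x in F. 0 \<le> \<mu> x * norm (p x) * (inverse (\<mu> x) * V x + 1) \<and>
              \<mu> x * norm (p x) * (inverse (\<mu> x) * V x + 1) \<le> norm (p x) * W x"
      using mu_pos nn
    proof eventually_elim
      case (elim x)
      have "\<mu> x * norm (p x) * (inverse (\<mu> x) * V x + 1) = norm (p x) * (V x + \<mu> x)"
        using elim(1) by (simp add: field_simps)
      moreover have "norm (p x) * (V x + \<mu> x) \<le> norm (p x) * W x"
        using elim(2) by (intro mult_left_mono) (auto simp: W_def)
      moreover have "0 \<le> norm (p x) * (V x + \<mu> x)" using elim(1) V_nonneg[of x] by simp
      ultimately show ?case by (simp only:)
    qed
  qed
  have "bigO F (\<lambda>x. mask (- B) (Ee x)) W"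
  proof (rule bigO_mask)
    fix i assume i: "i \<in> - B"
    then have "i \<notin> B" by simp
    from bigO_add[OF bigO_trans[OF Ek_inactive[OF this] W1(2)] bigO_trans[OF Ev_inactive[OF this] W1(3)]]
    show "bigO F (\<lambda>x. Ee x $ i) W" by (simp add: Ee_eq)
  qed
  moreover have "bigO F (\<lambda>x. mask (- B) (transpose (Ac x) *v p x)) (\<lambda>x. norm (p x))"
    by (intro bigO_mask' bigO_matvec1 bigO_self_norm) (simp add: Ac_1)
  ultimately have 2: "bigO F (\<lambda>x. mask (- B) (transpose (Ac x) *v p x) \<bullet> mask (- B) (Ee x)) (\<lambda>x. norm (p x) * W x)"
    by (intro bigO_inner)
  have 3: "bigO F (\<lambda>x. p x \<bullet> rhs x) (\<lambda>x. norm (p x) * W x)"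
    by (intro bigO_inner bigO_self_norm bigO_trans[OF rhs_mu W1(2)])
  have 4: "bigO F (\<lambda>x. p x \<bullet> (M x *v q x)) (\<lambda>x. norm (p x) * W x)"
    by (intro bigO_inner bigO_self_norm bigO_matvec1 M_1 q)
  have ev: "\<forall>\<^sub>F x in F. p x \<bullet> (M x *v p x) = p x \<bullet> rhs x - (mask B (transpose (Ac x) *v p x) \<bullet> mask B (Ee x)
     + mask (- B) (transpose (Ac x) *v p x) \<bullet> mask (- B) (Ee x)) - p x \<bullet> (M x *v q x)"
    using step_inner[of p]
  proof eventually_elim
    case (elim x)
    have "p x \<bullet> (M x *v p x) = p x \<bullet> (M x *v dz x) - p x \<bullet> (M x *v q x)"
      by (simp add: p_def[of x] matrix_vector_mult_diff_distrib inner_diff_right)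
    then show ?case unfolding elim inner_split_mask[where B=B, symmetric] .
  qed
  have "bigO F (\<lambda>x. p x \<bullet> (M x *v p x)) (\<lambda>x. norm (p x) * W x)"
    by (rule bigO_cong[OF ev]) (intro bigO_diff bigO_add 1 2 3 4)
  then have "bigO F p W"
    by (intro curvature_family[OF _ M_H]) (auto simp: Tp)
  from bigO_add[OF this q] have "bigO F dz W" by (simp add: p_def)
  then show ?thesis
    unfolding W_def
    by (rule bigO_absorb_self[OF _ mu_tendsto]) (use mu_nonneg in eventually_elim, simp add: V_nonneg)
qed

text \<open>Test the linear system with \<open>\<Delta>z\<close> itself: the large block contributes \<open>V\<^sup>2 / \<mu>\<close>.\<close>

lemma V_mu: "bigO F V \<mu>"
proof (rule bigO_absorb_quadratic[where k = \<mu>])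
  \<comment> \<open>The linear part pays for pairing the active part of \<open>va\<close> with that
    of \<open>Ek\<close>, which is only \<open>O(1)\<close>; the other terms are quadratic.
    Multiplication by \<mu> gives the weight to be absorbed, with \<open>k = \<mu>\<close>.\<close>
  define W where "W x = (V x + \<mu> x) + (V x + \<mu> x)\<^sup>2" for x
  have nn: "\<forall>\<^sub>F x in F. 0 \<le> V x + \<mu> x" using mu_nonneg by eventually_elim (simp add: V_nonneg)
  have W1: "bigO F V W"
    by (rule bigO_weaken[OF bigO_refl], use mu_nonneg in eventually_elim, simp add: W_def V_nonneg)
  have W2: "bigO F (\<lambda>x. (V x + \<mu> x) * (V x + \<mu> x)) W"
    by (rule bigO_weaken[OF bigO_refl], use mu_nonneg in eventually_elim, simp add: W_def V_nonneg power2_eq_square)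
  have mV: "bigO F \<mu> (\<lambda>x. V x + \<mu> x)"
    by (rule bigO_weaken[OF bigO_refl], use mu_nonneg in eventually_elim, simp add: V_nonneg)
  have "bigO F (\<lambda>x. dz x \<bullet> rhs x) (\<lambda>x. (V x + \<mu> x) * (V x + \<mu> x))"
    by (intro bigO_inner dz_V bigO_trans[OF rhs_mu mV])
  note 1 = bigO_trans[OF this W2]
  have "bigO F (\<lambda>x. dz x \<bullet> (M x *v dz x)) (\<lambda>x. (V x + \<mu> x) * (V x + \<mu> x))"
    by (intro bigO_inner dz_V bigO_matvec1 M_1)
  note 2 = bigO_trans[OF this W2]
  have va': "bigO F va (\<lambda>x. V x + \<mu> x)"
    using bigO_trans[OF va_dz] dz_V by simp
  have "bigO F (\<lambda>x. mask (- B) (va x) \<bullet> mask (- B) (Ek x)) (\<lambda>x. (V x + \<mu> x) * (V x + \<mu> x))"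
    by (intro bigO_inner bigO_mask'[OF va'] bigO_mask bigO_trans[OF Ek_inactive mV]) simp
  note 3 = bigO_trans[OF this W2]
  have "bigO F (\<lambda>x. mask B (va x) \<bullet> mask B (Ek x)) (\<lambda>x. V x * 1)"
    by (intro bigO_inner bigO_mask va_V Ek_active)
  then have 4: "bigO F (\<lambda>x. mask B (va x) \<bullet> mask B (Ek x)) W" using bigO_trans[OF _ W1] by simp
  have ev: "\<forall>\<^sub>F x in F. va x \<bullet> Ev x = dz x \<bullet> rhs x - dz x \<bullet> (M x *v dz x) -
      (mask B (va x) \<bullet> mask B (Ek x) + mask (- B) (va x) \<bullet> mask (- B) (Ek x))"
    using step_inner[of dz]
  proof eventually_elim
    case (elim x)
    then show ?case
      unfolding inner_split_mask[where B=B, symmetric] by (simp add: va_def[symmetric] Ee_eq inner_add_right)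
  qed
  have vE: "bigO F (\<lambda>x. va x \<bullet> Ev x) W"
    by (rule bigO_cong[OF ev]) (intro bigO_diff bigO_add 1 2 3 4)
  \<comment> \<open>All terms of \<open>va x \<bullet> Ev x\<close> are nonnegative, so each is
    bounded by the whole sum, and active entries \<open>E i x\<close> are at least a multiple of
    \<open>1/\<mu>\<close>.\<close>
  have comp: "bigO F (\<lambda>x. (va x $ i)\<^sup>2) (\<lambda>x. \<mu> x * (va x \<bullet> Ev x))" if i: "i \<in> B" for i
  proof -
    obtain c where c: "c > 0" "\<forall>\<^sub>F x in F. c \<le> E i x * \<mu> x" using E_active(2)[OF i] by auto
    have "\<forall>\<^sub>F x in F. \<forall>i. 0 < E i x" using E_pos by (simp add: eventually_all_finite)
    with c(2) mu_pos show ?thesis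
    proof (intro bigOI[where c="1/c"], eventually_elim)
      case (elim x)
      have "va x \<bullet> Ev x = (\<Sum>i\<in>UNIV. E i x * (va x $ i)\<^sup>2)"
        by (simp add: inner_vec_def Ev_def power2_eq_square mult_ac)
      moreover have "E i x * (va x $ i)\<^sup>2 \<le> (\<Sum>i\<in>UNIV. E i x * (va x $ i)\<^sup>2)"
        using elim by (intro member_le_sum) (auto simp: less_imp_le)
      ultimately have le: "E i x * (va x $ i)\<^sup>2 \<le> va x \<bullet> Ev x" by simp
      have "c * (va x $ i)\<^sup>2 \<le> E i x * \<mu> x * (va x $ i)\<^sup>2" using elim by (intro mult_right_mono) auto
      also have "\<dots> \<le> \<mu> x * (va x \<bullet> Ev x)" using mult_left_mono[OF le, of "\<mu> x"] elim by (simp add: mult_ac)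
      finally have "c * (va x $ i)\<^sup>2 \<le> \<bar>\<mu> x * (va x \<bullet> Ev x)\<bar>" by linarith
      with c(1) show ?case by (simp add: pos_le_divide_eq mult.commute)
    qed
  qed
  have "bigO F (\<lambda>x. \<Sum>i\<in>B. (va x $ i)\<^sup>2) (\<lambda>x. \<mu> x * W x)"
    by (intro bigO_sum bigO_trans[OF comp] bigO_mult bigO_refl vE)
  moreover have "(V x)\<^sup>2 = (\<Sum>i\<in>B. (va x $ i)\<^sup>2)" for x
    unfolding V_def power2_norm_eq_inner inner_mask_right by (rule sum.cong) (auto simp: mask_nth power2_eq_square)
  ultimately show "bigO F (\<lambda>x. (V x)\<^sup>2) (\<lambda>x. \<mu> x * (V x + \<mu> x) + \<mu> x * (V x + \<mu> x)\<^sup>2)"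
    by (simp add: W_def distrib_left)
qed (use mu_tendsto mu_nonneg V_nonneg in auto)

lemma dz_mu: "bigO F dz \<mu>"
  by (rule bigO_trans[OF dz_V]) (intro bigO_add V_mu bigO_refl)

lemma va_mu: "bigO F va \<mu>"
  using bigO_trans[OF va_dz] dz_mu by simp

definition "w x = u x + \<mu> x * \<mu> x"
text \<open>The quotient of \<open>w\<close> by \<mu>: the order of the multiplier step and the
  quantity in the upper bound on \<alpha>.\<close>

definition "om x = u x / \<mu> x + \<mu> x"

lemma w_nonneg: "\<forall>\<^sub>F x in F. 0 \<le> w x"
  using u_pos by eventually_elim (simp add: w_def)

lemma u_w: "bigO F v u \<Longrightarrow> bigO F v w"
  by (erule bigO_weaken, use u_pos in eventually_elim) (simp add: w_def)

lemma mu2_w: "bigO F v (\<lambda>x. \<mu> x * \<mu> x) \<Longrightarrow> bigO F v w"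
  by (erule bigO_weaken, use u_pos in eventually_elim) (simp add: w_def)

lemma u_bigO_mu: "bigO F v u \<Longrightarrow> bigO F v \<mu>"
  by (erule bigO_trans) (rule u_mu)

lemma mu_bigO_1: "bigO F v \<mu> \<Longrightarrow> bigO F v (\<lambda>_. 1)"
  by (erule bigO_trans) (rule mu_1)

lemma w_mu: "bigO F w \<mu>"
  unfolding w_def by (intro bigO_add u_mu mu2_mu)

lemma mu_om: "bigO F v \<mu> \<Longrightarrow> bigO F v om"
  by (erule bigO_weaken, use u_pos mu_pos in eventually_elim) (simp add: om_def)

lemma om_mu: "\<forall>\<^sub>F x in F. om x * \<mu> x = w x"
  using mu_pos by eventually_elim (simp add: om_def w_def distrib_right)

lemma om_pos: "\<forall>\<^sub>F x in F. 0 < om x \<and> \<mu> x \<le> om x"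
  using mu_pos u_pos by eventually_elim (simp add: om_def add_pos_pos)

lemma om_tendsto: "(om \<longlongrightarrow> 0) F"
  using tendsto_add[OF u_mu_tendsto mu_tendsto] by (simp add: om_def[abs_def])

lemma om_mu_w: "bigO F v (\<lambda>x. om x * \<mu> x) \<Longrightarrow> bigO F v w"
  by (erule bigO_trans, rule bigO_cong[OF om_mu bigO_refl])

text \<open>The rounding error is u times \<open>E i\<close> times the moduli of the summands, and
  that product is \<open>O(1)\<close> in both blocks: an active \<open>E i = O(1/\<mu>)\<close>
  meets summands \<open>O(\<mu>)\<close>, an inactive \<open>E i = O(\<mu>)\<close> meets bounded
  ones.\<close>

lemma dlam_Ee: "bigO F (\<lambda>x. dlam x - Ee x) u"
proof (rule bigO_vec)
  fix i
  define N where "N x = norm (gc x $ i) + norm (tq x $ i) + norm (Ac x) * norm (dz x)" for x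
  have Adz: "bigO F (\<lambda>x. norm (Ac x) * norm (dz x)) \<mu>"
    using bigO_mult1[of F "\<lambda>x. norm (Ac x)" "\<lambda>x. norm (dz x)" \<mu>] Ac_1 dz_mu by (simp only: bigO_norm_iff)
  have "bigO F (\<lambda>x. E i x * N x) (\<lambda>_. 1)"
  proof (cases "i \<in> B")
    case True
    have "bigO F N \<mu>" unfolding N_def
      by (intro bigO_add Adz) (simp_all only: bigO_norm_iff gc_active[OF True] bigO_nth[OF tq_mu])
    from bigO_trans[OF bigO_mult[OF E_active(1)[OF True] this] inverse_mu_mult] show ?thesis .
  next
    case False
    have "bigO F N (\<lambda>_. 1)" unfolding N_def
      by (intro bigO_add mu_bigO_1[OF Adz]) (simp_all only: bigO_norm_iff bigO_nth[OF gc_1] bigO_nth[OF mu_bigO_1[OF tq_mu]])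
    from bigO_mult1[OF mu_bigO_1[OF E_inactive[OF False]] this] show ?thesis .
  qed
  then have "bigO F (\<lambda>x. u x * (E i x * N x)) u" by (rule bigO_mult1'[OF bigO_refl])
  moreover have "bigO F (\<lambda>x. (dlam x - Ee x) $ i) (\<lambda>x. u x * (E i x * N x))"
  proof (rule bigOI[where c="round_const TYPE('n)"], use step_simplified u_pos E_pos[of i] in eventually_elim)
    case (elim x)
    then have "\<bar>dlam x $ i - Ee x $ i\<bar> \<le> round_const TYPE('n) * (u x * (\<bar>E i x\<bar> * N x))"
      by (simp only: N_def real_norm_def)
    moreover have "0 \<le> N x" by (simp add: N_def)
    ultimately show ?case using elim(2,3) by (simp add: abs_mult)
  qed
  ultimately show "bigO F (\<lambda>x. (dlam x - Ee x) $ i) u" by (rule bigO_trans[rotated])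
qed

lemma ds_raw: "bigO F (\<lambda>x. ds x + (gc x + s x) + va x) u"
proof (rule bigO_vec)
  fix i
  define N where "N x = norm (gc x $ i + s x $ i) + norm (Ac x) * norm (dz x)" for x
  have Adz: "bigO F (\<lambda>x. norm (Ac x) * norm (dz x)) (\<lambda>_. 1)"
    using bigO_mult1[of F "\<lambda>x. norm (Ac x)" "\<lambda>x. norm (dz x)" "\<lambda>_. 1"] Ac_1 mu_bigO_1[OF dz_mu] by (simp only: bigO_norm_iff)
  have "bigO F (\<lambda>x. gc x $ i + s x $ i) (\<lambda>_. 1)" by (rule bigO_add[OF bigO_nth[OF gc_1] bigO_nth[OF s_1]])
  then have "bigO F N (\<lambda>_. 1)" unfolding N_def
    by (intro bigO_add Adz) (simp only: bigO_norm_iff)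
  then have "bigO F (\<lambda>x. u x * N x) u" by (rule bigO_mult1'[OF bigO_refl])
  moreover have "bigO F (\<lambda>x. (ds x + (gc x + s x) + va x) $ i) (\<lambda>x. u x * N x)"
  proof (rule bigOI[where c="round_const TYPE('n)"], use step_simplified u_pos in eventually_elim)
    case (elim x)
    then have "\<bar>ds x $ i + (gc x $ i + s x $ i) + va x $ i\<bar> \<le> round_const TYPE('n) * (u x * N x)"
      by (simp only: N_def real_norm_def)
    moreover have "0 \<le> N x" by (simp add: N_def)
    ultimately show ?case using elim(2) by (simp add: abs_mult)
  qed
  ultimately show "bigO F (\<lambda>x. (ds x + (gc x + s x) + va x) $ i) u" by (rule bigO_trans[rotated])
qed

lemma Ee_nth: "bigO F (\<lambda>x. e x $ i) v \<Longrightarrow> bigO F (E i) v' \<Longrightarrow> bigO F (\<lambda>x. Ee x $ i) (\<lambda>x. v' x * v x)"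
  unfolding Ee_def by (simp add: bigO_mult)

lemma e_active: "i \<in> B \<Longrightarrow> bigO F (\<lambda>x. e x $ i) \<mu>"
  using bigO_add[OF gt_active[of i] bigO_nth[OF va_mu, of i]] by (simp add: e_def)

lemma e_1: "bigO F e (\<lambda>_. 1)"
  unfolding e_def by (intro bigO_add gt_1 mu_bigO_1[OF va_mu])

lemma dlam_inactive: "i \<notin> B \<Longrightarrow> bigO F (\<lambda>x. dlam x $ i) \<mu>"
  using bigO_add[OF bigO_nth[OF u_bigO_mu[OF dlam_Ee], of i], of "\<lambda>x. Ee x $ i"]
    Ee_nth[OF bigO_nth[OF e_1] E_inactive] by simp

text \<open>A preliminary bound, enough to make the error \<open>Fe x *v dlam x\<close> in the
  stationarity row \<open>O(u)\<close>. That row is then used to sharpen it in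
  \<open>dlam_om\<close>.\<close>

lemma dlam_1: "bigO F dlam (\<lambda>_. 1)"
proof (rule bigO_vec)
  fix i
  show "bigO F (\<lambda>x. dlam x $ i) (\<lambda>_. 1)"
  proof (cases "i \<in> B")
    case True
    have "bigO F (\<lambda>x. Ee x $ i) (\<lambda>_. 1)"
      by (rule bigO_trans[OF Ee_nth[OF e_active[OF True] E_active(1)[OF True]] inverse_mu_mult])
    from bigO_add[OF bigO_nth[OF mu_bigO_1[OF u_bigO_mu[OF dlam_Ee]], of i] this] show ?thesis by simp
  next
    case False
    then show ?thesis by (intro mu_bigO_1 dlam_inactive)
  qed
qed

lemma mask_dlam_inactive: "bigO F (\<lambda>x. mask (- B) (dlam x)) \<mu>"
  by (rule bigO_mask) (simp add: dlam_inactive)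

lemma Hz_1: "bigO F Hz (\<lambda>_. 1)"
  using bigO_add[OF bigO_trans[OF lagr_zz_bigO[OF tendsto_const z_tendsto lam_1]] H_1] y_1
  by (simp add: bigO_norm_iff)

text \<open>The Newton equation with exact data. The solver error \<open>Fh\<close> of order
  \<open>u/\<mu>\<close> is harmless because it multiplies \<open>dz = O(\<mu>)\<close>.\<close>

lemma stationarity_step: "bigO F (\<lambda>x. L x + Hz x *v dz x + J (z x) *v dlam x) u"
proof (rule bigO_cong)
  show "\<forall>\<^sub>F x in F. L x + Hz x *v dz x + J (z x) *v dlam x =
     Ac x *v (dlam x - Ee x) - Fb x *v dz x - Fh x *v dz x - Fe x *v dlam x - fb x + fh x"
    using step_simplified
  proof eventually_elim
    case (elim x)
    then have "M x *v dz x + Ac x *v Ee x = rhs x" by blast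
    then have "Ac x *v Ee x = - (L x + fb x) + fh x - (Hz x *v dz x + Fb x *v dz x + Fh x *v dz x)"
      by (simp add: rhs_def M_def matrix_vector_mult_add_rdistrib eq_diff_eq add.commute)
    moreover have "Ac x *v (dlam x - Ee x) = J (z x) *v dlam x + Fe x *v dlam x - Ac x *v Ee x"
      by (simp only: matrix_vector_mult_diff_distrib matrix_vector_mult_add_rdistrib)
    ultimately show ?case by simp
  qed
  have "bigO F (\<lambda>x. Fh x *v dz x) (\<lambda>x. u x / \<mu> x * \<mu> x)" by (intro bigO_matvec Fh_u dz_mu)
  then have "bigO F (\<lambda>x. Fh x *v dz x) u"
    by (rule bigO_trans, intro bigO_cong[OF _ bigO_refl], use mu_pos in eventually_elim) simp
  note 1 = this
  have 2: "bigO F (\<lambda>x. Fb x *v dz x) u" using bigO_matvec[OF Fb_u mu_bigO_1[OF dz_mu]] by simp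
  have 3: "bigO F (\<lambda>x. Fe x *v dlam x) u" using bigO_matvec[OF Fe_u dlam_1] by simp
  show "bigO F (\<lambda>x. Ac x *v (dlam x - Ee x) - Fb x *v dz x - Fh x *v dz x - Fe x *v dlam x - fb x + fh x) u"
    by (intro bigO_add[OF bigO_diff[OF bigO_diff[OF bigO_diff[OF bigO_diff]]]] 1 2 3 fb_u fh_u bigO_matvec1[OF Ac_1 dlam_Ee])
qed

lemma slack_step: "bigO F (\<lambda>x. ds x + (g (z x) + s x) + transpose (J (z x)) *v dz x) u"
proof -
  have "bigO F (\<lambda>x. transpose (Fe x) *v dz x) (\<lambda>x. u x * 1)"
    by (intro bigO_matvec mu_bigO_1[OF dz_mu]) (simp add: Fe_u)
  then have "bigO F (\<lambda>x. ds x + (gc x + s x) + va x - fe x - transpose (Fe x) *v dz x) u"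
    by (intro bigO_diff ds_raw fe_u) simp
  moreover have "transpose (Ac x) = transpose (J (z x)) + transpose (Fe x)" for x
    by (simp add: transpose_def vec_eq_iff)
  ultimately show ?thesis
    by (simp add: va_def matrix_vector_mult_add_rdistrib algebra_simps)
qed

lemma ds_mu: "bigO F ds \<mu>"
proof -
  have "bigO F (\<lambda>x. transpose (J (z x)) *v dz x) \<mu>" by (intro bigO_matvec1 dz_mu) (simp add: J_1)
  from bigO_diff[OF bigO_diff[OF u_bigO_mu[OF slack_step] r_g_mu] this] show ?thesis by simp
qed

text \<open>Adding \<lambda> times the slack row and s times the multiplier row cancels
  \<open>e\<close> up to the factor \<open>s * E - lam = O(u)\<close>; the term left over is
  \<open>t = O(\<mu>\<^sup>2)\<close>.\<close>

lemma complementarity_step: "bigO F (\<lambda>x. lam x $ i * ds x $ i + s x $ i * dlam x $ i + lam x $ i * s x $ i) w"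
proof (rule bigO_cong)
  show "\<forall>\<^sub>F x in F. lam x $ i * ds x $ i + s x $ i * dlam x $ i + lam x $ i * s x $ i =
     lam x $ i * (ds x + (gc x + s x) + va x) $ i + s x $ i * (dlam x - Ee x) $ i +
     (s x $ i * E i x - lam x $ i) * e x $ i - t x $ i"
    using positive[of i]
    by eventually_elim (simp add: Ee_def e_def tq_def algebra_simps)
  show "bigO F (\<lambda>x. lam x $ i * (ds x + (gc x + s x) + va x) $ i + s x $ i * (dlam x - Ee x) $ i +
     (s x $ i * E i x - lam x $ i) * e x $ i - t x $ i) w"
    by (intro bigO_add bigO_diff bigO_mult1 u_w[OF bigO_nth[OF ds_raw]] bigO_nth[OF lam_1] bigO_nth[OF s_1]
        u_w[OF bigO_nth[OF dlam_Ee]] u_w[OF bigO_mult1'[OF s_E bigO_nth[OF e_1]]] mu2_w[OF bigO_nth[OF t_mu2]])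
qed

text \<open>\<open>\<Theta>\<close> is orthogonal to the kernel component \<open>\<Delta>\<lambda> - b\<close>, so only errors of size
  \<open>w\<close> remain when \<open>D\<^sub>B \<Delta>\<lambda>\<^sub>B\<close> is paired with \<open>\<Delta>\<lambda>\<^sub>B\<close>.\<close>

lemma dlam_om: "bigO F dlam om"
proof -
  define b where "b x = R' (T' (dlam x))" for x
  define \<Theta> where "\<Theta> x = transpose A *v (y x + dz x)" for x
  define X where "X x = norm (mask B (dlam x))" for x
  define r where "r i x = dv i x * dlam x $ i - \<Theta> x $ i" for i x
  define W where "W x = \<mu> x * (om x * (X x + om x))" for x
  have X0: "0 \<le> X x" for x by (simp add: X_def)
  have Xn: "bigO F (\<lambda>x. dlam x $ i) X" if "i \<in> B" for i
  proof (rule bigOI[where c=1], rule always_eventually, rule allI)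
    fix x show "norm (dlam x $ i) \<le> 1 * \<bar>X x\<bar>"
      using component_le_norm_cart[of "mask B (dlam x)" i] that by (simp add: X_def mask_nth)
  qed
  have Hdz: "bigO F (\<lambda>x. Hz x *v dz x) \<mu>" by (intro bigO_matvec1 Hz_1 dz_mu)
  \<comment> \<open>All other terms of the stationarity row are \<open>O(\<mu>)\<close>, so only the
    component of the active multiplier step in the kernel of \<open>T'\<close> can be
    larger.\<close>
  have Jdlam: "bigO F (\<lambda>x. J (z x) *v dlam x) \<mu>"
    using bigO_diff[OF bigO_diff[OF u_bigO_mu[OF stationarity_step] r_f_mu] Hdz] by simp
  have "bigO F (\<lambda>x. (J (z x) - A) *v dlam x) \<mu>" using bigO_matvec[OF J_A dlam_1] by simp
  moreover have "bigO F (\<lambda>x. A *v mask (- B) (dlam x)) \<mu>"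
    by (intro bigO_matvec1 bigO_const mask_dlam_inactive)
  ultimately have "bigO F (\<lambda>x. J (z x) *v dlam x - (J (z x) - A) *v dlam x - A *v mask (- B) (dlam x)) \<mu>"
    using Jdlam by (intro bigO_diff)
  moreover have "T' (dlam x) = J (z x) *v dlam x - (J (z x) - A) *v dlam x - A *v mask (- B) (dlam x)" for x
  proof -
    have "mask B (dlam x) = dlam x - mask (- B) (dlam x)" by (auto simp: vec_eq_iff mask_nth)
    then show ?thesis by (simp add: T'_def matrix_vector_mult_diff_distrib matrix_vector_mult_diff_rdistrib)
  qed
  ultimately have "bigO F (\<lambda>x. T' (dlam x)) \<mu>" by simp
  then have b: "bigO F b \<mu>" unfolding b_def by (rule bigO_linear[OF R'(1)])
  \<comment> \<open>By definition \<open>dv i x * Ee x $ i = e x $ i\<close>. On the active set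
    \<open>g zs\<close> vanishes, so expanding \<open>gc\<close> and \<open>va\<close> at
    \<open>zs\<close> turns \<open>e\<close> into \<open>\<Theta>\<close> up to
    \<open>O(w)\<close>.\<close>
  have r: "bigO F (r i) w" if i: "i \<in> B" for i
  proof (rule bigO_cong)
    show "\<forall>\<^sub>F x in F. r i x = dv i x * (dlam x - Ee x) $ i + (g (z x) - g zs - transpose A *v y x) $ i
        + fe x $ i - tq x $ i + (va x - transpose A *v dz x) $ i"
      using dv_pos[of i]
    proof eventually_elim
      case (elim x)
      have "g zs $ i = 0" using i by (simp add: active_def)
      moreover have "dv i x * Ee x $ i = e x $ i" using elim by (simp add: Ee_def E_def)
      moreover have "\<Theta> x $ i = (transpose A *v y x) $ i + (transpose A *v dz x) $ i"
        by (simp only: \<Theta>_def matrix_vector_right_distrib vector_add_component)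
      ultimately show ?case by (simp add: r_def e_def right_diff_distrib)
    qed
    have 1: "bigO F (\<lambda>x. dv i x * (dlam x - Ee x) $ i) w"
      by (intro bigO_mult1 u_w[OF bigO_nth[OF dlam_Ee]] mu_bigO_1[OF dv_active(1)[OF i]])
    have "bigO F (\<lambda>x. norm (y x) * norm (y x)) (\<lambda>x. \<mu> x * \<mu> x)" by (intro bigO_mult) (simp_all only: bigO_norm_iff y_mu)
    then have 2: "bigO F (\<lambda>x. g (z x) - g zs - transpose A *v y x) w"
      using mu2_w[OF bigO_trans[OF g_bigO[OF tendsto_const z_tendsto]]] by (simp only: power2_eq_square)
    have "bigO F (\<lambda>x. \<mu> x * norm (dz x)) (\<lambda>x. \<mu> x * \<mu> x)" by (intro bigO_mult bigO_refl) (simp only: bigO_norm_iff dz_mu)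
    then have 3: "bigO F (\<lambda>x. va x - transpose A *v dz x) w"
      unfolding va_def by (intro mu2_w[OF bigO_trans[OF AcT_diff]])
    show "bigO F (\<lambda>x. dv i x * (dlam x - Ee x) $ i + (g (z x) - g zs - transpose A *v y x) $ i
        + fe x $ i - tq x $ i + (va x - transpose A *v dz x) $ i) w"
      by (intro bigO_add bigO_diff 1 bigO_nth[OF 2] bigO_nth[OF 3] bigO_nth[OF u_w[OF fe_u]] mu2_w[OF tq_active[OF i]])
  qed
  have id: "(\<Sum>i\<in>B. dv i x * (dlam x $ i)\<^sup>2) =
      (\<Sum>i\<in>B. r i x * (dlam x $ i - b x $ i)) + (\<Sum>i\<in>B. dv i x * dlam x $ i * b x $ i)" for x
  proof -
    have "(\<Sum>i\<in>B. \<Theta> x $ i * (dlam x - b x) $ i) = \<Theta> x \<bullet> mask B (dlam x - b x)" by (simp add: inner_mask_right)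
    also have "\<dots> = (y x + dz x) \<bullet> T' (dlam x - b x)" unfolding \<Theta>_def T'_def by (rule inner_matvec[symmetric])
    also have "\<dots> = 0" unfolding b_def by (simp add: R'(2))
    finally have z: "(\<Sum>i\<in>B. \<Theta> x $ i * (dlam x $ i - b x $ i)) = 0" by simp
    have "(\<Sum>i\<in>B. dv i x * (dlam x $ i)\<^sup>2) = (\<Sum>i\<in>B. r i x * (dlam x $ i - b x $ i) + \<Theta> x $ i * (dlam x $ i - b x $ i)
      + dv i x * dlam x $ i * b x $ i)"
      by (rule sum.cong) (simp_all add: r_def power2_eq_square algebra_simps)
    then show ?thesis using z by (simp add: sum.distrib)
  qed
  have SW: "bigO F (\<lambda>x. \<Sum>i\<in>B. dv i x * (dlam x $ i)\<^sup>2) W"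
    unfolding id
  proof (intro bigO_add bigO_sum)
    fix i assume i: "i \<in> B"
    have "bigO F (\<lambda>x. r i x * (dlam x $ i - b x $ i)) (\<lambda>x. w x * (X x + \<mu> x))"
      by (intro bigO_mult r[OF i] bigO_diff bigO_weight_add(1)[OF Xn[OF i]] bigO_weight_add(2)[OF bigO_nth[OF b]])
        (simp_all add: X0 mu_nonneg)
    then show "bigO F (\<lambda>x. r i x * (dlam x $ i - b x $ i)) W"
    proof (rule bigO_weaken, use om_mu om_pos w_nonneg mu_pos in eventually_elim)
      case (elim x)
      have "w x * (X x + \<mu> x) \<le> w x * (X x + om x)" using elim by (intro mult_left_mono) auto
      also have "\<dots> = W x" unfolding W_def elim(1)[symmetric] by simp
      finally show ?case using elim X0[of x] by simp
    qed
    have "bigO F (\<lambda>x. dv i x * dlam x $ i * b x $ i) (\<lambda>x. \<mu> x * X x * \<mu> x)"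
      by (intro bigO_mult dv_active[OF i] Xn[OF i] bigO_nth[OF b])
    then show "bigO F (\<lambda>x. dv i x * dlam x $ i * b x $ i) W"
    proof (rule bigO_weaken, use om_mu om_pos w_nonneg mu_pos in eventually_elim)
      case (elim x)
      have "\<mu> x * (\<mu> x * X x) \<le> \<mu> x * (om x * (X x + om x))"
        using elim X0[of x] by (intro mult_left_mono mult_mono) auto
      then show ?case using elim X0[of x] by (simp add: W_def mult_ac)
    qed
  qed
  have comp: "bigO F (\<lambda>x. (dlam x $ i)\<^sup>2) (\<lambda>x. inverse (\<mu> x) * (\<Sum>i\<in>B. dv i x * (dlam x $ i)\<^sup>2))" if i: "i \<in> B" for i
  proof -
    obtain c where c: "c > 0" "\<forall>\<^sub>F x in F. c * \<mu> x \<le> dv i x" using dv_active(2)[OF i] by auto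
    have ev: "\<forall>\<^sub>F x in F. \<forall>i. 0 < dv i x" using dv_pos by (simp add: eventually_all_finite)
    show ?thesis
    proof (rule bigOI[where c="1/c"], use c(2) mu_pos ev in eventually_elim)
      case (elim x)
      define S where "S = (\<Sum>i\<in>B. dv i x * (dlam x $ i)\<^sup>2)"
      have "c * \<mu> x * (dlam x $ i)\<^sup>2 \<le> dv i x * (dlam x $ i)\<^sup>2" using elim by (intro mult_right_mono) auto
      also have "\<dots> \<le> S" unfolding S_def using elim i by (intro member_le_sum) (auto simp: less_imp_le)
      finally have le: "c * \<mu> x * (dlam x $ i)\<^sup>2 \<le> S" .
      have "0 \<le> c * \<mu> x * (dlam x $ i)\<^sup>2" using c(1) elim(2) by simp
      with le have "0 \<le> S" by linarith
      moreover have "(dlam x $ i)\<^sup>2 \<le> S / (c * \<mu> x)"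
        using c(1) elim(2) le by (simp add: pos_le_divide_eq mult_ac)
      ultimately show ?case using elim(2) unfolding S_def[symmetric] by (simp add: abs_mult divide_inverse mult_ac)
    qed
  qed
  have "bigO F (\<lambda>x. \<Sum>i\<in>B. (dlam x $ i)\<^sup>2) (\<lambda>x. inverse (\<mu> x) * W x)"
    by (intro bigO_sum bigO_trans[OF comp] bigO_mult bigO_refl SW)
  then have "bigO F (\<lambda>x. \<Sum>i\<in>B. (dlam x $ i)\<^sup>2) (\<lambda>x. om x * (X x + om x))"
    unfolding W_def by (rule inverse_mu_cancel)
  moreover have "(X x)\<^sup>2 = (\<Sum>i\<in>B. (dlam x $ i)\<^sup>2)" for x
    unfolding X_def power2_norm_eq_inner inner_mask_right by (rule sum.cong) (auto simp: mask_nth power2_eq_square)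
  ultimately have "bigO F (\<lambda>x. (X x)\<^sup>2) (\<lambda>x. om x * (X x + om x) + 0 * (X x + om x)\<^sup>2)" by simp
  then have "bigO F X om"
    by (rule bigO_absorb_quadratic) (use om_pos X0 in \<open>auto elim: eventually_mono\<close>)
  then have "bigO F (\<lambda>x. mask B (dlam x)) om" by (simp add: X_def[abs_def])
  from bigO_add[OF this mu_om[OF mask_dlam_inactive]]
  show ?thesis by (rule bigO_eq) (auto simp: vec_eq_iff mask_nth)
qed

end

section \<open>Damped steps\<close>

locale damped_step_family = step_family \<phi> g zs F z lam s C \<gamma> K u t dz dlam ds Fb fb Fe fe G Fh fh
  for \<phi> :: "real^'n \<Rightarrow> real" and g :: "real^'n \<Rightarrow> real^'m" and zs :: "real^'n"
    and F :: "'a filter" and z :: "'a \<Rightarrow> real^'n" and lam s :: "'a \<Rightarrow> real^'m" and C \<gamma> :: real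
    and K :: real and u :: "'a \<Rightarrow> real" and t :: "'a \<Rightarrow> real^'m"
    and dz :: "'a \<Rightarrow> real^'n" and dlam ds :: "'a \<Rightarrow> real^'m"
    and Fb :: "'a \<Rightarrow> real^'n^'n" and fb :: "'a \<Rightarrow> real^'n" and Fe :: "'a \<Rightarrow> real^'m^'n"
    and fe :: "'a \<Rightarrow> real^'m" and G :: "'a \<Rightarrow> real^'m^'m" and Fh :: "'a \<Rightarrow> real^'n^'n"
    and fh :: "'a \<Rightarrow> real^'n" +
  fixes \<alpha> \<tau> :: "'a \<Rightarrow> real"
  assumes alpha: "\<forall>\<^sub>F x in F. 0 \<le> \<alpha> x \<and> \<alpha> x \<le> 1"
    and tau: "\<forall>\<^sub>F x in F. 0 < \<tau> x \<and> \<tau> x \<le> 1/2"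
    and C_pos: "0 < C"
begin

abbreviation "zn x \<equiv> z x + \<alpha> x *\<^sub>R dz x"
abbreviation "lamn x \<equiv> lam x + \<alpha> x *\<^sub>R dlam x"
abbreviation "sn x \<equiv> s x + \<alpha> x *\<^sub>R ds x"
abbreviation "\<mu>n x \<equiv> mu (lamn x) (sn x)"

lemma alpha_1: "bigO F \<alpha> (\<lambda>_. 1)"
  by (rule bigOI[where c=1], use alpha in eventually_elim) simp

lemma adz_mu: "bigO F (\<lambda>x. \<alpha> x *\<^sub>R dz x) \<mu>"
  by (rule bigO_scaleR1[OF alpha_1 dz_mu])

lemma adlam_om: "bigO F (\<lambda>x. \<alpha> x *\<^sub>R dlam x) om"
  by (rule bigO_scaleR1[OF alpha_1 dlam_om])

lemma ads_mu: "bigO F (\<lambda>x. \<alpha> x *\<^sub>R ds x) \<mu>"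
  by (rule bigO_scaleR1[OF alpha_1 ds_mu])

lemma zn_tendsto: "(zn \<longlongrightarrow> zs) F"
  using tendsto_add[OF z_tendsto bigO_tendsto_0[OF adz_mu mu_tendsto]] by simp

lemma adz2_w: "bigO F (\<lambda>x. (norm (zn x - z x))\<^sup>2) w"
proof -
  have "bigO F (\<lambda>x. norm (zn x - z x) * norm (zn x - z x)) (\<lambda>x. \<mu> x * \<mu> x)"
    by (intro bigO_mult) (simp_all only: bigO_norm_iff add_diff_cancel_left' adz_mu)
  then show ?thesis by (simp only: power2_eq_square mu2_w)
qed

text \<open>The Newton row removes the fraction \<alpha> of the old residual. The cross term, a
  change of \<open>J\<close> by \<open>O(\<mu>)\<close> times \<open>dlam = O(om)\<close>, is
  \<open>O(w)\<close> thanks to \<open>dlam_om\<close>; the product of \<open>dlam\<close> and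
  \<open>ds\<close> in \<open>product_new\<close> is handled in the same way.\<close>

lemma r_f_new: "bigO F (\<lambda>x. lagr_z \<phi> g (zn x) (lamn x) - (1 - \<alpha> x) *\<^sub>R L x) w"
proof -
  have 1: "bigO F (\<lambda>x. lagr_z \<phi> g (zn x) (lam x) - L x - Hz x *v (zn x - z x)) w"
    by (rule bigO_trans[OF lagr_z_bigO[OF z_tendsto zn_tendsto lam_1] adz2_w])
  have "bigO F (\<lambda>x. J (zn x) - J (z x)) \<mu>"
    by (rule bigO_trans[OF J_bigO[OF z_tendsto zn_tendsto]]) (simp only: bigO_norm_iff add_diff_cancel_left' adz_mu)
  from om_mu_w[OF bigO_trans[OF bigO_matvec[OF this adlam_om]]]
  have 2: "bigO F (\<lambda>x. (J (zn x) - J (z x)) *v (\<alpha> x *\<^sub>R dlam x)) w" by (simp add: mult.commute)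
  have 3: "bigO F (\<lambda>x. \<alpha> x *\<^sub>R (L x + Hz x *v dz x + J (z x) *v dlam x)) w"
    by (rule bigO_scaleR1[OF alpha_1 u_w[OF stationarity_step]])
  show ?thesis
  proof (rule bigO_eq[OF bigO_add[OF bigO_add[OF 1 2] 3]])
    fix x
    have "lagr_z \<phi> g (zn x) (lamn x) = lagr_z \<phi> g (zn x) (lam x) + J (zn x) *v (\<alpha> x *\<^sub>R dlam x)"
      by (simp add: lagr_z_eq matrix_vector_right_distrib)
    then show "lagr_z \<phi> g (zn x) (lamn x) - (1 - \<alpha> x) *\<^sub>R L x =
         lagr_z \<phi> g (zn x) (lam x) - L x - Hz x *v (zn x - z x) +
         (J (zn x) - J (z x)) *v (\<alpha> x *\<^sub>R dlam x) +
         \<alpha> x *\<^sub>R (L x + Hz x *v dz x + J (z x) *v dlam x)"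
      by (simp add: matrix_vector_mult_diff_rdistrib matrix_vector_mult_scaleR scaleR_diff_left scaleR_diff_right scaleR_add_right)
  qed
qed

lemma r_g_new: "bigO F (\<lambda>x. g (zn x) + sn x - (1 - \<alpha> x) *\<^sub>R (g (z x) + s x)) w"
proof -
  have 1: "bigO F (\<lambda>x. g (zn x) - g (z x) - transpose (J (z x)) *v (zn x - z x)) w"
    by (rule bigO_trans[OF g_bigO[OF z_tendsto zn_tendsto] adz2_w])
  have 3: "bigO F (\<lambda>x. \<alpha> x *\<^sub>R (ds x + (g (z x) + s x) + transpose (J (z x)) *v dz x)) w"
    by (rule bigO_scaleR1[OF alpha_1 u_w[OF slack_step]])
  show ?thesis
    by (rule bigO_eq[OF bigO_add[OF 1 3]])
      (simp add: matrix_vector_mult_scaleR scaleR_diff_left scaleR_add_right)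
qed

lemma product_new: "bigO F (\<lambda>x. lamn x $ i * sn x $ i - (1 - \<alpha> x) * (lam x $ i * s x $ i)) w"
proof -
  have 1: "bigO F (\<lambda>x. \<alpha> x * (lam x $ i * ds x $ i + s x $ i * dlam x $ i + lam x $ i * s x $ i)) w"
    by (rule bigO_mult1[OF alpha_1 complementarity_step])
  have 2: "bigO F (\<lambda>x. (\<alpha> x *\<^sub>R dlam x) $ i * (\<alpha> x *\<^sub>R ds x) $ i) w"
    by (intro om_mu_w bigO_mult bigO_nth[OF adlam_om] bigO_nth[OF ads_mu])
  show ?thesis
    by (rule bigO_eq[OF bigO_add[OF 1 2]]) (simp add: algebra_simps)
qed

lemma mu_new: "bigO F (\<lambda>x. \<mu>n x - (1 - \<alpha> x) * \<mu> x) w"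
proof -
  have "bigO F (\<lambda>x. (1 / CARD('m)) * (\<Sum>i\<in>UNIV. lamn x $ i * sn x $ i - (1 - \<alpha> x) * (lam x $ i * s x $ i))) w"
    by (intro bigO_mult1 bigO_const bigO_sum product_new)
  then show ?thesis
    by (rule bigO_eq) (simp add: mu_def inner_vec_def sum_subtractf sum_distrib_left[symmetric] diff_divide_distrib)
qed

lemma mu_new_tendsto: "(\<mu>n \<longlongrightarrow> 0) F"
proof -
  have "bigO F (\<lambda>x. (1 - \<alpha> x) * \<mu> x) \<mu>"
    by (intro bigO_mult1 bigO_diff bigO_const alpha_1 bigO_refl)
  from bigO_add[OF bigO_trans[OF mu_new w_mu] this] have "bigO F \<mu>n \<mu>" by simp
  then show ?thesis by (rule bigO_tendsto_0[OF _ mu_tendsto])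
qed

lemma dist_new_tendsto: "((\<lambda>x. dist_sol \<phi> g zs (zn x) (lamn x)) \<longlongrightarrow> 0) F"
proof (rule Lim_null_comparison)
  have "((\<lambda>x. dist_sol \<phi> g zs (z x) (lam x) + (norm (\<alpha> x *\<^sub>R dz x) + norm (\<alpha> x *\<^sub>R dlam x))) \<longlongrightarrow> 0 + (norm (0 :: real^'n) + norm (0 :: real^'m))) F"
    by (intro tendsto_add tendsto_norm dist_tendsto bigO_tendsto_0[OF adz_mu mu_tendsto] bigO_tendsto_0[OF adlam_om om_tendsto])
  then show "((\<lambda>x. dist_sol \<phi> g zs (z x) (lam x) + (norm (\<alpha> x *\<^sub>R dz x) + norm (\<alpha> x *\<^sub>R dlam x))) \<longlongrightarrow> 0) F" by simp
  have "norm (dist_sol \<phi> g zs (zn x) (lamn x)) \<le> dist_sol \<phi> g zs (z x) (lam x) + (norm (\<alpha> x *\<^sub>R dz x) + norm (\<alpha> x *\<^sub>R dlam x))" for x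
  proof -
    have "dist_sol \<phi> g zs (zn x) (lamn x) \<le> dist_sol \<phi> g zs (z x) (lam x) + dist (zn x, lamn x) (z x, lam x)"
      unfolding dist_sol_def by (rule infdist_triangle)
    also have "dist (zn x, lamn x) (z x, lam x) \<le> dist (zn x) (z x) + dist (lamn x) (lam x)"
      unfolding dist_prod_def by (simp add: sqrt_sum_squares_le_sum)
    finally show ?thesis by (simp add: dist_norm dist_sol_def infdist_nonneg)
  qed
  then show "\<forall>\<^sub>F x in F. norm (dist_sol \<phi> g zs (zn x) (lamn x)) \<le> dist_sol \<phi> g zs (z x) (lam x) + (norm (\<alpha> x *\<^sub>R dz x) + norm (\<alpha> x *\<^sub>R dlam x))"
    by simp
qed

text \<open>The relaxed product bound will make each new product positive, so positivity of one
  factor suffices. It is taken from the factor that is bounded away from 0.\<close>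

lemma positive_component_new: "\<forall>\<^sub>F x in F. 0 < lamn x $ i \<or> 0 < sn x $ i"
proof (cases "i \<in> B")
  case True
  obtain c where c: "c > 0" "\<forall>\<^sub>F x in F. c \<le> lam x $ i" by (rule lam_active[OF True])
  have "\<forall>\<^sub>F x in F. norm (\<alpha> x *\<^sub>R dlam x) \<le> c / 2"
    using bigO_tendsto_0[OF adlam_om om_tendsto] by (rule tendsto_0_bound) (use c(1) in simp)
  with c(2) show ?thesis
  proof eventually_elim
    case (elim x)
    have "\<bar>(\<alpha> x *\<^sub>R dlam x) $ i\<bar> \<le> c / 2" using component_le_norm_cart elim(2) by (rule order.trans)
    then have "0 < lam x $ i + (\<alpha> x *\<^sub>R dlam x) $ i" using elim(1) c(1) by linarith
    then show ?case by simp
  qed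
next
  case False
  obtain c where c: "c > 0" "\<forall>\<^sub>F x in F. c \<le> s x $ i" by (rule s_inactive[OF False])
  have "\<forall>\<^sub>F x in F. norm (\<alpha> x *\<^sub>R ds x) \<le> c / 2"
    using bigO_tendsto_0[OF ads_mu mu_tendsto] by (rule tendsto_0_bound) (use c(1) in simp)
  with c(2) show ?thesis
  proof eventually_elim
    case (elim x)
    have "\<bar>(\<alpha> x *\<^sub>R ds x) $ i\<bar> \<le> c / 2" using component_le_norm_cart elim(2) by (rule order.trans)
    then have "0 < s x $ i + (\<alpha> x *\<^sub>R ds x) $ i" using elim(1) c(1) by linarith
    then show ?case by simp
  qed
qed

lemma common_bound:
  obtains c where "c > 0"
    "\<forall>\<^sub>F x in F. norm (lagr_z \<phi> g (zn x) (lamn x) - (1 - \<alpha> x) *\<^sub>R L x) \<le> c * w x"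
    "\<forall>\<^sub>F x in F. norm (g (zn x) + sn x - (1 - \<alpha> x) *\<^sub>R (g (z x) + s x)) \<le> c * w x"
    "\<forall>\<^sub>F x in F. \<forall>i. \<bar>lamn x $ i * sn x $ i - (1 - \<alpha> x) * (lam x $ i * s x $ i)\<bar> \<le> c * w x"
    "\<forall>\<^sub>F x in F. \<bar>\<mu>n x - (1 - \<alpha> x) * \<mu> x\<bar> \<le> c * w x"
proof -
  \<comment> \<open>Stated for all larger constants at once, so that the four bounds can share their
    sum as constant.\<close>
  have w: "\<exists>c>0. \<forall>\<^sub>F x in F. \<forall>d\<ge>c. norm (v x) \<le> d * w x" if v: "bigO F v w" for v :: "'a \<Rightarrow> 'b::real_normed_vector"
  proof -
    obtain c where c: "c > 0" "\<forall>\<^sub>F x in F. norm (v x) \<le> c * \<bar>w x\<bar>" using bigOE[OF v] by auto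
    have "\<forall>\<^sub>F x in F. \<forall>d\<ge>c. norm (v x) \<le> d * w x"
      using c(2) w_nonneg
    proof eventually_elim
      case (elim x)
      then show ?case using mult_right_mono[of c _ "w x"] by fastforce
    qed
    with c(1) show ?thesis by blast
  qed
  define P where "P x = (\<chi> i. lamn x $ i * sn x $ i - (1 - \<alpha> x) * (lam x $ i * s x $ i))" for x
  have P: "bigO F P w" by (rule bigO_vec) (use product_new in \<open>simp add: P_def\<close>)
  obtain c1 where c1: "c1 > 0" "\<forall>\<^sub>F x in F. \<forall>d\<ge>c1. norm (lagr_z \<phi> g (zn x) (lamn x) - (1 - \<alpha> x) *\<^sub>R L x) \<le> d * w x"
    using w[OF r_f_new] by blast
  obtain c2 where c2: "c2 > 0" "\<forall>\<^sub>F x in F. \<forall>d\<ge>c2. norm (g (zn x) + sn x - (1 - \<alpha> x) *\<^sub>R (g (z x) + s x)) \<le> d * w x"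
    using w[OF r_g_new] by blast
  obtain c3 where c3: "c3 > 0" "\<forall>\<^sub>F x in F. \<forall>d\<ge>c3. norm (P x) \<le> d * w x"
    using w[OF P] by blast
  obtain c4 where c4: "c4 > 0" "\<forall>\<^sub>F x in F. \<forall>d\<ge>c4. norm (\<mu>n x - (1 - \<alpha> x) * \<mu> x) \<le> d * w x"
    using w[OF mu_new] by blast
  define c where "c = c1 + c2 + c3 + c4"
  have le: "c1 \<le> c" "c2 \<le> c" "c3 \<le> c" "c4 \<le> c" "0 < c" using c1(1) c2(1) c3(1) c4(1) by (auto simp: c_def)
  show ?thesis
  proof (rule that[of c])
    show "\<forall>\<^sub>F x in F. norm (lagr_z \<phi> g (zn x) (lamn x) - (1 - \<alpha> x) *\<^sub>R L x) \<le> c * w x"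
      using c1(2) by eventually_elim (use le in blast)
    show "\<forall>\<^sub>F x in F. norm (g (zn x) + sn x - (1 - \<alpha> x) *\<^sub>R (g (z x) + s x)) \<le> c * w x"
      using c2(2) by eventually_elim (use le in blast)
    show "\<forall>\<^sub>F x in F. \<forall>i. \<bar>lamn x $ i * sn x $ i - (1 - \<alpha> x) * (lam x $ i * s x $ i)\<bar> \<le> c * w x"
      using c3(2)
    proof eventually_elim
      case (elim x)
      then have *: "norm (P x) \<le> c * w x" using le by blast
      show ?case
      proof
        fix i
        have "\<bar>P x $ i\<bar> \<le> c * w x" using component_le_norm_cart * by (rule order.trans)
        then show "\<bar>lamn x $ i * sn x $ i - (1 - \<alpha> x) * (lam x $ i * s x $ i)\<bar> \<le> c * w x" by (simp add: P_def)
      qed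
    qed
    show "\<forall>\<^sub>F x in F. \<bar>\<mu>n x - (1 - \<alpha> x) * \<mu> x\<bar> \<le> c * w x"
      using c4(2) by eventually_elim (use le in \<open>simp only: real_norm_def\<close>)
  qed (rule le)
qed

text \<open>Positivity of the new \<mu> is included because it is needed to treat the new points as
  central points again.\<close>

definition relaxed_centrality where
  "relaxed_centrality x \<longleftrightarrow> 0 < \<mu>n x \<and> norm (lagr_z \<phi> g (zn x) (lamn x)) \<le> C * (1 + \<tau> x) * \<mu>n x \<and>
     norm (g (zn x) + sn x) \<le> C * (1 + \<tau> x) * \<mu>n x \<and>
     (\<forall>i. \<gamma> * (1 - \<tau> x) * \<mu>n x \<le> lamn x $ i * sn x $ i)"

text \<open>The gain \<open>C * ta * ((1 - a) * m)\<close> has to pay for the residual error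
  \<open>c * v\<close> and for the loss \<open>C * (1 + ta) * (c * v)\<close> in \<open>m'\<close>,
  at most \<open>2 * C * (c * v)\<close>. Divided by \<open>C\<close>, this is the premise
  \<open>slack\<close>.\<close>

lemma relaxed_residual:
  fixes r :: "'b::real_normed_vector"
  assumes r: "norm (r - (1 - a) *\<^sub>R r0) \<le> c * v" and r0: "norm r0 \<le> C * m" and m': "\<bar>m' - (1 - a) * m\<bar> \<le> c * v"
    and slack: "(c / C + 2 * c) * v \<le> ta * ((1 - a) * m)"
    and a: "a \<le> 1" and ta: "0 < ta" "ta \<le> 1/2" and v: "0 \<le> c * v"
  shows "norm r \<le> C * (1 + ta) * m'"
proof -
  have "norm r \<le> norm ((1 - a) *\<^sub>R r0) + norm (r - (1 - a) *\<^sub>R r0)" by (metis add.commute norm_triangle_sub)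
  also have "norm ((1 - a) *\<^sub>R r0) = (1 - a) * norm r0" using a by simp
  also have "\<dots> \<le> (1 - a) * (C * m)" using r0 a by (intro mult_left_mono) auto
  finally have 1: "norm r \<le> C * ((1 - a) * m) + c * v" using r by (simp add: mult_ac)
  have "C * ((c / C + 2 * c) * v) \<le> C * (ta * ((1 - a) * m))" using slack C_pos by (intro mult_left_mono) auto
  moreover have "C * ((c / C + 2 * c) * v) = c * v + C * 2 * (c * v)" using C_pos by (simp add: distrib_left distrib_right)
  ultimately have 2: "c * v + C * 2 * (c * v) \<le> C * ta * ((1 - a) * m)" by (simp only: mult.assoc)
  have "C * (1 + ta) * (c * v) \<le> C * 2 * (c * v)"
    using ta C_pos v by (intro mult_right_mono mult_left_mono) auto
  moreover have "C * (1 + ta) * ((1 - a) * m - c * v) \<le> C * (1 + ta) * m'"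
    using m' C_pos ta by (intro mult_left_mono) (auto simp: abs_le_iff)
  moreover have "C * (1 + ta) * ((1 - a) * m - c * v) = C * ((1 - a) * m) + C * ta * ((1 - a) * m) - C * (1 + ta) * (c * v)"
    by (simp add: algebra_simps)
  ultimately show ?thesis using 1 2 by linarith
qed

lemma relaxed: "\<exists>Chat>0. \<forall>\<^sub>F x in F. \<alpha> x \<le> 1 - Chat * inverse (\<tau> x) * om x \<longrightarrow> relaxed_centrality x"
proof -
  obtain c where c: "c > 0" and bounds:
    "\<forall>\<^sub>F x in F. norm (lagr_z \<phi> g (zn x) (lamn x) - (1 - \<alpha> x) *\<^sub>R L x) \<le> c * w x"
    "\<forall>\<^sub>F x in F. norm (g (zn x) + sn x - (1 - \<alpha> x) *\<^sub>R (g (z x) + s x)) \<le> c * w x"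
    "\<forall>\<^sub>F x in F. \<forall>i. \<bar>lamn x $ i * sn x $ i - (1 - \<alpha> x) * (lam x $ i * s x $ i)\<bar> \<le> c * w x"
    "\<forall>\<^sub>F x in F. \<bar>\<mu>n x - (1 - \<alpha> x) * \<mu> x\<bar> \<le> c * w x"
    by (rule common_bound)
  \<comment> \<open>The first two summands serve the residuals. The products need
    \<open>c / \<gamma> + c\<close>, and positivity of the new \<mu> needs
    \<open>c < 2 * Chat\<close>, the factor 2 being the bound on the inverse of \<tau>.\<close>
  define Chat where "Chat = c / C + 2 * c + c / \<gamma>"
  have Chat: "Chat > 0" "c / C + 2 * c \<le> Chat" "c / \<gamma> + c \<le> Chat" "c < 2 * Chat"
    using c C_pos gamma by (auto simp: Chat_def add_pos_pos)
  have "\<forall>\<^sub>F x in F. \<alpha> x \<le> 1 - Chat * inverse (\<tau> x) * om x \<longrightarrow> relaxed_centrality x"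
    using bounds alpha tau mu_pos om_pos om_mu central
  proof eventually_elim
    case (elim x)
    show ?case
    proof
      assume le: "\<alpha> x \<le> 1 - Chat * inverse (\<tau> x) * om x"
      define m where "m = (1 - \<alpha> x) * \<mu> x"
      have w0: "0 < w x" using elim by (metis mult_pos_pos)
      have "Chat * om x \<le> \<tau> x * (1 - \<alpha> x)" using le elim(6) by (simp add: field_simps)
      then have "Chat * om x * \<mu> x \<le> \<tau> x * (1 - \<alpha> x) * \<mu> x" using elim(7) by (intro mult_right_mono) auto
      then have slack: "Chat * w x \<le> \<tau> x * m" unfolding elim(9)[symmetric] m_def by (simp only: mult.assoc)
      have m0: "0 \<le> m" using elim by (simp add: m_def)
      have "\<tau> x * m \<le> 1/2 * m" using elim m0 by (intro mult_right_mono) auto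
      with slack have "2 * Chat * w x \<le> m" by simp
      moreover have "c * w x < 2 * Chat * w x" using Chat w0 by simp
      ultimately have mn: "0 < \<mu>n x" using elim(4) unfolding m_def by linarith
      have s1: "(c / C + 2 * c) * w x \<le> \<tau> x * m" and s2: "(c / \<gamma> + c) * w x \<le> \<tau> x * m"
        using mult_right_mono[OF Chat(2), of "w x"] mult_right_mono[OF Chat(3), of "w x"] slack w0 by linarith+
      have cw: "0 \<le> c * w x" using c w0 by simp
      have cen: "norm (L x) \<le> C * \<mu> x" "norm (g (z x) + s x) \<le> C * \<mu> x" "\<And>i. \<gamma> * \<mu> x \<le> lam x $ i * s x $ i"
        using elim(10) by (simp_all add: centrality_def r_f_def r_g_def)
      have "\<gamma> * (1 - \<tau> x) * \<mu>n x \<le> lamn x $ i * sn x $ i" for i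
      proof -
        have "(1 - \<alpha> x) * (\<gamma> * \<mu> x) \<le> (1 - \<alpha> x) * (lam x $ i * s x $ i)"
          using cen(3)[of i] elim(5) by (intro mult_left_mono) auto
        moreover have "(1 - \<alpha> x) * (lam x $ i * s x $ i) - c * w x \<le> lamn x $ i * sn x $ i"
          using elim(3) by (simp only: abs_le_iff) (smt (verit))
        ultimately have 1: "\<gamma> * m - c * w x \<le> lamn x $ i * sn x $ i" by (simp add: m_def mult_ac)
        have "\<gamma> * (1 - \<tau> x) * \<mu>n x \<le> \<gamma> * (1 - \<tau> x) * (m + c * w x)"
          using elim(4,6) gamma by (intro mult_left_mono) (auto simp: m_def abs_le_iff)
        also have "\<dots> = \<gamma> * m - \<gamma> * (\<tau> x * m) + \<gamma> * (1 - \<tau> x) * (c * w x)" by (simp add: algebra_simps)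
        finally have 2: "\<gamma> * (1 - \<tau> x) * \<mu>n x \<le> \<gamma> * m - \<gamma> * (\<tau> x * m) + \<gamma> * (1 - \<tau> x) * (c * w x)" .
        have 3: "\<gamma> * (1 - \<tau> x) * (c * w x) \<le> \<gamma> * 1 * (c * w x)"
          using elim(6) gamma cw by (intro mult_right_mono mult_left_mono) auto
        have "\<gamma> * ((c / \<gamma> + c) * w x) \<le> \<gamma> * (\<tau> x * m)" using s2 gamma by (intro mult_left_mono) auto
        moreover have "\<gamma> * ((c / \<gamma> + c) * w x) = c * w x + \<gamma> * (c * w x)" using gamma by (simp add: distrib_left distrib_right)
        ultimately have "c * w x + \<gamma> * (c * w x) \<le> \<gamma> * (\<tau> x * m)" by simp
        with 1 2 3 show ?thesis by simp
      qed
      moreover have "norm (lagr_z \<phi> g (zn x) (lamn x)) \<le> C * (1 + \<tau> x) * \<mu>n x"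
        using elim(5,6) by (intro relaxed_residual[OF elim(1) cen(1) elim(4) s1[unfolded m_def] _ _ _ cw]) auto
      moreover have "norm (g (zn x) + sn x) \<le> C * (1 + \<tau> x) * \<mu>n x"
        using elim(5,6) by (intro relaxed_residual[OF elim(2) cen(2) elim(4) s1[unfolded m_def] _ _ _ cw]) auto
      ultimately show "relaxed_centrality x" using mn unfolding relaxed_centrality_def by blast
    qed
  qed
  with Chat(1) show ?thesis by blast
qed

text \<open>For \<tau> at most 1/2, relaxed centrality is centrality with \<open>2 * C\<close> and
  \<open>\<gamma> / 2\<close>, so \<open>dist_sol_mu\<close> applies to the new points. At the
  largest \<alpha> the new \<mu> is \<open>Chat * w / \<tau>\<close> up to
  \<open>O(w)\<close>.\<close>

lemma dist_after_step:
  assumes Chat: "Chat > 0" and rel: "\<forall>\<^sub>F x in F. \<alpha> x \<le> 1 - Chat * inverse (\<tau> x) * om x \<longrightarrow> relaxed_centrality x"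
  shows "\<exists>K'>0. \<forall>\<^sub>F x in F. \<alpha> x = 1 - Chat * inverse (\<tau> x) * om x \<longrightarrow>
     dist_sol \<phi> g zs (zn x) (lamn x) \<le> inverse (\<tau> x) * (K' * w x)"
proof -
  \<comment> \<open>Restricts to iterations with \<alpha> at its upper bound. The filter may become
    trivial, which is harmless for eventual statements.\<close>
  define F' where "F' = inf F (principal {x. \<alpha> x = 1 - Chat * inverse (\<tau> x) * om x})"
  have le: "F' \<le> F" by (simp add: F'_def)
  have pos: "\<forall>\<^sub>F x in F. \<forall>i. 0 < lamn x $ i \<or> 0 < sn x $ i"
    using positive_component_new by (simp only: eventually_all_finite)
  interpret new: central_family \<phi> g zs F' zn lamn sn "2 * C" "\<gamma> / 2"
  proof unfold_locales
    show "0 < \<gamma> / 2" using gamma by simp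
    show "((\<lambda>x. dist_sol \<phi> g zs (zn x) (lamn x)) \<longlongrightarrow> 0) F'" by (rule tendsto_mono[OF le dist_new_tendsto])
    show "(\<mu>n \<longlongrightarrow> 0) F'" by (rule tendsto_mono[OF le mu_new_tendsto])
    show "\<forall>\<^sub>F x in F'. centrality \<phi> g (2 * C) (\<gamma> / 2) (zn x) (lamn x) (sn x)"
      unfolding F'_def eventually_inf_principal
      using rel pos tau
    proof eventually_elim
      case (elim x)
      show ?case
      proof
        assume "x \<in> {x. \<alpha> x = 1 - Chat * inverse (\<tau> x) * om x}"
        then have rc: "relaxed_centrality x" using elim(1) by simp
        then have mn: "0 < \<mu>n x" by (simp add: relaxed_centrality_def)
        have "C * (1 + \<tau> x) * \<mu>n x \<le> C * 2 * \<mu>n x"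
          using C_pos mn elim(3) by (intro mult_right_mono mult_left_mono) auto
        moreover have half: "\<gamma> / 2 * \<mu>n x \<le> \<gamma> * (1 - \<tau> x) * \<mu>n x"
          using gamma mn elim(3) by (intro mult_right_mono) auto
        have prod: "\<gamma> / 2 * \<mu>n x \<le> lamn x $ i * sn x $ i" for i
          using rc half unfolding relaxed_centrality_def by (meson order.trans)
        moreover have "0 < lamn x $ i \<and> 0 < sn x $ i" for i
        proof -
          have "0 < \<gamma> / 2 * \<mu>n x" using gamma mn by simp
          then have "0 < lamn x $ i * sn x $ i" using prod by (rule less_le_trans)
          moreover have "0 < lamn x $ i \<or> 0 < sn x $ i" using elim(2) by blast
          ultimately show ?thesis by (metis zero_less_mult_pos zero_less_mult_pos2)
        qed
        ultimately show "centrality \<phi> g (2 * C) (\<gamma> / 2) (zn x) (lamn x) (sn x)"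
          using rc unfolding centrality_def relaxed_centrality_def r_f_def r_g_def
          by (simp add: mult.commute[of C 2])
      qed
    qed
  qed
  obtain c where c: "c > 0" "\<forall>\<^sub>F x in F'. norm (dist_sol \<phi> g zs (zn x) (lamn x)) \<le> c * \<bar>\<mu>n x\<bar>"
    using bigOE[OF new.dist_sol_mu] by auto
  obtain c' where c': "c' > 0" "\<forall>\<^sub>F x in F. norm (\<mu>n x - (1 - \<alpha> x) * \<mu> x) \<le> c' * \<bar>w x\<bar>"
    using bigOE[OF mu_new] by auto
  have "\<forall>\<^sub>F x in F. \<alpha> x = 1 - Chat * inverse (\<tau> x) * om x \<longrightarrow>
     dist_sol \<phi> g zs (zn x) (lamn x) \<le> inverse (\<tau> x) * (c * (Chat + c') * w x)"
    using c(2)[unfolded F'_def eventually_inf_principal] c'(2) tau w_nonneg om_mu rel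
  proof eventually_elim
    case (elim x)
    show ?case
    proof
      assume eq: "\<alpha> x = 1 - Chat * inverse (\<tau> x) * om x"
      then have 1: "dist_sol \<phi> g zs (zn x) (lamn x) \<le> c * \<bar>\<mu>n x\<bar>" using elim(1) by simp
      have mn: "0 < \<mu>n x" using elim(6) eq by (simp add: relaxed_centrality_def)
      have "(1 - \<alpha> x) * \<mu> x = inverse (\<tau> x) * (Chat * w x)"
        unfolding eq elim(5)[symmetric] by (simp add: mult_ac)
      then have "\<mu>n x \<le> inverse (\<tau> x) * (Chat * w x) + c' * w x" using elim(2,4) by (simp add: abs_le_iff)
      also have "c' * w x \<le> inverse (\<tau> x) * (c' * w x)"
        using mult_right_mono[of 1 "inverse (\<tau> x)" "c' * w x"] elim(3,4) c'(1) by (simp add: one_le_inverse_iff)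
      finally have "\<mu>n x \<le> inverse (\<tau> x) * ((Chat + c') * w x)" by (simp add: algebra_simps)
      then have "c * \<mu>n x \<le> c * (inverse (\<tau> x) * ((Chat + c') * w x))" using c(1) by (intro mult_left_mono) auto
      with 1 mn show "dist_sol \<phi> g zs (zn x) (lamn x) \<le> inverse (\<tau> x) * (c * (Chat + c') * w x)"
        by (simp add: mult_ac)
    qed
  qed
  moreover have "c * (Chat + c') > 0" using c(1) c'(1) Chat by simp
  ultimately show ?thesis by blast
qed

end

section \<open>The theorem\<close>

text \<open>Collects the real data over which the constants have to be uniform.\<close>

record ('n, 'm) iteration =
  it_z :: "real^'n"
  it_lam :: "real^'m"
  it_s :: "real^'m"
  it_t :: "real^'m"
  it_u :: real
  it_dz :: "real^'n"
  it_dlam :: "real^'m"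
  it_ds :: "real^'m"
  it_Fb :: "real^'n^'n"
  it_fb :: "real^'n"
  it_Fe :: "real^'m^'n"
  it_fe :: "real^'m"
  it_G :: "real^'m^'m"
  it_Fh :: "real^'n^'n"
  it_fh :: "real^'n"
  it_alpha :: real
  it_tau :: real

text \<open>Constants that depend on the problem data only correspond to eventual bounds along the filter
  with base \<open>admissible \<phi> g zs C \<gamma> K \<epsilon>\<close>, \<open>\<epsilon> > 0\<close>.\<close>

definition admissible ::
    "(real^'n \<Rightarrow> real) \<Rightarrow> (real^'n \<Rightarrow> real^'m) \<Rightarrow> real^'n \<Rightarrow> real \<Rightarrow> real \<Rightarrow> real \<Rightarrow> real \<Rightarrow> ('n, 'm) iteration set" where
  "admissible \<phi> g zs C \<gamma> K \<epsilon> = {x.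
     centrality \<phi> g C \<gamma> (it_z x) (it_lam x) (it_s x) \<and>
     norm (it_t x) \<le> K * (mu (it_lam x) (it_s x))\<^sup>2 \<and>
     dist_sol \<phi> g zs (it_z x) (it_lam x) \<le> \<epsilon> \<and> mu (it_lam x) (it_s x) \<le> \<epsilon> \<and>
     0 < it_u x \<and> it_u x / mu (it_lam x) (it_s x) \<le> \<epsilon> \<and>
     rounded_step \<phi> g zs K (it_u x) (it_z x) (it_lam x) (it_s x) (it_t x) (it_dz x) (it_dlam x) (it_ds x)
       (it_Fb x) (it_fb x) (it_Fe x) (it_fe x) (it_G x) (it_Fh x) (it_fh x) \<and>
     0 \<le> it_alpha x \<and> it_alpha x \<le> 1 \<and> 0 < it_tau x \<and> it_tau x \<le> 1/2}"

lemma centrality_mu_pos: "centrality \<phi> g C \<gamma> z lam s \<Longrightarrow> 0 < mu lam s"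
  unfolding mu_def inner_vec_def centrality_def by (auto intro!: divide_pos_pos sum_pos)

lemma eventually_INF_admissible:
  "eventually P (INF \<epsilon>\<in>{0<..}. principal (admissible \<phi> g zs C \<gamma> K \<epsilon>)) \<longleftrightarrow>
     (\<exists>\<epsilon>>0. \<forall>x\<in>admissible \<phi> g zs C \<gamma> K \<epsilon>. P x)"
proof (subst eventually_INF_base)
  fix a b :: real assume "a \<in> {0<..}" "b \<in> {0<..}"
  then show "\<exists>x\<in>{0<..}. principal (admissible \<phi> g zs C \<gamma> K x)
       \<le> inf (principal (admissible \<phi> g zs C \<gamma> K a)) (principal (admissible \<phi> g zs C \<gamma> K b))"
    by (intro bexI[of _ "min a b"]) (auto simp: admissible_def)
qed (auto simp: eventually_principal)

theorem theorem5p3: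
  fixes \<phi> :: "real^'n \<Rightarrow> real" and g :: "real^'n \<Rightarrow> real^'m" and zs :: "real^'n"
    and C \<gamma> K :: real
    and r :: nat and p :: "nat \<Rightarrow> real^'n" and \<sigma> :: "nat \<Rightarrow> real" and q :: "nat \<Rightarrow> real^'m"
  assumes "twice_lipschitz_diff \<phi>"
    and "\<And>i. twice_lipschitz_diff (\<lambda>z. g z $ i)"
    and "nlp_solution \<phi> g zs"
    and "multipliers \<phi> g zs \<noteq> {}"
    and "mfcq g zs"
    and "second_order \<phi> g zs"
    and "strict_compl \<phi> g zs"
    and "svd_cols (grad_cols g zs) (active g zs) r p \<sigma> q"
    and "0 < C" and "0 < \<gamma>" and "\<gamma> < 1" and "0 < K"
  shows "\<exists>\<epsilon>>0. \<exists>\<eta>>0. \<exists>\<beta>\<^sub>0>0. \<exists>K'>0. \<exists>Chat>0.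
    \<forall>(\<beta>::real) (u::real) (\<FF>::real set) (fl::(real \<Rightarrow> real \<Rightarrow> real) \<Rightarrow> real \<Rightarrow> real \<Rightarrow> real)
      (z::real^'n) (lam::real^'m) (s::real^'m) (t::real^'m)
      (dz::real^'n) (dlam::real^'m) (ds::real^'m) (\<mu>::real).
      \<mu> = mu lam s \<longrightarrow>
      centrality \<phi> g C \<gamma> z lam s \<longrightarrow>
      norm t \<le> K * \<mu>\<^sup>2 \<longrightarrow>
      dist_sol \<phi> g zs z lam \<le> \<epsilon> \<longrightarrow> \<mu> \<le> \<epsilon> \<longrightarrow>
      u / \<mu> \<le> \<eta> \<longrightarrow> u \<le> \<eta> \<longrightarrow> \<beta> \<ge> \<beta>\<^sub>0 \<longrightarrow>
      conditioning \<phi> g zs r p \<sigma> \<beta> u \<mu> \<longrightarrow>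
      float_model \<FF> fl u \<longrightarrow>
      float_vec \<FF> z \<longrightarrow> float_vec \<FF> lam \<longrightarrow> float_vec \<FF> s \<longrightarrow> float_vec \<FF> t \<longrightarrow>
      computed_step \<phi> g zs K \<FF> fl u z lam s t dz dlam ds \<longrightarrow>
      (\<forall>\<tau>. 0 < \<tau> \<and> \<tau> \<le> 1/2 \<longrightarrow>
        (\<forall>\<alpha>. 0 \<le> \<alpha> \<and> \<alpha> \<le> 1 - Chat * inverse \<tau> * (u / \<mu> + \<mu>) \<longrightarrow>
           norm (r_f \<phi> g (z + \<alpha> *\<^sub>R dz) (lam + \<alpha> *\<^sub>R dlam))
             \<le> C * (1 + \<tau>) * mu (lam + \<alpha> *\<^sub>R dlam) (s + \<alpha> *\<^sub>R ds) \<and>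
           norm (r_g g (z + \<alpha> *\<^sub>R dz) (s + \<alpha> *\<^sub>R ds))
             \<le> C * (1 + \<tau>) * mu (lam + \<alpha> *\<^sub>R dlam) (s + \<alpha> *\<^sub>R ds) \<and>
           (\<forall>i. (lam $ i + \<alpha> * dlam $ i) * (s $ i + \<alpha> * ds $ i)
             \<ge> \<gamma> * (1 - \<tau>) * mu (lam + \<alpha> *\<^sub>R dlam) (s + \<alpha> *\<^sub>R ds))) \<and>
        (\<forall>\<alpha>. \<alpha> = 1 - Chat * inverse \<tau> * (u / \<mu> + \<mu>) \<and> 0 \<le> \<alpha> \<longrightarrow>
           dist_sol \<phi> g zs (z + \<alpha> *\<^sub>R dz) (lam + \<alpha> *\<^sub>R dlam)
             \<le> inverse \<tau> * (K' * u + K' * \<mu>\<^sup>2)))"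
proof -
  let ?adm = "admissible \<phi> g zs C \<gamma> K"
  define F where "F = (INF \<epsilon>\<in>{0<..}. principal (?adm \<epsilon>))"
  note ev = eventually_INF_admissible[of _ \<phi> g zs C \<gamma> K, folded F_def]
  let ?\<mu> = "\<lambda>x :: ('n, 'm) iteration. mu (it_lam x) (it_s x)"
  have null: "(f \<longlongrightarrow> 0) F" if "\<And>x \<epsilon>. x \<in> ?adm \<epsilon> \<Longrightarrow> \<bar>f x\<bar> \<le> \<epsilon>" for f :: "('n, 'm) iteration \<Rightarrow> real"
  proof (rule tendstoI)
    fix e :: real assume e: "0 < e"
    \<comment> \<open>Half of \<open>e\<close>, because membership in the admissible set gives only
      a non-strict inequality.\<close>
    have "dist (f x) 0 < e" if "x \<in> ?adm (e / 2)" for x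
      using \<open>\<And>x \<epsilon>. x \<in> ?adm \<epsilon> \<Longrightarrow> \<bar>f x\<bar> \<le> \<epsilon>\<close>[OF that] e by simp
    then show "\<forall>\<^sub>F x in F. dist (f x) 0 < e" unfolding ev using e by (intro exI[of _ "e / 2"]) simp
  qed
  have mu_pos: "0 < ?\<mu> x" if "x \<in> ?adm \<epsilon>" for x \<epsilon>
    using that by (auto simp: admissible_def intro: centrality_mu_pos)
  have evI: "eventually P F" if "\<And>x. x \<in> ?adm 1 \<Longrightarrow> P x" for P
    unfolding ev using that by (intro exI[of _ 1]) simp
  interpret damped_step_family \<phi> g zs F it_z it_lam it_s C \<gamma> K it_u it_t it_dz it_dlam it_ds
    it_Fb it_fb it_Fe it_fe it_G it_Fh it_fh it_alpha it_tau
  proof unfold_locales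
    show "(?\<mu> \<longlongrightarrow> 0) F"
      by (rule null) (use mu_pos in \<open>force simp: admissible_def\<close>)
    show "((\<lambda>x. dist_sol \<phi> g zs (it_z x) (it_lam x)) \<longlongrightarrow> 0) F"
      by (rule null) (auto simp: admissible_def dist_sol_def infdist_nonneg)
    show "((\<lambda>x. it_u x / ?\<mu> x) \<longlongrightarrow> 0) F"
    proof (rule null)
      fix x \<epsilon> assume x: "x \<in> ?adm \<epsilon>"
      then have "0 \<le> it_u x / ?\<mu> x" using mu_pos[OF x] by (simp add: admissible_def)
      with x show "\<bar>it_u x / ?\<mu> x\<bar> \<le> \<epsilon>" by (simp only: abs_of_nonneg) (simp add: admissible_def)
    qed
  qed (rule evI, simp add: admissible_def | fact assms)+
  obtain Chat where Chat: "Chat > 0" and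
    rel: "\<forall>\<^sub>F x in F. it_alpha x \<le> 1 - Chat * inverse (it_tau x) * om x \<longrightarrow> relaxed_centrality x"
    using relaxed by blast
  obtain K' where K': "K' > 0" and
    dist: "\<forall>\<^sub>F x in F. it_alpha x = 1 - Chat * inverse (it_tau x) * om x \<longrightarrow>
     dist_sol \<phi> g zs (zn x) (lamn x) \<le> inverse (it_tau x) * (K' * w x)"
    using dist_after_step[OF Chat rel] by blast
  obtain \<epsilon>' where \<epsilon>': "\<epsilon>' > 0" and conc: "\<And>x. x \<in> ?adm \<epsilon>' \<Longrightarrow>
      (it_alpha x \<le> 1 - Chat * inverse (it_tau x) * om x \<longrightarrow> relaxed_centrality x) \<and>
      (it_alpha x = 1 - Chat * inverse (it_tau x) * om x \<longrightarrow>
        dist_sol \<phi> g zs (zn x) (lamn x) \<le> inverse (it_tau x) * (K' * w x))"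
    using eventually_conj[OF rel dist] unfolding ev by blast
  \<comment> \<open>The bound 1 ensures \<open>u \<le> 1\<close>, as the rounding estimates require;
    the same number also serves as \<eta>.\<close>
  define \<epsilon> where "\<epsilon> = min 1 \<epsilon>'"
  have \<epsilon>: "\<epsilon> > 0" "\<epsilon> \<le> 1" "\<epsilon> \<le> \<epsilon>'" using \<epsilon>' by (auto simp: \<epsilon>_def)
  have main: "(\<alpha> \<le> 1 - Chat * inverse \<tau> * (u / mu lam s + mu lam s) \<longrightarrow>
        norm (r_f \<phi> g (z + \<alpha> *\<^sub>R dz) (lam + \<alpha> *\<^sub>R dlam))
             \<le> C * (1 + \<tau>) * mu (lam + \<alpha> *\<^sub>R dlam) (s + \<alpha> *\<^sub>R ds) \<and>
        norm (r_g g (z + \<alpha> *\<^sub>R dz) (s + \<alpha> *\<^sub>R ds))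
             \<le> C * (1 + \<tau>) * mu (lam + \<alpha> *\<^sub>R dlam) (s + \<alpha> *\<^sub>R ds) \<and>
        (\<forall>i. (lam $ i + \<alpha> * dlam $ i) * (s $ i + \<alpha> * ds $ i)
             \<ge> \<gamma> * (1 - \<tau>) * mu (lam + \<alpha> *\<^sub>R dlam) (s + \<alpha> *\<^sub>R ds))) \<and>
      (\<alpha> = 1 - Chat * inverse \<tau> * (u / mu lam s + mu lam s) \<longrightarrow>
        dist_sol \<phi> g zs (z + \<alpha> *\<^sub>R dz) (lam + \<alpha> *\<^sub>R dlam)
             \<le> inverse \<tau> * (K' * u + K' * (mu lam s)\<^sup>2))"
    if cen: "centrality \<phi> g C \<gamma> z lam s" and t: "norm t \<le> K * (mu lam s)\<^sup>2"
      and d: "dist_sol \<phi> g zs z lam \<le> \<epsilon>" and m: "mu lam s \<le> \<epsilon>" and um: "u / mu lam s \<le> \<epsilon>" and u1: "u \<le> \<epsilon>"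
      and fm: "float_model \<FF> fl u" and fv: "float_vec \<FF> lam" "float_vec \<FF> s" "float_vec \<FF> t"
      and cs: "computed_step \<phi> g zs K \<FF> fl u z lam s t dz dlam ds"
      and \<tau>: "0 < \<tau>" "\<tau> \<le> 1/2" and \<alpha>: "0 \<le> \<alpha>" "\<alpha> \<le> 1 - Chat * inverse \<tau> * (u / mu lam s + mu lam s)"
    for u \<FF> fl z lam s t dz dlam ds \<tau> \<alpha>
  proof -
    have u0: "0 < u" using fm by (simp add: float_model_def)
    have mp: "0 < mu lam s" using cen by (rule centrality_mu_pos)
    have "lam $ i > 0" for i using cen by (simp add: centrality_def)
    then obtain Fb fb Fe fe G Fh fh where rs: "rounded_step \<phi> g zs K u z lam s t dz dlam ds Fb fb Fe fe G Fh fh"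
      using computed_step_rounded[OF cs fm _ fv] u1 \<epsilon>(2) by force
    define x :: "('n, 'm) iteration" where "x = \<lparr>it_z = z, it_lam = lam, it_s = s, it_t = t, it_u = u,
      it_dz = dz, it_dlam = dlam, it_ds = ds, it_Fb = Fb, it_fb = fb, it_Fe = Fe, it_fe = fe, it_G = G,
      it_Fh = Fh, it_fh = fh, it_alpha = \<alpha>, it_tau = \<tau>\<rparr>"
    \<comment> \<open>Gives \<alpha> at most 1, which is part of admissibility.\<close>
    have "0 \<le> Chat * inverse \<tau> * (u / mu lam s + mu lam s)" using Chat \<tau> u0 mp by simp
    then have "x \<in> ?adm \<epsilon>'"
      using cen t d m um rs \<tau> \<alpha> u0 \<epsilon>(3) by (simp add: admissible_def x_def)
    from conc[OF this] show ?thesis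
      unfolding relaxed_centrality_def om_def w_def
      by (simp add: x_def r_f_def r_g_def power2_eq_square distrib_left)
  qed
  show ?thesis
    by (rule exI[of _ \<epsilon>], rule conjI[OF \<epsilon>(1)], rule exI[of _ \<epsilon>], rule conjI[OF \<epsilon>(1)],
        rule exI[of _ 1], rule conjI[OF zero_less_one], rule exI[of _ K'], rule conjI[OF K'],
        rule exI[of _ Chat], rule conjI[OF Chat], intro allI impI conjI)
      (use main in \<open>blast\<close>)+
qed

end
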